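(* Let $G$ be a bicyclic graph, i.e. a finite simple connected graph with $n$ vertices and $n+1$ edges, and let $\lambda_2(G)$ be its second largest distance eigenvalue. Then $\lambda_2(G)<-\frac{1}{2}$ if and only if one of the following holds: (i) $G$ is isomorphic to one of the seven graphs $B_1,\dots,B_7$; (ii) $G\cong B(s;h_1,h_2,h_3,h_4)$ for some integers $s\ge 0$ and $h_1,h_2,h_3,h_4\ge 0$; (iii) $G\cong B^{\infty}_t$ for some integer $t\ge 0$; (iv) $G\cong B^{\theta}_k$ for some integer $k\ge 0$. (The graphs named here are defined in the context.)
   Context: For a connected simple graph $G$ on vertices $v_1,\dots,v_n$, $n\ge2$, the distance matrix is $D(G)=(d_G(v_i,v_j))$, where $d_G(u,v)$ is the length of a shortest path between $u$ and $v$; its eigenvalues with multiplicity are $\lambda_1(G)\ge\lambda_2(G)\ge\dots\ge\lambda_n(G)$, and $\lambda_2(G)$ is the second largest distance eigenvalue. Attaching a pendant path of length $r\ge 1$ at a vertex $u_0$ means adding new vertices $u_1,\dots,u_r$ and the edges $u_0u_1,u_1u_2,\dots,u_{r-1}u_r$; for $r=0$ nothing is added. A pendant edge is a pendant path of length $1$. $\infty(3,3,s)$, for $s\ge 0$: take a triangle $a_1a_2a_3$, a triangle $b_1b_2b_3$ and a path $p_0p_1\cdots p_s$ of length $s$, and identify $a_1$ with $p_0$ and $b_1$ with $p_s$ (so for $s=0$ the two triangles share exactly the one vertex $a_1=b_1$). $B(s;h_1,h_2,h_3,h_4)$: obtained from $\infty(3,3,s)$ by attaching pendant paths of lengths $h_1,h_2,h_3,h_4\ge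 0$ at $a_2,a_3,b_2,b_3$, respectively. $B^{\infty}_t$, $t\ge 0$: obtained from $\infty(3,3,0)$ by attaching $t$ pendant edges at the vertex common to the two triangles. $\theta(2,2,1)$: the complete graph $K_4$ minus one edge; let $x,y$ be its two vertices of degree three. $B^{\theta}_k$, $k\ge 0$: obtained from $\theta(2,2,1)$ by attaching $k$ pendant edges at $x$. $B_1$: obtained from $\infty(3,3,1)$ by attaching two pendant edges at $a_2$. $B_2$: obtained from $\infty(3,3,2)$ by attaching one pendant edge at $a_1$ and one pendant edge at $b_1$. $B_3$: obtained from $\infty(3,3,2)$ by attaching one pendant edge at $a_1$. $B_4$: obtained from $\infty(3,3,0)$ by attaching one pendant edge at the vertex common to the two triangles and a pendant path of length $2$ at $a_2$. $B_5$: obtained from $\infty(3,3,0)$ by attaching one pendant edge at the vertex common to the two triangles and one pendant edge at $a_2$. $B_6$: obtained from $\theta(2,2,1)$ by attaching one pendant edge at $x$ and one pendant edge at $y$. $B_7$: obtained from $\theta(2,2,1)$ by attaching two pendant edges at $x$ and one pendant edge at $y$. *)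

theory Defs
  imports "Jordan_Normal_Form.Char_Poly" "HOL-Library.Multiset"
begin

(* Undirected graphs: a vertex set together with a set of two-element edge sets. *)

type_synonym 'a graph = "'a set \<times> 'a set set"

abbreviation verts :: "'a graph \<Rightarrow> 'a set" where "verts G \<equiv> fst G"
abbreviation edges :: "'a graph \<Rightarrow> 'a set set" where "edges G \<equiv> snd G"

definition simple_graph :: "'a graph \<Rightarrow> bool" where
  "simple_graph G \<longleftrightarrow> finite (verts G) \<and> edges G \<subseteq> {e. e \<subseteq> verts G \<and> card e = 2}"

definition is_path :: "'a graph \<Rightarrow> 'a \<Rightarrow> 'a list \<Rightarrow> 'a \<Rightarrow> bool" where
  "is_path G u p v \<longleftrightarrow> p \<noteq> [] \<and> hd p = u \<and> last p = v \<and> distinct p \<and> set p \<subseteq> verts G \<and>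
     successively (\<lambda>x y. {x, y} \<in> edges G) p"

definition connected_graph :: "'a graph \<Rightarrow> bool" where
  "connected_graph G \<longleftrightarrow> verts G \<noteq> {} \<and> (\<forall>u\<in>verts G. \<forall>v\<in>verts G. \<exists>p. is_path G u p v)"

(* The length of a path counts its edges, so it is one less than the number of listed vertices. *)
definition graph_dist :: "'a graph \<Rightarrow> 'a \<Rightarrow> 'a \<Rightarrow> nat" where
  "graph_dist G u v = (LEAST k. \<exists>p. is_path G u p v \<and> length p = Suc k)"

definition bicyclic :: "'a graph \<Rightarrow> bool" where
  "bicyclic G \<longleftrightarrow> simple_graph G \<and> connected_graph G \<and> card (edges G) = card (verts G) + 1"

definition graph_iso :: "'a graph \<Rightarrow> 'b graph \<Rightarrow> bool" where
  "graph_iso G H \<longleftrightarrow> (\<exists>f. bij_betw f (verts G) (verts H) \<and>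
     (\<forall>u\<in>verts G. \<forall>v\<in>verts G. {u, v} \<in> edges G \<longleftrightarrow> {f u, f v} \<in> edges H))"

(* The list vs enumerates the vertices v_1, ..., v_n (without repetition). *)
definition distance_matrix :: "'a graph \<Rightarrow> 'a list \<Rightarrow> real mat" where
  "distance_matrix G vs = mat (length vs) (length vs) (\<lambda>(i, j). real (graph_dist G (vs ! i) (vs ! j)))"

(* The k-th largest (k = 1, 2, ...) real eigenvalue, counted with algebraic multiplicity.
   A distance matrix is real symmetric, so all n eigenvalues are real. *)
definition kth_eigenvalue :: "real mat \<Rightarrow> nat \<Rightarrow> real" where
  "kth_eigenvalue A k = rev (sorted_list_of_multiset (proots (char_poly A))) ! (k - 1)"

definition distance_eigenvalue :: "'a graph \<Rightarrow> 'a list \<Rightarrow> nat \<Rightarrow> real" where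
  "distance_eigenvalue G vs k = kth_eigenvalue (distance_matrix G vs) k"

(* Attaches a pendant path of length r at u; its i-th new vertex (1 <= i <= r) is
   Max (verts G) + i, so the old vertices keep their names under repeated attachment. *)
definition attach_path :: "nat \<Rightarrow> nat \<Rightarrow> nat graph \<Rightarrow> nat graph" where
  "attach_path u r G =
     (let w = (\<lambda>i. if i = 0 then u else Max (verts G) + i)
      in (verts G \<union> w ` {1..r}, edges G \<union> {{w i, w (Suc i)} | i. i < r}))"

definition attach_edges :: "nat \<Rightarrow> nat \<Rightarrow> nat graph \<Rightarrow> nat graph" where
  "attach_edges u t = attach_path u 1 ^^ t"

(* The graph infinity(3,3,s): the path vertex p_i is i, so a_1 = 0 and b_1 = s, and
   a_2, a_3, b_2, b_3 are s + 1, s + 2, s + 3, s + 4. *)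
definition infinity_graph :: "nat \<Rightarrow> nat graph" where
  "infinity_graph s =
     ({0..s + 4},
      {{i, Suc i} | i. i < s} \<union>
      {{0, s + 1}, {0, s + 2}, {s + 1, s + 2}} \<union>
      {{s, s + 3}, {s, s + 4}, {s + 3, s + 4}})"

(* The graph theta(2,2,1), i.e. K_4 minus the edge {2, 3}; x = 0 and y = 1. *)
definition theta_graph :: "nat graph" where
  "theta_graph = ({0, 1, 2, 3}, {{0, 1}, {0, 2}, {0, 3}, {1, 2}, {1, 3}})"

definition B_paths :: "nat \<Rightarrow> nat \<Rightarrow> nat \<Rightarrow> nat \<Rightarrow> nat \<Rightarrow> nat graph" where
  "B_paths s h1 h2 h3 h4 =
     attach_path (s + 4) h4 (attach_path (s + 3) h3
       (attach_path (s + 2) h2 (attach_path (s + 1) h1 (infinity_graph s))))"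

definition B_inf :: "nat \<Rightarrow> nat graph" where
  "B_inf t = attach_edges 0 t (infinity_graph 0)"

definition B_theta :: "nat \<Rightarrow> nat graph" where
  "B_theta k = attach_edges 0 k theta_graph"

(* In infinity_graph 0, 1, 2 the vertex a_2 is 1, 2, 3, respectively. *)

definition B1 :: "nat graph" where
  "B1 = attach_edges 2 2 (infinity_graph 1)"

definition B2 :: "nat graph" where
  "B2 = attach_edges 2 1 (attach_edges 0 1 (infinity_graph 2))"

definition B3 :: "nat graph" where
  "B3 = attach_edges 0 1 (infinity_graph 2)"

definition B4 :: "nat graph" where
  "B4 = attach_path 1 2 (attach_edges 0 1 (infinity_graph 0))"

definition B5 :: "nat graph" where
  "B5 = attach_edges 1 1 (attach_edges 0 1 (infinity_graph 0))"

definition B6 :: "nat graph" where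
  "B6 = attach_edges 1 1 (attach_edges 0 1 theta_graph)"

definition B7 :: "nat graph" where
  "B7 = attach_edges 1 1 (attach_edges 0 2 theta_graph)"

end

(* By the spectral theorem, lambda_2 < -1/2 holds if and only if the quadratic form
   x^T (D + I/2) x is negative on some hyperplane; this property passes to isometric subgraphs and
   is refuted by a plane on which the form is nonnegative.

   Testing it on the vectors (1, -1, 1, -1) and (1, 1, 1, 1) on four vertices shows that in such a
   graph every locally geodesic walk is a geodesic. Hence the ends of a diametral path of a bicyclic
   graph without leaves lie in triangles, which already makes up the whole graph: it is theta(2,2,1)
   or infinity(3,3,s). Removing leaves one at a time, every other case is one of these cores with
   trees attached. Distances in an induced configuration are forced by the local geodesics, so finitely
   many explicit configurations, together with one infinite family of tripods, reduced to two members
   by contracting pairs of path edges, exclude everything outside the list.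

   Conversely, on vectors of sum zero the form of a block graph is a sum over blocks, from which its
   sign for B(s;h1,h2,h3,h4) follows by adding one block at a time; the graphs with a dominating
   vertex use the hyperplane x_c + 2 (sum of the other entries) = 0, and the rest are finitely many
   factorisations. *)

theory Submission
  imports Defs "Jordan_Normal_Form.Schur_Decomposition"
begin

section \<open>The second largest eigenvalue and the distance form\<close>

text \<open>Asking for some hyperplane, with no eigenvector named, turns both directions into finite
  certificates. To exclude a configuration one integer vector is enough, because the second vector
  of the plane is always the all-ones vector. To show that a small graph qualifies, one triangular
  factorisation of a multiple of 2D + I is enough: its first row is the hyperplane and all later
  pivots are negative. The tripods are an unavoidable infinite family, since a branching and a
  triangle can be arbitrarily far apart. Contracting a single edge cannot reduce them: distance 2 is
  realised inside \<open>B1\<close>, distance 1 is impossible. Two edges at a time work, starting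
  from distances 1 and 4. The graphs of the statement label new vertices by \<open>Max + i\<close>,
  so labels depend on the order of attachment. The classification is therefore carried out on
  vertices written as triples (core vertex, leg, depth), where automorphisms act on the first entry
  only, and is translated back at the end.\<close>

text \<open>A complex eigenvector \<open>z\<close> exists. The number \<open>z\<close>* A
  \<open>z\<close> = \<open>a\<close> |\<open>z\<close>|^2 equals its own conjugate by symmetry, so
  \<open>a\<close> is real, and then the real and the imaginary part of \<open>z\<close> both
  satisfy the eigenvector equation. At least one of them is nonzero.\<close>

lemma symmetric_real_eigenvector:
  fixes A :: "real mat"
  assumes A: "A \<in> carrier_mat n n" and sym: "transpose_mat A = A" and n: "n \<noteq> 0"
  obtains v e where "v \<in> carrier_vec n" "v \<noteq> 0\<^sub>v n" "A *\<^sub>v v = e \<cdot>\<^sub>v v"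
proof -
  let ?c = "complex_of_real"
  define C where "C = map_mat ?c A"
  have C: "C \<in> carrier_mat n n" using A by (simp add: C_def)
  obtain as where as: "char_poly C = (\<Prod>a\<leftarrow>as. [:- a, 1:])" "length as = n"
    using char_poly_factorized[OF C] by blast
  then obtain a as' where "as = a # as'" using n by (cases as) auto
  then have "poly (char_poly C) a = 0" using as by simp
  then have "eigenvalue C a" using eigenvalue_root_char_poly[OF C] by simp
  then obtain z where z: "z \<in> carrier_vec n" "z \<noteq> 0\<^sub>v n" "C *\<^sub>v z = a \<cdot>\<^sub>v z"
    unfolding eigenvalue_def eigenvector_def using C by auto
  have zi: "(\<Sum>j<n. ?c (A $$ (i, j)) * z $ j) = a * z $ i" if "i < n" for i
  proof -
    have "(C *\<^sub>v z) $ i = (\<Sum>j<n. ?c (A $$ (i, j)) * z $ j)"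
      using that z(1) A by (auto simp: scalar_prod_def C_def row_def atLeast0LessThan intro!: sum.cong)
    moreover have "(C *\<^sub>v z) $ i = a * z $ i" unfolding z(3) using z(1) that by simp
    ultimately show ?thesis by simp
  qed
  have As: "A $$ (i, j) = A $$ (j, i)" if "i < n" "j < n" for i j
    using sym A that by (metis carrier_matD index_transpose_mat(1))
  define N where "N = (\<Sum>i<n. (cmod (z $ i))\<^sup>2)"
  have N0: "N \<noteq> 0"
  proof
    assume "N = 0"
    then have "\<forall>i\<in>{..<n}. (cmod (z $ i))\<^sup>2 = 0"
      unfolding N_def by (subst (asm) sum_nonneg_eq_0_iff) auto
    then show False using z by (auto intro!: eq_vecI)
  qed
  have T: "(\<Sum>i<n. cnj (z $ i) * (\<Sum>j<n. ?c (A $$ (i, j)) * z $ j)) = a * ?c N"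
  proof -
    have "(\<Sum>i<n. cnj (z $ i) * (\<Sum>j<n. ?c (A $$ (i, j)) * z $ j)) = (\<Sum>i<n. a * ?c ((cmod (z $ i))\<^sup>2))"
      by (intro sum.cong refl, subst zi) (simp_all add: complex_norm_square mult.commute mult.left_commute del: of_real_power)
    then show ?thesis by (simp add: N_def sum_distrib_left)
  qed
  have "cnj (a * ?c N) = a * ?c N"
  proof -
    have "cnj (a * ?c N) = (\<Sum>i<n. \<Sum>j<n. z $ i * ?c (A $$ (i, j)) * cnj (z $ j))"
      unfolding T[symmetric] by (simp add: sum_distrib_left mult.assoc)
    also have "\<dots> = (\<Sum>j<n. \<Sum>i<n. z $ i * ?c (A $$ (i, j)) * cnj (z $ j))"
      by (rule sum.swap)
    also have "\<dots> = (\<Sum>j<n. \<Sum>i<n. cnj (z $ j) * (?c (A $$ (j, i)) * z $ i))"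
      by (intro sum.cong refl) (simp add: As mult.commute mult.left_commute)
    also have "\<dots> = a * ?c N" unfolding T[symmetric] by (simp add: sum_distrib_left)
    finally show ?thesis .
  qed
  then have "cnj a = a" using N0 by simp
  then have a: "a = ?c (Re a)" by (simp add: complex_eq_iff)
  have re: "(\<Sum>j<n. A $$ (i, j) * Re (z $ j)) = Re a * Re (z $ i)"
   and im: "(\<Sum>j<n. A $$ (i, j) * Im (z $ j)) = Re a * Im (z $ i)" if "i < n" for i
    using arg_cong[OF zi[OF that], of Re] arg_cong[OF zi[OF that], of Im] by (subst (asm) (2) a, simp)+
  have ev: "A *\<^sub>v vec n f = Re a \<cdot>\<^sub>v vec n f"
    if "\<And>i. i < n \<Longrightarrow> (\<Sum>j<n. A $$ (i, j) * f j) = Re a * f i" for f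
    using A that by (intro eq_vecI) (auto simp: scalar_prod_def row_def atLeast0LessThan)
  show ?thesis
  proof (cases "vec n (\<lambda>i. Re (z $ i)) = 0\<^sub>v n")
    case False
    then show ?thesis using that[of "vec n (\<lambda>i. Re (z $ i))"] ev re by auto
  next
    case True
    have "vec n (\<lambda>i. Im (z $ i)) \<noteq> 0\<^sub>v n"
    proof
      assume "vec n (\<lambda>i. Im (z $ i)) = 0\<^sub>v n"
      with True have "Re (z $ i) = 0 \<and> Im (z $ i) = 0" if "i < n" for i
        using that by (metis index_vec index_zero_vec(1))
      then show False using z by (auto intro!: eq_vecI simp: complex_eq_iff)
    qed
    then show ?thesis using that[of "vec n (\<lambda>i. Im (z $ i))"] ev im by auto
  qed
qed

text \<open>Gram-Schmidt leaves the first vector of a basis unchanged, so after normalising, column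
  0 is still a multiple of \<open>v\<close>.\<close>

lemma orthonormal_completion:
  fixes v :: "real vec"
  assumes v: "v \<in> carrier_vec n" "v \<noteq> 0\<^sub>v n"
  obtains W c where "W \<in> carrier_mat n n" "transpose_mat W * W = 1\<^sub>m n" "col W 0 = c \<cdot>\<^sub>v v"
proof -
  interpret cof_vec_space n "TYPE(real)" .
  define b where "b = basis_completion v"
  define ws where "ws = gram_schmidt n b"
  from basis_completion[OF v, folded b_def]
  have dist_b: "distinct b" and indep: "\<not> lin_dep (set b)" and b: "set b \<subseteq> carrier_vec n"
    and hdb: "hd b = v" and len_b: "length b = n" by auto
  have n: "n \<noteq> 0" using v by (auto intro: eq_vecI)
  from hdb len_b n obtain vs where bv: "b = v # vs" by (cases b, auto)
  from gram_schmidt_result[OF b dist_b indep refl, folded ws_def]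
  have ws: "set ws \<subseteq> carrier_vec n" "corthogonal ws" "length ws = n"
    by (auto simp: len_b)
  from gram_schmidt_hd[OF v(1), of vs, folded bv] have hdws: "hd ws = v" unfolding ws_def .
  define f where "f w = (1 / sqrt (w \<bullet> w)) \<cdot>\<^sub>v w" for w :: "real vec"
  define W where "W = mat_of_cols n (map f ws)"
  have W: "W \<in> carrier_mat n n" using mat_of_cols_carrier(1)[of n "map f ws"] ws by (simp add: W_def)
  have wsi: "ws ! i \<in> carrier_vec n" if "i < n" for i using ws that by auto
  have colW: "col W i = f (ws ! i)" if "i < n" for i
    unfolding W_def using that ws wsi[OF that] by (subst col_mat_of_cols) (auto simp: f_def)
  have o: "(ws ! i \<bullet> ws ! j = 0) = (i \<noteq> j)" if "i < n" "j < n" for i j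
    using corthogonalD[OF ws(2), of i j] that ws by (simp add: conjugate_vec_def)
  have "transpose_mat W * W = 1\<^sub>m n"
  proof (rule eq_matI)
    fix i j assume "i < dim_row (1\<^sub>m n :: real mat)" "j < dim_col (1\<^sub>m n :: real mat)"
    then have ij: "i < n" "j < n" by auto
    have pos: "ws ! i \<bullet> ws ! i > 0"
    proof -
      have "ws ! i \<bullet> ws ! i \<ge> 0" by (simp add: scalar_prod_def sum_nonneg)
      then show ?thesis using o[OF ij(1) ij(1)] by simp
    qed
    have "(transpose_mat W * W) $$ (i, j) = f (ws ! i) \<bullet> f (ws ! j)"
      using ij W colW by simp
    also have "\<dots> = (1 / sqrt (ws ! i \<bullet> ws ! i)) * (1 / sqrt (ws ! j \<bullet> ws ! j)) * (ws ! i \<bullet> ws ! j)"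
      unfolding f_def using wsi[OF ij(1)] wsi[OF ij(2)] by simp
    also have "\<dots> = (if i = j then 1 else 0)"
      using o[OF ij] pos by (auto simp: field_simps)
    finally show "(transpose_mat W * W) $$ (i, j) = 1\<^sub>m n $$ (i, j)" using ij by simp
  qed (use W in auto)
  moreover have "col W 0 = (1 / sqrt (v \<bullet> v)) \<cdot>\<^sub>v v"
    using colW[of 0] n hdws ws hd_conv_nth[of ws] by (auto simp: f_def)
  ultimately show ?thesis using that W by blast
qed

text \<open>Rotating an eigenvector into the first coordinate clears the first column below the
  diagonal. Symmetry clears the first row as well, and the remaining block is again
  symmetric.\<close>

lemma symmetric_real_diagonalization:
  fixes A :: "real mat"
  assumes "A \<in> carrier_mat n n" and "transpose_mat A = A"
  shows "\<exists>P es. P \<in> carrier_mat n n \<and> transpose_mat P * P = 1\<^sub>m n \<and> length es = n \<and>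
     transpose_mat P * A * P = mat_diag n (\<lambda>i. es ! i)"
  using assms
proof (induction n arbitrary: A)
  case 0
  then show ?case by (intro exI[of _ "1\<^sub>m 0"] exI[of _ "[]"]) (auto intro!: eq_matI simp: mat_diag_def)
next
  case (Suc m A)
  let ?n = "Suc m"
  note A = Suc.prems(1) and sym = Suc.prems(2)
  obtain v e where v: "v \<in> carrier_vec ?n" "v \<noteq> 0\<^sub>v ?n" "A *\<^sub>v v = e \<cdot>\<^sub>v v"
    using symmetric_real_eigenvector[OF A sym] by auto
  obtain W c where W: "W \<in> carrier_mat ?n ?n" and WW: "transpose_mat W * W = 1\<^sub>m ?n"
    and W0: "col W 0 = c \<cdot>\<^sub>v v"
    using orthonormal_completion[OF v(1,2)] by metis
  let ?Wt = "transpose_mat W"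
  have Wt: "?Wt \<in> carrier_mat ?n ?n" using W by simp
  define A' where "A' = ?Wt * A * W"
  have A': "A' \<in> carrier_mat ?n ?n" using A W by (simp add: A'_def)
  have A'sym: "transpose_mat A' = A'"
    unfolding A'_def using W A sym
    by (subst transpose_mult[of _ ?n ?n _ ?n], simp, simp)
       (subst transpose_mult[of _ ?n ?n _ ?n], auto simp: assoc_mult_mat[of _ ?n ?n _ ?n _ ?n])
  have A'0: "A' $$ (i, 0) = (if i = 0 then e else 0)" if i: "i < ?n" for i
  proof -
    have "col (A * W) 0 = A *\<^sub>v col W 0" using A W by (intro col_mult2[of _ ?n ?n _ ?n]) auto
    also have "\<dots> = e \<cdot>\<^sub>v col W 0"
      unfolding W0 using v A by (simp add: mult_mat_vec[of _ ?n ?n] smult_smult_assoc mult.commute)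
    finally have cAW: "col (A * W) 0 = e \<cdot>\<^sub>v col W 0" .
    have "A' $$ (i, 0) = (?Wt * (A * W)) $$ (i, 0)"
      unfolding A'_def using A W by (simp add: assoc_mult_mat[of _ ?n ?n _ ?n _ ?n])
    also have "\<dots> = row ?Wt i \<bullet> col (A * W) 0" using i A W by simp
    also have "\<dots> = e * (row ?Wt i \<bullet> col W 0)" unfolding cAW using i W by simp
    also have "row ?Wt i \<bullet> col W 0 = (?Wt * W) $$ (i, 0)" using i W by simp
    finally show ?thesis unfolding WW using i by simp
  qed
  define B where "B = mat m m (\<lambda>(i, j). A' $$ (Suc i, Suc j))"
  have B: "B \<in> carrier_mat m m" by (simp add: B_def)
  have A's: "A' $$ (i, j) = A' $$ (j, i)" if "i < ?n" "j < ?n" for i j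
    using A'sym A' that by (metis carrier_matD index_transpose_mat(1))
  have Bsym: "transpose_mat B = B" using A's by (intro eq_matI) (auto simp: B_def)
  obtain Q es where Q: "Q \<in> carrier_mat m m" "transpose_mat Q * Q = 1\<^sub>m m" "length es = m"
    "transpose_mat Q * B * Q = mat_diag m (\<lambda>i. es ! i)"
    using Suc.IH[OF B Bsym] by blast
  define E where "E = mat 1 1 (\<lambda>_. e)"
  have E: "E \<in> carrier_mat 1 1" by (simp add: E_def)
  have A'f: "A' = four_block_mat E (0\<^sub>m 1 m) (0\<^sub>m m 1) B"
  proof (rule eq_matI)
    fix i j assume "i < dim_row (four_block_mat E (0\<^sub>m 1 m) (0\<^sub>m m 1) B)"
      "j < dim_col (four_block_mat E (0\<^sub>m 1 m) (0\<^sub>m m 1) B)"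
    then have ij: "i < ?n" "j < ?n" by (auto simp: E_def B_def)
    show "A' $$ (i, j) = four_block_mat E (0\<^sub>m 1 m) (0\<^sub>m m 1) B $$ (i, j)"
      using ij A'0[of i] A'0[of j] A's[of 0 j]
      by (cases i; cases j) (auto simp: E_def B_def)
  qed (use A' in \<open>auto simp: E_def B_def\<close>)
  define P where "P = four_block_mat (1\<^sub>m 1) (0\<^sub>m 1 m) (0\<^sub>m m 1) Q"
  have P: "P \<in> carrier_mat ?n ?n" unfolding P_def
    using four_block_carrier_mat[of "1\<^sub>m 1" 1 1 Q m m] Q by simp
  have Pt: "transpose_mat P = four_block_mat (1\<^sub>m 1) (0\<^sub>m 1 m) (0\<^sub>m m 1) (transpose_mat Q)"
    unfolding P_def using Q by (subst transpose_four_block_mat[of _ 1 1 _ m _ m]) auto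
  have PP: "transpose_mat P * P = 1\<^sub>m ?n"
    unfolding Pt unfolding P_def using Q
    by (subst mult_four_block_mat[of _ 1 1 _ m _ m _ _ 1 _ m]) auto
  have PAP: "transpose_mat P * A' * P = mat_diag ?n (\<lambda>i. (e # es) ! i)"
  proof -
    have "transpose_mat P * A' = four_block_mat E (0\<^sub>m 1 m) (0\<^sub>m m 1) (transpose_mat Q * B)"
      unfolding Pt A'f using Q B E
      by (subst mult_four_block_mat[of _ 1 1 _ m _ m _ _ 1 _ m]) auto
    then have "transpose_mat P * A' * P
      = four_block_mat E (0\<^sub>m 1 m) (0\<^sub>m m 1) (transpose_mat Q * B * Q)"
      unfolding P_def using Q B E
      by (simp, subst mult_four_block_mat[of _ 1 1 _ m _ m _ _ 1 _ m]) auto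
    also have "\<dots> = mat_diag ?n (\<lambda>i. (e # es) ! i)"
      unfolding Q by (rule eq_matI) (auto simp: mat_diag_def E_def)
    finally show ?thesis .
  qed
  have tWP: "transpose_mat (W * P) = transpose_mat P * ?Wt" using W P by (rule transpose_mult)
  have 1: "transpose_mat (W * P) * (W * P) = 1\<^sub>m ?n"
  proof -
    have "transpose_mat (W * P) * (W * P) = transpose_mat P * (?Wt * W) * P"
      unfolding tWP using W P by (simp add: assoc_mult_mat[of _ ?n ?n _ ?n _ ?n])
    then show ?thesis using PP WW P by simp
  qed
  have 2: "transpose_mat (W * P) * A * (W * P) = mat_diag ?n (\<lambda>i. (e # es) ! i)"
  proof -
    have "transpose_mat (W * P) * A * (W * P) = transpose_mat P * A' * P"
      unfolding tWP A'_def using W P A by (simp add: assoc_mult_mat[of _ ?n ?n _ ?n _ ?n])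
    then show ?thesis using PAP by simp
  qed
  show ?case using 1 2 W P Q(3) by (intro exI[of _ "W * P"] exI[of _ "e # es"]) auto
qed


text \<open>The same diagonalisation in coordinates: column \<open>k\<close> of \<open>p\<close> is
  a unit eigenvector for \<open>es ! k\<close>. Both orthogonality relations are kept, one for
  coordinates of vectors and one for recovering vectors from them.\<close>

lemma symmetric_matrix_spectral_sum:
  fixes m :: "nat \<Rightarrow> nat \<Rightarrow> real"
  assumes sym: "\<And>i j. i < n \<Longrightarrow> j < n \<Longrightarrow> m i j = m j i"
  obtains p es where "length es = n"
    "\<And>k l. k < n \<Longrightarrow> l < n \<Longrightarrow> (\<Sum>i<n. p i k * p i l) = (if k = l then 1 else (0::real))"
    "\<And>i j. i < n \<Longrightarrow> j < n \<Longrightarrow> (\<Sum>k<n. p i k * p j k) = (if i = j then 1 else (0::real))"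
    "\<And>i j. i < n \<Longrightarrow> j < n \<Longrightarrow> m i j = (\<Sum>k<n. es ! k * p i k * p j k)"
    "proots (char_poly (mat n n (\<lambda>(i, j). m i j))) = mset es"
proof -
  define A where "A = mat n n (\<lambda>(i, j). m i j)"
  have A: "A \<in> carrier_mat n n" by (simp add: A_def)
  have "transpose_mat A = A" by (rule eq_matI) (auto simp: A_def sym)
  from symmetric_real_diagonalization[OF A this] obtain P es where
    P: "P \<in> carrier_mat n n" "transpose_mat P * P = 1\<^sub>m n" "length es = n"
      "transpose_mat P * A * P = mat_diag n (\<lambda>i. es ! i)" by blast
  let ?D = "mat_diag n (\<lambda>i. es ! i)" and ?Pt = "transpose_mat P"
  have Pt: "?Pt \<in> carrier_mat n n" using P by simp
  have PP: "P * ?Pt = 1\<^sub>m n" using mat_mult_left_right_inverse[OF Pt P(1) P(2)] .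
  have APD: "A = P * ?D * ?Pt"
  proof -
    have "P * ?D * ?Pt = (P * ?Pt) * A * (P * ?Pt)"
      unfolding P(4)[symmetric] using P(1) A by (simp add: assoc_mult_mat[of _ n n _ n _ n])
    then show ?thesis using PP A by simp
  qed
  have "similar_mat_wit A ?D P ?Pt"
    by (rule similar_mat_witI[of _ _ n]) (use P A APD PP in auto)
  then have "char_poly A = char_poly ?D" by (intro char_poly_similar) (auto simp: similar_mat_def)
  also have "\<dots> = (\<Prod>a\<leftarrow>es. [:- a, 1:])"
  proof -
    have "diag_mat ?D = es" using P(3) by (intro nth_equalityI) (auto simp: diag_mat_def mat_diag_def)
    moreover have "char_poly ?D = (\<Prod>a \<leftarrow> diag_mat ?D. [:- a, 1:])"
      by (rule char_poly_upper_triangular[of _ n]) (auto simp: mat_diag_def upper_triangular_def)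
    ultimately show ?thesis by simp
  qed
  finally have cp: "char_poly A = (\<Prod>a\<leftarrow>es. [:- a, 1:])" .
  have pr: "proots (\<Prod>a\<leftarrow>xs. [:- a, 1:]) = mset xs" for xs :: "real list"
  proof (induction xs)
    case (Cons a xs)
    have "(\<Prod>a\<leftarrow>xs. [:- a, 1:]) \<noteq> 0" by (auto simp: prod_list_zero_iff)
    then show ?case using Cons by (simp add: proots_mult del: mult_pCons_left)
  qed simp
  show ?thesis
  proof (rule that[of es "\<lambda>i k. P $$ (i, k)"])
    show "(\<Sum>i<n. P $$ (i, k) * P $$ (i, l)) = (if k = l then 1 else 0)" if "k < n" "l < n" for k l
      using arg_cong[OF P(2), of "\<lambda>M. M $$ (k, l)"] that P(1)
      by (simp add: scalar_prod_def atLeast0LessThan)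
    show "(\<Sum>k<n. P $$ (i, k) * P $$ (j, k)) = (if i = j then 1 else 0)" if "i < n" "j < n" for i j
      using arg_cong[OF PP, of "\<lambda>M. M $$ (i, j)"] that P(1)
      by (simp add: scalar_prod_def atLeast0LessThan)
    show "m i j = (\<Sum>k<n. es ! k * P $$ (i, k) * P $$ (j, k))" if "i < n" "j < n" for i j
    proof -
      have "P * ?D = mat n n (\<lambda>(i, k). P $$ (i, k) * es ! k)"
        using P(1) mat_diag_mult_right[of P n n] by simp
      then have "(P * ?D * ?Pt) $$ (i, j) = (\<Sum>k<n. P $$ (i, k) * es ! k * P $$ (j, k))"
        using that P(1) by (simp add: scalar_prod_def atLeast0LessThan)
      moreover have "m i j = A $$ (i, j)" using that by (simp add: A_def)
      moreover have "(\<Sum>k<n. P $$ (i, k) * es ! k * P $$ (j, k)) = (\<Sum>k<n. es ! k * P $$ (i, k) * P $$ (j, k))"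
        by (simp add: mult.commute)
      ultimately show ?thesis using APD by metis
    qed
    show "proots (char_poly (mat n n (\<lambda>(i, j). m i j))) = mset es"
      using cp pr by (simp add: A_def)
  qed (use P in auto)
qed

text \<open>Counting the entries that reach \<open>c\<close> does not depend on their order, so
  sorting can be forgotten from here on.\<close>

lemma second_largest_less_iff:
  fixes es :: "'a::linorder list"
  assumes n: "length es \<ge> 2"
  shows "rev (sort es) ! 1 < c \<longleftrightarrow> card {k. k < length es \<and> c \<le> es ! k} \<le> 1"
proof -
  define n l where "n = length es" and "l = sort es"
  have l: "length l = n" "sorted l" "n \<ge> 2" using n by (auto simp: l_def n_def)
  have "length (filter (\<lambda>e. c \<le> e) es) = length (filter (\<lambda>e. c \<le> e) l)"
    unfolding l_def by (metis filter_sort length_sort)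
  then have card: "card {k. k < n \<and> c \<le> es ! k} = card {k. k < n \<and> c \<le> l ! k}"
    using l by (simp add: length_filter_conv_card n_def)
  have r: "rev l ! 1 = l ! (n - 2)" using l by (simp add: rev_nth numeral_2_eq_2)
  have "card {k. k < n \<and> c \<le> l ! k} \<le> 1 \<longleftrightarrow> l ! (n - 2) < c"
  proof
    assume "l ! (n - 2) < c"
    have "k = n - 1" if "k < n" "c \<le> l ! k" for k
    proof (rule ccontr)
      assume "k \<noteq> n - 1"
      then have "l ! k \<le> l ! (n - 2)" using l that by (intro sorted_nth_mono) auto
      then show False using that \<open>l ! (n - 2) < c\<close> by auto
    qed
    then have "{k. k < n \<and> c \<le> l ! k} \<subseteq> {n - 1}" by auto
    from card_mono[OF _ this] show "card {k. k < n \<and> c \<le> l ! k} \<le> 1" by simp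
  next
    assume c: "card {k. k < n \<and> c \<le> l ! k} \<le> 1"
    show "l ! (n - 2) < c"
    proof (rule ccontr)
      assume "\<not> l ! (n - 2) < c"
      moreover have "l ! (n - 2) \<le> l ! (n - 1)" using l by (intro sorted_nth_mono) auto
      ultimately have "{n - 2, n - 1} \<subseteq> {k. k < n \<and> c \<le> l ! k}" using l by auto
      then have "card {n - 2, n - 1} \<le> card {k. k < n \<and> c \<le> l ! k}" by (intro card_mono) auto
      then show False using c l by simp
    qed
  qed
  then show ?thesis using card r by (simp add: n_def l_def)
qed

section \<open>Forms that are negative on a hyperplane\<close>

definition qform :: "('a \<Rightarrow> 'a \<Rightarrow> real) \<Rightarrow> 'a set \<Rightarrow> ('a \<Rightarrow> real) \<Rightarrow> real" where
  "qform d V x = (\<Sum>u\<in>V. \<Sum>v\<in>V. d u v * x u * x v) + (\<Sum>v\<in>V. (x v)\<^sup>2) / 2"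

definition linear_functional :: "(('a \<Rightarrow> real) \<Rightarrow> real) \<Rightarrow> bool" where
  "linear_functional f \<longleftrightarrow> (\<forall>x y a b. f (\<lambda>v. a * x v + b * y v) = a * f x + b * f y)"

text \<open>The functional may vanish identically, so the condition is negative definiteness on a
  subspace of codimension at most one. It speaks of an arbitrary function \<open>d\<close> and not
  of a graph, so that it also applies to numerical tables and to selections of vertices with
  distances taken in the ambient graph.\<close>

definition neg_on_hyperplane :: "('a \<Rightarrow> 'a \<Rightarrow> real) \<Rightarrow> 'a set \<Rightarrow> bool" where
  "neg_on_hyperplane d V \<longleftrightarrow> (\<exists>f. linear_functional f \<and>
     (\<forall>x. f x = 0 \<longrightarrow> (\<exists>v\<in>V. x v \<noteq> 0) \<longrightarrow> qform d V x < 0))"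

text \<open>Some nonzero combination of two vectors lies in the kernel of the functional. The
  conclusion is a linear dependence and not a contradiction because \<open>x\<close> and
  \<open>y\<close> may be dependent on \<open>V\<close>.\<close>

lemma neg_on_hyperplane_no_plane:
  assumes g: "neg_on_hyperplane d V"
    and nn: "\<And>a b. qform d V (\<lambda>v. a * x v + b * y v) \<ge> 0"
  obtains a b where "(a, b) \<noteq> (0, 0)" "\<And>v. v \<in> V \<Longrightarrow> a * x v + b * y v = 0"
proof -
  obtain f where f: "linear_functional f"
    "\<And>x. f x = 0 \<Longrightarrow> (\<exists>v\<in>V. x v \<noteq> 0) \<Longrightarrow> qform d V x < 0"
    using g unfolding neg_on_hyperplane_def by blast
  obtain a b where ab: "(a, b) \<noteq> (0, 0)" "a * f x + b * f y = 0"
  proof (cases "f x = 0")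
    case True then show ?thesis using that[of 1 0] by simp
  next
    case False then show ?thesis using that[of "f y" "- f x"] by simp
  qed
  then have "f (\<lambda>v. a * x v + b * y v) = 0" using f(1) by (simp add: linear_functional_def)
  then have "\<not> (\<exists>v\<in>V. a * x v + b * y v \<noteq> 0)"
    using f(2)[of "\<lambda>v. a * x v + b * y v"] nn[of a b] by fastforce
  then show ?thesis using that ab by blast
qed

text \<open>In coordinates \<open>Y\<close> with respect to an orthonormal eigenbasis the form is
  the sum of (\<open>es ! k\<close> + 1/2) \<open>Y\<close>^2. If at most one coefficient is
  nonnegative, the vanishing of that coordinate is the hyperplane; two nonnegative coefficients give
  a plane on which the form is nonnegative.\<close>

theorem kth_eigenvalue_2_less_iff:
  fixes d :: "'a \<Rightarrow> 'a \<Rightarrow> real"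
  assumes vs: "distinct vs" "set vs = V" "length vs \<ge> 2"
    and sym: "\<And>u v. u \<in> V \<Longrightarrow> v \<in> V \<Longrightarrow> d u v = d v u"
  shows "kth_eigenvalue (mat (length vs) (length vs) (\<lambda>(i, j). d (vs ! i) (vs ! j))) 2 < - 1 / 2
    \<longleftrightarrow> neg_on_hyperplane d V"
proof -
  define n where "n = length vs"
  define m where "m i j = d (vs ! i) (vs ! j)" for i j
  have msym: "m i j = m j i" if "i < n" "j < n" for i j
    using sym that vs by (auto simp: m_def n_def)
  obtain p es where
    es: "length es = n" and
    p1: "\<And>k l. k < n \<Longrightarrow> l < n \<Longrightarrow> (\<Sum>i<n. p i k * p i l) = (if k = l then 1 else 0)" and
    p2: "\<And>i j. i < n \<Longrightarrow> j < n \<Longrightarrow> (\<Sum>k<n. p i k * p j k) = (if i = j then 1 else 0)" and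
    m: "\<And>i j. i < n \<Longrightarrow> j < n \<Longrightarrow> m i j = (\<Sum>k<n. es ! k * p i k * p j k)" and
    pr: "proots (char_poly (mat n n (\<lambda>(i, j). m i j))) = mset es"
    by (rule symmetric_matrix_spectral_sum[of n m, OF msym]) (assumption, assumption, rule that)
  define Y where "Y x k = (\<Sum>i<n. p i k * x (vs ! i))" for x k
  have bij: "bij_betw ((!) vs) {..<n} V" using vs by (simp add: bij_betw_nth n_def)
  have sumV: "(\<Sum>v\<in>V. g v) = (\<Sum>i<n. g (vs ! i))" for g :: "'a \<Rightarrow> real"
    using sum.reindex_bij_betw[OF bij, of g] by simp
  have swap: "(\<Sum>i<n. \<Sum>j<n. (\<Sum>k<n. c k * p i k * p j k) * x i * x j) = (\<Sum>k<n. c k * (\<Sum>i<n. p i k * x i)\<^sup>2)"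
    for c x :: "nat \<Rightarrow> real"
  proof -
    have "(\<Sum>i<n. \<Sum>j<n. (\<Sum>k<n. c k * p i k * p j k) * x i * x j)
      = (\<Sum>i<n. \<Sum>j<n. \<Sum>k<n. c k * (p i k * x i * (p j k * x j)))"
      by (simp add: sum_distrib_right sum_distrib_left mult_ac)
    also have "\<dots> = (\<Sum>i<n. \<Sum>k<n. \<Sum>j<n. c k * (p i k * x i * (p j k * x j)))"
      by (intro sum.cong refl sum.swap)
    also have "\<dots> = (\<Sum>k<n. \<Sum>i<n. \<Sum>j<n. c k * (p i k * x i * (p j k * x j)))"
      by (rule sum.swap)
    finally show ?thesis by (simp only: power2_eq_square sum_product) (simp only: sum_distrib_left)
  qed
  have q: "qform d V x = (\<Sum>k<n. (es ! k + 1 / 2) * (Y x k)\<^sup>2)" for x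
  proof -
    have "(\<Sum>u\<in>V. \<Sum>v\<in>V. d u v * x u * x v) = (\<Sum>i<n. \<Sum>j<n. m i j * x (vs ! i) * x (vs ! j))"
      by (simp add: sumV m_def)
    also have "\<dots> = (\<Sum>k<n. es ! k * (Y x k)\<^sup>2)"
      unfolding Y_def swap[symmetric] by (intro sum.cong refl) (simp add: m)
    finally have 1: "(\<Sum>u\<in>V. \<Sum>v\<in>V. d u v * x u * x v) = (\<Sum>k<n. es ! k * (Y x k)\<^sup>2)" .
    have "(\<Sum>k<n. 1 * (Y x k)\<^sup>2)
      = (\<Sum>i<n. \<Sum>j<n. (\<Sum>k<n. 1 * p i k * p j k) * x (vs ! i) * x (vs ! j))"
      unfolding Y_def swap ..
    also have "\<dots> = (\<Sum>i<n. \<Sum>j<n. if i = j then x (vs ! i) * x (vs ! j) else 0)"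
      by (intro sum.cong refl) (simp add: p2)
    also have "\<dots> = (\<Sum>v\<in>V. (x v)\<^sup>2)"
      by (simp add: sumV power2_eq_square)
    finally have 2: "(\<Sum>v\<in>V. (x v)\<^sup>2) = (\<Sum>k<n. (Y x k)\<^sup>2)" by simp
    show ?thesis unfolding qform_def 1 2
      by (simp add: distrib_right sum.distrib sum_divide_distrib)
  qed
  have xY: "x (vs ! i) = (\<Sum>k<n. p i k * Y x k)" if "i < n" for x i
  proof -
    have "(\<Sum>k<n. p i k * Y x k) = (\<Sum>k<n. \<Sum>j<n. p i k * p j k * x (vs ! j))"
      by (simp add: Y_def sum_distrib_left mult.assoc)
    also have "\<dots> = (\<Sum>j<n. \<Sum>k<n. p i k * p j k * x (vs ! j))" by (rule sum.swap)
    also have "\<dots> = (\<Sum>j<n. if i = j then x (vs ! j) else 0)"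
      by (intro sum.cong refl) (simp add: sum_distrib_right[symmetric] p2 that)
    finally show ?thesis using that by simp
  qed
  have "kth_eigenvalue (mat n n (\<lambda>(i, j). m i j)) 2 = rev (sort es) ! 1"
    unfolding kth_eigenvalue_def pr by simp
  also have "\<dots> < - 1 / 2 \<longleftrightarrow> card {k. k < n \<and> - 1 / 2 \<le> es ! k} \<le> 1"
    using second_largest_less_iff[of es] es vs(3) by (simp add: n_def)
  also have "\<dots> \<longleftrightarrow> neg_on_hyperplane d V"
  proof
    assume c: "card {k. k < n \<and> - 1 / 2 \<le> es ! k} \<le> 1"
    obtain k0 where k0: "\<And>k. k < n \<Longrightarrow> k \<noteq> k0 \<Longrightarrow> es ! k < - 1 / 2"
    proof (cases "\<exists>k0<n. - 1 / 2 \<le> es ! k0")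
      case True
      then obtain k0 where k0: "k0 < n" "- 1 / 2 \<le> es ! k0" by blast
      have "es ! k < - 1 / 2" if "k < n" "k \<noteq> k0" for k
      proof (rule ccontr)
        assume "\<not> ?thesis"
        then have "{k, k0} \<subseteq> {k. k < n \<and> - 1 / 2 \<le> es ! k}" using k0 that by auto
        then have "card {k, k0} \<le> card {k. k < n \<and> - 1 / 2 \<le> es ! k}" by (intro card_mono) auto
        then show False using c that by simp
      qed
      then show ?thesis using that by blast
    next
      case False then show ?thesis using that by force
    qed
    show "neg_on_hyperplane d V"
      unfolding neg_on_hyperplane_def
    proof (intro exI[of _ "\<lambda>x. Y x k0"] conjI allI impI)
      show "linear_functional (\<lambda>x. Y x k0)"
        by (simp add: linear_functional_def Y_def sum.distrib sum_distrib_left algebra_simps)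
      fix x assume f: "Y x k0 = 0" and "\<exists>v\<in>V. x v \<noteq> 0"
      then obtain i where i: "i < n" "x (vs ! i) \<noteq> 0" using vs by (metis in_set_conv_nth n_def)
      then obtain k where k: "k < n" "Y x k \<noteq> 0" using xY[of i x] by (metis (no_types, lifting) lessThan_iff mult_zero_right sum.neutral)
      have "(\<Sum>k<n. (es ! k + 1 / 2) * (Y x k)\<^sup>2) < (\<Sum>k<n. 0)"
      proof (rule sum_strict_mono_ex1)
        show "\<forall>k\<in>{..<n}. (es ! k + 1 / 2) * (Y x k)\<^sup>2 \<le> 0"
        proof
          fix k assume "k \<in> {..<n}"
          then show "(es ! k + 1 / 2) * (Y x k)\<^sup>2 \<le> 0"
            using k0[of k] f by (cases "k = k0") (auto simp: mult_le_0_iff)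
        qed
        show "\<exists>k\<in>{..<n}. (es ! k + 1 / 2) * (Y x k)\<^sup>2 < 0"
        proof (rule bexI[of _ k])
          have "k \<noteq> k0" using k f by auto
          then have "es ! k + 1 / 2 < 0" using k0[of k] k by linarith
          then show "(es ! k + 1 / 2) * (Y x k)\<^sup>2 < 0" using k by (simp add: mult_less_0_iff)
        qed (use k in simp)
      qed simp
      then show "qform d V x < 0" using q by simp
    qed
  next
    assume g: "neg_on_hyperplane d V"
    show "card {k. k < n \<and> - 1 / 2 \<le> es ! k} \<le> 1"
    proof (rule ccontr)
      assume "\<not> ?thesis"
      then obtain k l where kl: "k < n" "l < n" "k \<noteq> l" "- 1 / 2 \<le> es ! k" "- 1 / 2 \<le> es ! l"
        by (metis (mono_tags, lifting) One_nat_def card_le_Suc0_iff_eq finite_nat_set_iff_bounded mem_Collect_eq)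
      \<comment> \<open>\<open>idx\<close> inverts the enumeration, which turns the eigenvectors,
        indexed by positions, into functions on vertices.\<close>
      define idx where "idx v = (THE i. i < n \<and> vs ! i = v)" for v
      have idx: "idx (vs ! i) = i" if "i < n" for i
        unfolding idx_def using vs that by (auto simp: n_def nth_eq_iff_index_eq)
      define x y where "x v = p (idx v) k" and "y v = p (idx v) l" for v
      have Yxy: "Y (\<lambda>v. a * x v + b * y v) j = (if j = k then a else 0) + (if j = l then b else 0)"
        if "j < n" for a b j
      proof -
        have "Y (\<lambda>v. a * x v + b * y v) j = (\<Sum>i<n. p i j * (a * p i k + b * p i l))"
          unfolding Y_def x_def y_def by (intro sum.cong refl) (simp add: idx)
        also have "\<dots> = a * (\<Sum>i<n. p i j * p i k) + b * (\<Sum>i<n. p i j * p i l)"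
          by (simp add: sum.distrib sum_distrib_left algebra_simps)
        finally have "Y (\<lambda>v. a * x v + b * y v) j = a * (\<Sum>i<n. p i j * p i k) + b * (\<Sum>i<n. p i j * p i l)" .
        then show ?thesis using p1 that kl by simp
      qed
      have "qform d V (\<lambda>v. a * x v + b * y v) \<ge> 0" for a b
        unfolding q by (rule sum_nonneg) (use kl in \<open>auto simp: Yxy\<close>)
      from neg_on_hyperplane_no_plane[OF g this] obtain a b where
        ab: "(a, b) \<noteq> (0, 0)" "\<And>v. v \<in> V \<Longrightarrow> a * x v + b * y v = 0" by blast
      have "Y (\<lambda>v. a * x v + b * y v) j = 0" for j
        unfolding Y_def using ab(2) vs by (auto simp: n_def intro!: sum.neutral)
      from this[of k] this[of l] show False using ab(1) kl Yxy[of k a b] Yxy[of l a b] by simp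
    qed
  qed
  finally show ?thesis by (simp add: m_def n_def)
qed

section \<open>Graph distances\<close>

locale conn_graph =
  fixes G :: "'a graph"
  assumes simple: "simple_graph G" and connected: "connected_graph G"

abbreviation adj :: "'a graph \<Rightarrow> 'a \<Rightarrow> 'a \<Rightarrow> bool" where
  "adj G u v \<equiv> {u, v} \<in> edges G"

lemma simple_graph_adjD:
  assumes "simple_graph G" "adj G u v"
  shows "u \<in> verts G" "v \<in> verts G" "u \<noteq> v"
proof -
  have "{u, v} \<subseteq> verts G" "card {u, v} = 2" using assms by (auto simp: simple_graph_def)
  then show "u \<in> verts G" "v \<in> verts G" "u \<noteq> v" by auto
qed

lemma simple_graph_edgeE:
  assumes "simple_graph G" "e \<in> edges G"
  obtains u v where "e = {u, v}" "u \<noteq> v" "u \<in> verts G" "v \<in> verts G" "adj G u v"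
proof -
  have e: "e \<subseteq> verts G" "card e = 2" using assms by (auto simp: simple_graph_def)
  then obtain u v where "e = {u, v}" "u \<noteq> v" by (metis card_2_iff)
  then show ?thesis using that e assms(2) by blast
qed

lemma is_path_snoc:
  assumes "is_path G u p v" "adj G v w" "w \<in> verts G" "w \<notin> set p"
  shows "is_path G u (p @ [w]) w"
  using assms by (auto simp: is_path_def successively_append_iff)

lemma is_path_prefix:
  assumes "is_path G u (p @ w # q) v"
  shows "is_path G u (p @ [w]) w"
proof -
  have "hd (p @ [w]) = hd (p @ w # q)" by (cases p) auto
  then show ?thesis using assms unfolding is_path_def by (auto simp: successively_append_iff)
qed

lemma is_path_rev: "is_path G u p v \<Longrightarrow> is_path G v (rev p) u"
  by (auto simp: is_path_def hd_rev last_rev insert_commute)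

lemma graph_dist_le_path: "is_path G u p v \<Longrightarrow> graph_dist G u v \<le> length p - 1"
  unfolding graph_dist_def
  by (rule Least_le) (auto simp: is_path_def intro!: exI[of _ p])

lemma graph_dist_path:
  assumes "is_path G u p v"
  obtains q where "is_path G u q v" "length q = Suc (graph_dist G u v)"
proof -
  have "\<exists>k q. is_path G u q v \<and> length q = Suc k"
    using assms by (intro exI[of _ "length p - 1"] exI[of _ p]) (auto simp: is_path_def)
  from LeastI_ex[OF this] show ?thesis using that unfolding graph_dist_def by blast
qed

text \<open>The bound along edges makes \<open>f\<close> a lower bound for the length of every path
  from \<open>u\<close>, and descending along predecessors builds a path of exactly that length.
  Distances of a modified graph thus become a local check of a guessed formula.\<close>

lemma graph_dist_eqI:
  assumes simple: "simple_graph G" and u: "u \<in> verts G" "f u = 0"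
    and step: "\<And>v w. adj G v w \<Longrightarrow> f w \<le> Suc (f v)"
    and pred: "\<And>v. v \<in> verts G \<Longrightarrow> v \<noteq> u \<Longrightarrow> \<exists>w. adj G w v \<and> f v = Suc (f w)"
    and v: "v \<in> verts G"
  shows "(\<exists>p. is_path G u p v) \<and> graph_dist G u v = f v"
proof -
  \<comment> \<open>The bound on \<open>f\<close> along the path is carried through the induction
    because it shows that the vertex appended next is new, as a path must not repeat
    vertices.\<close>
  have ex: "\<exists>p. is_path G u p v \<and> length p = Suc (f v) \<and> (\<forall>x\<in>set p. f x \<le> f v)" using v
  proof (induction "f v" arbitrary: v rule: less_induct)
    case less
    show ?case
    proof (cases "v = u")
      case True
      then show ?thesis using u by (intro exI[of _ "[u]"]) (auto simp: is_path_def)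
    next
      case False
      then obtain w where w: "adj G w v" "f v = Suc (f w)" using pred less.prems by blast
      then have "w \<in> verts G" using simple_graph_adjD simple by metis
      then obtain p where p: "is_path G u p w" "length p = Suc (f w)" "\<forall>x\<in>set p. f x \<le> f w"
        using less.hyps[of w] w by auto
      then have "v \<notin> set p" using w by auto
      then show ?thesis using is_path_snoc[OF p(1) w(1) less.prems] p w
        by (intro exI[of _ "p @ [v]"]) auto
    qed
  qed
  have lower: "f v \<le> length p - 1" if "is_path G u p v" for p v
    using that
  proof (induction p arbitrary: v rule: rev_induct)
    case (snoc x p)
    show ?case
    proof (cases p rule: rev_cases)
      case Nil
      then show ?thesis using snoc.prems u by (auto simp: is_path_def)
    next
      case (snoc q y)
      have "is_path G u p y"
        using is_path_prefix[of G u q y "[x]" v] snoc.prems snoc by simp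
      then have "f y \<le> length p - 1" by (rule snoc.IH)
      moreover have "v = x" "adj G y x" using snoc.prems snoc by (auto simp: is_path_def successively_append_iff)
      ultimately show ?thesis using step[of y x] snoc by simp
    qed
  qed (auto simp: is_path_def)
  from ex obtain p where p: "is_path G u p v" "length p = Suc (f v)" by blast
  obtain q where q: "is_path G u q v" "length q = Suc (graph_dist G u v)"
    using graph_dist_path[OF p(1)] by blast
  show ?thesis using graph_dist_le_path[OF p(1)] lower[OF q(1)] p q by auto
qed

lemma conn_graph_distI:
  assumes "simple_graph G" "verts G \<noteq> {}"
    and "\<And>u. u \<in> verts G \<Longrightarrow> f u u = 0"
    and "\<And>u v w. u \<in> verts G \<Longrightarrow> adj G v w \<Longrightarrow> f u w \<le> Suc (f u v)"
    and "\<And>u v. u \<in> verts G \<Longrightarrow> v \<in> verts G \<Longrightarrow> v \<noteq> u \<Longrightarrow> \<exists>w. adj G w v \<and> f u v = Suc (f u w)"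
  shows "conn_graph G \<and> (\<forall>u\<in>verts G. \<forall>v\<in>verts G. graph_dist G u v = f u v)"
proof -
  have *: "(\<exists>p. is_path G u p v) \<and> graph_dist G u v = f u v" if "u \<in> verts G" "v \<in> verts G" for u v
    by (rule graph_dist_eqI) (use assms that in auto)
  then have "conn_graph G" using assms by unfold_locales (auto simp: connected_graph_def)
  then show ?thesis using * by blast
qed

context conn_graph
begin

abbreviation "V \<equiv> verts G"
abbreviation "d \<equiv> graph_dist G"

lemma finite_V: "finite V" and V_nonempty: "V \<noteq> {}"
  using simple connected by (auto simp: simple_graph_def connected_graph_def)

lemmas adjD = simple_graph_adjD[OF simple]

lemma shortest_path:
  assumes "u \<in> V" "v \<in> V"
  obtains p where "is_path G u p v" "length p = Suc (d u v)"
  using assms connected graph_dist_path unfolding connected_graph_def by metis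

lemma dist_self [simp]: "u \<in> V \<Longrightarrow> d u u = 0"
  using graph_dist_le_path[of G u "[u]" u] by (auto simp: is_path_def)

lemma dist_eq_0_iff: "u \<in> V \<Longrightarrow> v \<in> V \<Longrightarrow> d u v = 0 \<longleftrightarrow> u = v"
proof (rule iffI)
  assume uv: "u \<in> V" "v \<in> V" "d u v = 0"
  obtain p where "is_path G u p v" "length p = Suc (d u v)" using shortest_path uv by blast
  then show "u = v" using uv by (auto simp: is_path_def length_Suc_conv)
qed auto

lemma dist_sym: "u \<in> V \<Longrightarrow> v \<in> V \<Longrightarrow> d u v = d v u"
proof -
  have "d u v \<le> d v u" if uv: "u \<in> V" "v \<in> V" for u v
  proof -
    obtain p where "is_path G v p u" "length p = Suc (d v u)" using shortest_path[OF uv(2,1)] .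
    then show ?thesis using graph_dist_le_path[OF is_path_rev[of G v p u]] by simp
  qed
  then show "u \<in> V \<Longrightarrow> v \<in> V \<Longrightarrow> d u v = d v u" by (simp add: order_antisym)
qed

lemma dist_step:
  assumes "u \<in> V" "adj G v w"
  shows "d u w \<le> Suc (d u v)"
proof -
  have vw: "v \<in> V" "w \<in> V" using adjD assms by auto
  obtain p where p: "is_path G u p v" "length p = Suc (d u v)" using shortest_path assms vw by blast
  show ?thesis
  proof (cases "w \<in> set p")
    case True
    then obtain q r where "p = q @ w # r" by (meson split_list)
    then have "is_path G u (q @ [w]) w" "length (q @ [w]) \<le> length p"
      using is_path_prefix[of G u q w r v] p by auto
    then show ?thesis using graph_dist_le_path[of G u "q @ [w]" w] p by simp
  next
    case False
    then show ?thesis using graph_dist_le_path[OF is_path_snoc[OF p(1) assms(2) vw(2)]] p by simp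
  qed
qed

lemma dist_pred:
  assumes "u \<in> V" "v \<in> V" "v \<noteq> u"
  obtains w where "adj G w v" "d u v = Suc (d u w)"
proof -
  obtain p where p: "is_path G u p v" "length p = Suc (d u v)" using shortest_path assms by blast
  obtain q x where q: "p = q @ [x]" using p by (cases p rule: rev_cases) (auto simp: is_path_def)
  have x: "x = v" using p q by (auto simp: is_path_def)
  have "q \<noteq> []" using p q x assms by (auto simp: is_path_def)
  then obtain r w where r: "q = r @ [w]" by (cases q rule: rev_cases) auto
  have "is_path G u (r @ [w]) w" using is_path_prefix[of G u r w "[x]" v] p q r by simp
  then have "d u w \<le> d u v - 1" using graph_dist_le_path[of G u "r @ [w]" w] p q r by simp
  moreover have wv: "adj G w v" using p q r x by (auto simp: is_path_def successively_append_iff)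
  moreover have "d u v \<noteq> 0" using assms dist_eq_0_iff by auto
  ultimately show ?thesis using dist_step[OF assms(1) wv] that by simp
qed

lemma dist_triangle:
  assumes "u \<in> V" "v \<in> V" "w \<in> V"
  shows "d u w \<le> d u v + d v w"
  using assms(3)
proof (induction "d v w" arbitrary: w rule: less_induct)
  case less
  show ?case
  proof (cases "w = v")
    case False
    then obtain y where y: "adj G y w" "d v w = Suc (d v y)" using dist_pred[of v w] assms less by metis
    have "d u y \<le> d u v + d v y" using less.hyps[of y] y adjD[OF y(1)] by simp
    then show ?thesis using dist_step[OF assms(1) y(1)] y by simp
  qed simp
qed

lemma dist_eq_1_iff: "u \<in> V \<Longrightarrow> v \<in> V \<Longrightarrow> d u v = 1 \<longleftrightarrow> adj G u v"
proof
  assume uv: "u \<in> V" "v \<in> V" "d u v = 1"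
  then have "v \<noteq> u" by auto
  then obtain w where w: "adj G w v" "d u v = Suc (d u w)" using dist_pred uv by metis
  then have "u = w" using uv adjD[OF w(1)] by (simp add: dist_eq_0_iff)
  then show "adj G u v" using w by simp
next
  assume uv: "u \<in> V" "v \<in> V" "adj G u v"
  then have "d u v \<le> 1" "u \<noteq> v" using dist_step[of u u v] adjD by auto
  then show "d u v = 1" using dist_eq_0_iff uv by (metis le_neq_implies_less less_one)
qed

lemma dist_succ:
  assumes "u \<in> V" "v \<in> V" "v \<noteq> u"
  obtains w where "adj G u w" "d u v = Suc (d w v)"
proof -
  obtain w where w: "adj G w u" "d v u = Suc (d v w)" using dist_pred[of v u] assms by metis
  then show ?thesis using that[of w] dist_sym assms adjD[OF w(1)] by (simp add: insert_commute)
qed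

text \<open>A shortcut between two vertices of a shortest path would shorten the whole path, so
  every stretch of it is shortest too.\<close>

lemma geodesic:
  assumes "u \<in> V" "v \<in> V"
  obtains x where "x 0 = u" "x (d u v) = v" "\<And>i. i \<le> d u v \<Longrightarrow> x i \<in> V"
    "\<And>i. i < d u v \<Longrightarrow> adj G (x i) (x (Suc i))" "\<And>i j. i \<le> j \<Longrightarrow> j \<le> d u v \<Longrightarrow> d (x i) (x j) = j - i"
proof -
  have "\<exists>x. x 0 = u \<and> x (d u v) = v \<and> (\<forall>i\<le>d u v. x i \<in> V) \<and> (\<forall>i<d u v. adj G (x i) (x (Suc i)))"
    using assms(2)
  proof (induction "d u v" arbitrary: v)
    case 0
    then show ?case using assms(1) dist_eq_0_iff by (intro exI[of _ "\<lambda>_. u"]) auto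
  next
    case (Suc k)
    then have "v \<noteq> u" using assms(1) by auto
    then obtain w where w: "adj G w v" "d u v = Suc (d u w)" using dist_pred assms(1) Suc.prems by metis
    then have "k = d u w" "w \<in> V" using Suc.hyps(2) adjD by auto
    then obtain x where x: "x 0 = u" "x k = w" "\<forall>i\<le>k. x i \<in> V" "\<forall>i<k. adj G (x i) (x (Suc i))"
      using Suc.hyps(1) by metis
    then show ?case
      using w Suc.hyps(2)[symmetric] Suc.prems
      by (intro exI[of _ "x(Suc k := v)"]) (auto simp: le_Suc_eq less_Suc_eq)
  qed
  then obtain x where x: "x 0 = u" "x (d u v) = v" "\<And>i. i \<le> d u v \<Longrightarrow> x i \<in> V"
    "\<And>i. i < d u v \<Longrightarrow> adj G (x i) (x (Suc i))" by blast
  have le: "d (x i) (x j) \<le> j - i" if "i \<le> j" "j \<le> d u v" for i j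
    using that
  proof (induction j rule: dec_induct)
    case base
    then show ?case using x by simp
  next
    case (step j)
    then show ?case using dist_step[of "x i" "x j" "x (Suc j)"] x by (simp add: Suc_diff_le)
  qed
  have "d (x i) (x j) = j - i" if ij: "i \<le> j" "j \<le> d u v" for i j
  proof -
    have "d u v \<le> d u (x i) + d (x i) v" "d (x i) v \<le> d (x i) (x j) + d (x j) v"
      using dist_triangle[of u "x i" v] dist_triangle[of "x i" "x j" v] assms x(3) ij by auto
    moreover have "d u (x i) \<le> i" "d (x j) v \<le> d u v - j" using le[of 0 i] le[of j "d u v"] x ij by auto
    ultimately show ?thesis using le[OF ij] ij by linarith
  qed
  then show ?thesis using that x by blast
qed

end

section \<open>Adding and removing leaves, isomorphisms\<close>

definition add_leaf :: "'a graph \<Rightarrow> 'a \<Rightarrow> 'a \<Rightarrow> 'a graph" where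
  "add_leaf G u w = (insert w (verts G), insert {u, w} (edges G))"

lemma verts_add_leaf [simp]: "verts (add_leaf G u w) = insert w (verts G)"
  and edges_add_leaf [simp]: "edges (add_leaf G u w) = insert {u, w} (edges G)"
  by (simp_all add: add_leaf_def)

lemma (in conn_graph) add_leaf:
  assumes u: "u \<in> V" and w: "w \<notin> V"
  shows "conn_graph (add_leaf G u w)"
    and "\<And>a b. a \<in> V \<Longrightarrow> b \<in> V \<Longrightarrow> graph_dist (add_leaf G u w) a b = d a b"
    and "\<And>a. a \<in> V \<Longrightarrow> graph_dist (add_leaf G u w) a w = Suc (d a u)"
    and "\<And>a. a \<in> V \<Longrightarrow> graph_dist (add_leaf G u w) w a = Suc (d u a)"
    and "graph_dist (add_leaf G u w) w w = 0"
proof -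
  let ?H = "add_leaf G u w"
  define f where "f a b = (if a = w then if b = w then 0 else Suc (d u b)
    else if b = w then Suc (d a u) else d a b)" for a b
  have "u \<noteq> w" using u w by auto
  then have s: "simple_graph ?H" using simple u by (auto simp: simple_graph_def)
  have wE: "\<not> adj G w x" "\<not> adj G x w" for x using adjD w by blast+
  have *: "conn_graph ?H \<and> (\<forall>a\<in>verts ?H. \<forall>b\<in>verts ?H. graph_dist ?H a b = f a b)"
  proof (rule conn_graph_distI[OF s])
    show "f a c \<le> Suc (f a b)" if "a \<in> verts ?H" and bc: "adj ?H b c" for a b c
    proof -
      consider "b = u" "c = w" | "b = w" "c = u" | "adj G b c" using bc by (auto simp: doubleton_eq_iff)
      then show ?thesis
      proof cases
        case 3
        then have "b \<in> V" "c \<in> V" "b \<noteq> w" "c \<noteq> w" using adjD w by auto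
        then show ?thesis using dist_step[OF _ 3] that u w by (auto simp: f_def)
      qed (use u w that in \<open>auto simp: f_def\<close>)
    qed
    show "\<exists>c. adj ?H c b \<and> f a b = Suc (f a c)" if ab: "a \<in> verts ?H" "b \<in> verts ?H" "b \<noteq> a" for a b
    proof (cases "b = w")
      case True
      then show ?thesis using ab u w by (intro exI[of _ u]) (auto simp: f_def)
    next
      case False
      then have b: "b \<in> V" using ab by simp
      define a' where "a' = (if a = w then u else a)"
      have a': "a' \<in> V" using u ab by (auto simp: a'_def)
      show ?thesis
      proof (cases "b = a'")
        case True
        then have "a = w" "b = u" using ab by (auto simp: a'_def split: if_splits)
        then show ?thesis using u w by (intro exI[of _ w]) (auto simp: f_def insert_commute)
      next
        case b': False
        obtain c where c: "adj G c b" "d a' b = Suc (d a' c)" using dist_pred[OF a' b b'] .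
        then have "c \<noteq> w" using adjD w by auto
        then show ?thesis using c False by (intro exI[of _ c]) (auto simp: f_def a'_def)
      qed
    qed
  qed (auto simp: f_def w)
  show "conn_graph ?H" using * ..
  show "\<And>a b. a \<in> V \<Longrightarrow> b \<in> V \<Longrightarrow> graph_dist ?H a b = d a b"
    "\<And>a. a \<in> V \<Longrightarrow> graph_dist ?H a w = Suc (d a u)"
    "\<And>a. a \<in> V \<Longrightarrow> graph_dist ?H w a = Suc (d u a)"
    "graph_dist ?H w w = 0"
    using * w by (auto simp: f_def)
qed

text \<open>A leaf is never an inner vertex of a geodesic: entering and leaving it would both use
  \<open>u\<close>. Hence the old distance function still satisfies the local conditions after the
  removal.\<close>

lemma (in conn_graph) remove_leaf:
  assumes w: "w \<in> V" and uw: "adj G u w" and leaf: "\<And>x. adj G x w \<Longrightarrow> x = u"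
  shows "conn_graph (V - {w}, edges G - {{u, w}})"
    and "G = add_leaf (V - {w}, edges G - {{u, w}}) u w"
proof -
  let ?H = "(V - {w}, edges G - {{u, w}})"
  have u: "u \<in> V" "u \<noteq> w" using adjD uw by auto
  have H: "adj ?H x y \<longleftrightarrow> adj G x y \<and> x \<noteq> w \<and> y \<noteq> w" for x y
    using leaf[of x] leaf[of y] uw adjD[of x y] by (auto simp: doubleton_eq_iff insert_commute)
  have "e \<subseteq> V - {w}" if e: "e \<in> edges G" "e \<noteq> {u, w}" for e
  proof -
    obtain a b where ab: "e = {a, b}" "a \<in> V" "b \<in> V" using simple_graph_edgeE[OF simple e(1)] by metis
    then have "a \<noteq> w" "b \<noteq> w" using leaf[of a] leaf[of b] e by (auto simp: insert_commute)
    then show ?thesis using ab by auto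
  qed
  then have s: "simple_graph ?H" using simple by (auto simp: simple_graph_def)
  have "conn_graph ?H \<and> (\<forall>a\<in>verts ?H. \<forall>b\<in>verts ?H. graph_dist ?H a b = d a b)"
  proof (rule conn_graph_distI[OF s])
    show "\<exists>c. adj ?H c b \<and> d a b = Suc (d a c)" if ab: "a \<in> verts ?H" "b \<in> verts ?H" "b \<noteq> a" for a b
    proof -
      obtain c where c: "adj G c b" "d a b = Suc (d a c)" using dist_pred[of a b] ab by auto
      have "c \<noteq> w"
      proof
        assume "c = w"
        then have "b = u" using c leaf[of b] by (simp add: insert_commute)
        obtain y where "adj G y w" "d a w = Suc (d a y)" using dist_pred[of a w] ab w by auto
        then show False using leaf[of y] c \<open>b = u\<close> \<open>c = w\<close> by simp
      qed
      then show ?thesis using c ab H by auto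
    qed
    show "d a c \<le> Suc (d a b)" if "a \<in> verts ?H" "adj ?H b c" for a b c
      using that H dist_step[of a b c] by auto
  qed (use u in auto)
  then show "conn_graph ?H" ..
  show "G = add_leaf ?H u w"
    using w uw by (intro prod_eqI) auto
qed

lemma graph_iso_sym:
  assumes "graph_iso G H" shows "graph_iso H G"
proof -
  obtain f where f: "bij_betw f (verts G) (verts H)"
    "\<forall>u\<in>verts G. \<forall>v\<in>verts G. adj G u v \<longleftrightarrow> adj H (f u) (f v)" using assms by (auto simp: graph_iso_def)
  let ?g = "inv_into (verts G) f"
  have "bij_betw ?g (verts H) (verts G)" using f(1) by (rule bij_betw_inv_into)
  moreover have "adj H u v \<longleftrightarrow> adj G (?g u) (?g v)" if uv: "u \<in> verts H" "v \<in> verts H" for u v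
  proof -
    have "?g x \<in> verts G \<and> f (?g x) = x" if "x \<in> verts H" for x
      using f(1) that by (auto simp: bij_betw_def f_inv_into_f inv_into_into)
    then show ?thesis using f(2) uv by metis
  qed
  ultimately show ?thesis unfolding graph_iso_def by (intro exI[of _ ?g]) blast
qed

lemma graph_iso_trans:
  assumes "graph_iso G H" "graph_iso H K" shows "graph_iso G K"
proof -
  obtain f where f: "bij_betw f (verts G) (verts H)"
    "\<forall>u\<in>verts G. \<forall>v\<in>verts G. adj G u v \<longleftrightarrow> adj H (f u) (f v)" using assms by (auto simp: graph_iso_def)
  obtain g where g: "bij_betw g (verts H) (verts K)"
    "\<forall>u\<in>verts H. \<forall>v\<in>verts H. adj H u v \<longleftrightarrow> adj K (g u) (g v)" using assms by (auto simp: graph_iso_def)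
  have "\<forall>u\<in>verts G. f u \<in> verts H" using f(1) by (auto simp: bij_betw_def)
  then show ?thesis unfolding graph_iso_def
    using bij_betw_trans[OF f(1) g(1)] f(2) g(2) by (intro exI[of _ "g \<circ> f"]) auto
qed

lemma graph_iso_conn_graph:
  assumes G: "conn_graph G" and H: "simple_graph H"
    and f: "bij_betw f (verts G) (verts H)"
      "\<forall>u\<in>verts G. \<forall>v\<in>verts G. adj G u v \<longleftrightarrow> adj H (f u) (f v)"
  shows "conn_graph H"
    and "\<And>u v. u \<in> verts G \<Longrightarrow> v \<in> verts G \<Longrightarrow> graph_dist H (f u) (f v) = graph_dist G u v"
proof -
  interpret G: conn_graph G by fact
  let ?g = "inv_into (verts G) f"
  have g: "?g v \<in> verts G" "f (?g v) = v" if "v \<in> verts H" for v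
    using f(1) that by (auto simp: bij_betw_def f_inv_into_f inv_into_into)
  have gf: "?g (f u) = u" "f u \<in> verts H" if "u \<in> verts G" for u
    using f(1) that by (auto simp: bij_betw_def)
  have *: "conn_graph H \<and> (\<forall>u\<in>verts H. \<forall>v\<in>verts H. graph_dist H u v = graph_dist G (?g u) (?g v))"
  proof (rule conn_graph_distI[OF H])
    show "graph_dist G (?g u) (?g w) \<le> Suc (graph_dist G (?g u) (?g v))" if "u \<in> verts H" "adj H v w" for u v w
    proof -
      have "v \<in> verts H" "w \<in> verts H" using simple_graph_adjD[OF H that(2)] by auto
      then show ?thesis using that g f(2) by (intro G.dist_step) auto
    qed
    show "\<exists>w. adj H w v \<and> graph_dist G (?g u) (?g v) = Suc (graph_dist G (?g u) (?g w))"
      if uv: "u \<in> verts H" "v \<in> verts H" "v \<noteq> u" for u v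
    proof -
      have "?g v \<noteq> ?g u" using g uv by metis
      then obtain w where w: "adj G w (?g v)" "graph_dist G (?g u) (?g v) = Suc (graph_dist G (?g u) w)"
        using G.dist_pred[of "?g u" "?g v"] g uv by metis
      then have "w \<in> verts G" using G.adjD by blast
      then show ?thesis using w gf[of w] g uv f(2) by (intro exI[of _ "f w"]) auto
    qed
  qed (use g gf f(1) G.V_nonempty in \<open>auto simp: bij_betw_def\<close>)
  show "conn_graph H" using * ..
  show "\<And>u v. u \<in> verts G \<Longrightarrow> v \<in> verts G \<Longrightarrow> graph_dist H (f u) (f v) = graph_dist G u v"
    using * gf by simp
qed

section \<open>Good graphs and their geodesics\<close>

text \<open>The functional is pulled back along the linear map \<open>T\<close>; injectivity keeps
  nonzero vectors nonzero. The map will be extension by zero for sub-configurations, and a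
  redistribution of weights for contracted paths.\<close>

lemma neg_on_hyperplane_transfer:
  assumes g: "neg_on_hyperplane d' V'"
    and lin: "\<And>x y a b. T (\<lambda>v. a * x v + b * y v) = (\<lambda>v. a * T x v + b * T y v)"
    and inj: "\<And>x v. v \<in> V \<Longrightarrow> x v \<noteq> 0 \<Longrightarrow> \<exists>v\<in>V'. T x v \<noteq> 0"
    and le: "\<And>x. qform d V x \<le> qform d' V' (T x)"
  shows "neg_on_hyperplane d V"
proof -
  obtain f where f: "linear_functional f"
    "\<And>x. f x = 0 \<Longrightarrow> (\<exists>v\<in>V'. x v \<noteq> 0) \<Longrightarrow> qform d' V' x < 0"
    using g unfolding neg_on_hyperplane_def by blast
  have "linear_functional (\<lambda>x. f (T x))" using f(1) by (simp add: linear_functional_def lin)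
  moreover have "qform d V x < 0" if "f (T x) = 0" "\<exists>v\<in>V. x v \<noteq> 0" for x
    using f(2)[OF that(1)] inj that(2) le[of x] by fastforce
  ultimately show ?thesis unfolding neg_on_hyperplane_def by blast
qed

lemma sum_zero_extension:
  assumes "finite V'" "inj_on f V" "f ` V \<subseteq> V'"
  shows "(\<Sum>w\<in>V'. if w \<in> f ` V then g (inv_into V f w) else (0::real)) = (\<Sum>v\<in>V. g v)"
proof -
  have "(\<Sum>w\<in>V'. if w \<in> f ` V then g (inv_into V f w) else 0) = (\<Sum>w\<in>f ` V. g (inv_into V f w))"
    using assms by (simp add: sum.If_cases Int_absorb1)
  also have "\<dots> = (\<Sum>v\<in>V. g v)"
    using assms(2) by (simp add: sum.reindex)
  finally show ?thesis .
qed

text \<open>Extension by zero along \<open>f\<close> preserves the form. The same lemma moves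
  between graphs, lists of chosen vertices and numerical tables.\<close>

lemma neg_on_hyperplane_inj:
  assumes g: "neg_on_hyperplane d' V'" and fin: "finite V'"
    and f: "inj_on f V" "f ` V \<subseteq> V'"
    and d: "\<And>u v. u \<in> V \<Longrightarrow> v \<in> V \<Longrightarrow> d u v = d' (f u) (f v)"
  shows "neg_on_hyperplane d V"
proof (rule neg_on_hyperplane_transfer[OF g, of "\<lambda>x w. if w \<in> f ` V then x (inv_into V f w) else 0"])
  fix x :: "'b \<Rightarrow> real"
  let ?i = "inv_into V f"
  let ?T = "\<lambda>w. if w \<in> f ` V then x (?i w) else 0"
  have q: "(\<Sum>w\<in>V'. (?T w)\<^sup>2) = (\<Sum>v\<in>V. (x v)\<^sup>2)"
    using sum_zero_extension[OF fin f, of "\<lambda>v. (x v)\<^sup>2"] by (simp add: if_distrib[of "\<lambda>z. z\<^sup>2"] cong: if_cong)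
  have inner: "(\<Sum>v\<in>V'. d' u v * ?T u * ?T v) = (if u \<in> f ` V then \<Sum>v\<in>V. d (?i u) v * x (?i u) * x v else 0)" for u
  proof (cases "u \<in> f ` V")
    case True
    have "(\<Sum>v\<in>V'. d' u v * ?T u * ?T v)
      = (\<Sum>v\<in>V'. if v \<in> f ` V then d (?i u) (?i v) * x (?i u) * x (?i v) else 0)"
      using True by (intro sum.cong refl) (auto simp: d inv_into_into f_inv_into_f)
    also have "\<dots> = (\<Sum>v\<in>V. d (?i u) v * x (?i u) * x v)"
      by (rule sum_zero_extension[OF fin f])
    finally show ?thesis using True by simp
  qed auto
  have "(\<Sum>u\<in>V'. \<Sum>v\<in>V'. d' u v * ?T u * ?T v) = (\<Sum>u\<in>V. \<Sum>v\<in>V. d u v * x u * x v)"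
    unfolding inner by (rule sum_zero_extension[OF fin f])
  with q show "qform d V x \<le> qform d' V' ?T" by (simp add: qform_def)
next
  fix x :: "'b \<Rightarrow> real" and v assume "v \<in> V" "x v \<noteq> 0"
  then show "\<exists>w\<in>V'. (if w \<in> f ` V then x (inv_into V f w) else 0) \<noteq> 0"
    using f by (intro bexI[of _ "f v"]) auto
qed auto

definition bform :: "('a \<Rightarrow> 'a \<Rightarrow> real) \<Rightarrow> 'a set \<Rightarrow> ('a \<Rightarrow> real) \<Rightarrow> ('a \<Rightarrow> real) \<Rightarrow> real" where
  "bform d V x y = (\<Sum>u\<in>V. \<Sum>v\<in>V. d u v * x u * y v) + (\<Sum>v\<in>V. x v * y v) / 2"

lemma qform_combination:
  assumes sym: "\<And>u v. u \<in> V \<Longrightarrow> v \<in> V \<Longrightarrow> d u v = d v u"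
  shows "qform d V (\<lambda>v. a * x v + b * y v)
    = a\<^sup>2 * bform d V x x + 2 * a * b * bform d V x y + b\<^sup>2 * bform d V y y"
proof -
  have s: "(\<Sum>u\<in>V. \<Sum>v\<in>V. d u v * y u * x v) = (\<Sum>u\<in>V. \<Sum>v\<in>V. d u v * x u * y v)"
    by (subst sum.swap) (intro sum.cong refl, simp add: sym mult_ac)
  have "qform d V (\<lambda>v. a * x v + b * y v) =
    a\<^sup>2 * (\<Sum>u\<in>V. \<Sum>v\<in>V. d u v * x u * x v) + a * b * (\<Sum>u\<in>V. \<Sum>v\<in>V. d u v * x u * y v)
    + a * b * (\<Sum>u\<in>V. \<Sum>v\<in>V. d u v * y u * x v) + b\<^sup>2 * (\<Sum>u\<in>V. \<Sum>v\<in>V. d u v * y u * y v)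
    + (a\<^sup>2 * (\<Sum>v\<in>V. x v * x v) + 2 * a * b * (\<Sum>v\<in>V. x v * y v) + b\<^sup>2 * (\<Sum>v\<in>V. y v * y v)) / 2"
    unfolding qform_def
    by (simp add: sum.distrib sum_distrib_left power2_eq_square distrib_left distrib_right mult_ac)
  then show ?thesis unfolding s bform_def by (simp add: field_simps)
qed

text \<open>The three inequalities say that the Gram matrix of \<open>x\<close> and \<open>y\<close>
  is positive semidefinite, so the form is nonnegative on their span. The minor at \<open>i\<close>
  and \<open>j\<close> makes the two vectors independent on \<open>V\<close>.\<close>

lemma neg_on_hyperplane_contradiction:
  assumes g: "neg_on_hyperplane d V"
    and sym: "\<And>u v. u \<in> V \<Longrightarrow> v \<in> V \<Longrightarrow> d u v = d v u"
    and pq: "bform d V x x \<ge> 0" "bform d V y y \<ge> 0"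
      "(bform d V x y)\<^sup>2 \<le> bform d V x x * bform d V y y"
    and ij: "i \<in> V" "j \<in> V" "x i * y j \<noteq> x j * y i"
  shows False
proof -
  define p q h where "p = bform d V x x" and "q = bform d V y y" and "h = bform d V x y"
  have nn: "qform d V (\<lambda>v. a * x v + b * y v) \<ge> 0" for a b
  proof -
    have "a\<^sup>2 * p + 2 * a * b * h + b\<^sup>2 * q \<ge> 0"
    proof (cases "p = 0")
      case True
      then have "h = 0" using pq by (simp add: p_def q_def h_def)
      then show ?thesis using True pq by (simp add: q_def)
    next
      case False
      then have p: "p > 0" using pq by (simp add: p_def)
      \<comment> \<open>Completing the square; in the other case, \<open>p = 0\<close>, the
        determinant inequality forces \<open>h = 0\<close>.\<close>
      have "p * (a\<^sup>2 * p + 2 * a * b * h + b\<^sup>2 * q) = (a * p + b * h)\<^sup>2 + b\<^sup>2 * (p * q - h\<^sup>2)"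
        by (simp add: power2_eq_square algebra_simps)
      also have "\<dots> \<ge> 0" using pq by (simp add: p_def q_def h_def)
      finally show ?thesis using p by (simp add: zero_le_mult_iff)
    qed
    then show ?thesis by (simp add: qform_combination[OF sym] p_def q_def h_def)
  qed
  obtain a b where ab: "(a, b) \<noteq> (0, 0)" "\<And>v. v \<in> V \<Longrightarrow> a * x v + b * y v = 0"
    using neg_on_hyperplane_no_plane[OF g nn] by metis
  have "a * (x i * y j - x j * y i) = y j * (a * x i + b * y i) - y i * (a * x j + b * y j)"
    "b * (x i * y j - x j * y i) = x i * (a * x j + b * y j) - x j * (a * x i + b * y i)"
    by (simp_all add: algebra_simps)
  then have "a * (x i * y j - x j * y i) = 0" "b * (x i * y j - x j * y i) = 0"
    using ab(2)[OF ij(1)] ab(2)[OF ij(2)] by simp_all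
  then show False using ab(1) ij(3) by simp
qed

text \<open>By \<open>distance_eigenvalue_2_less_iff\<close> below, these are the graphs with
  \<open>\<lambda>\<^sub>2 < - 1 / 2\<close>.\<close>

definition good :: "'a graph \<Rightarrow> bool" where
  "good G \<longleftrightarrow> neg_on_hyperplane (\<lambda>u v. real (graph_dist G u v)) (verts G)"

lemma (in conn_graph) good_points:
  assumes "good G" "distinct vs" "set vs \<subseteq> V"
  shows "neg_on_hyperplane (\<lambda>i j. real (d (vs ! i) (vs ! j))) {..<length vs}"
  using assms unfolding good_def
  by (elim neg_on_hyperplane_inj[of _ _ "(!) vs"]) (auto simp: finite_V inj_on_nth)

lemma good_iso:
  assumes G: "conn_graph G" and H: "simple_graph H" and iso: "graph_iso G H"
  shows "good G \<longleftrightarrow> good H"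
proof -
  obtain f where f: "bij_betw f (verts G) (verts H)"
    "\<forall>u\<in>verts G. \<forall>v\<in>verts G. adj G u v \<longleftrightarrow> adj H (f u) (f v)" using iso by (auto simp: graph_iso_def)
  note * = graph_iso_conn_graph[OF G H f]
  have fin: "finite (verts G)" "finite (verts H)" using G * by (auto dest: conn_graph.finite_V)
  let ?g = "inv_into (verts G) f"
  have "good G" if "good H"
    using that unfolding good_def
    by (rule neg_on_hyperplane_inj[of _ _ f]) (use f(1) * fin in \<open>auto simp: bij_betw_def\<close>)
  moreover have "good H" if "good G"
    using that unfolding good_def
  proof (rule neg_on_hyperplane_inj[of _ _ ?g])
    have g: "bij_betw ?g (verts H) (verts G)" using f(1) by (rule bij_betw_inv_into)
    show "inj_on ?g (verts H)" "?g ` verts H \<subseteq> verts G" using g by (auto simp: bij_betw_def)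
    fix u v assume uv: "u \<in> verts H" "v \<in> verts H"
    have "?g u \<in> verts G" "f (?g u) = u" "?g v \<in> verts G" "f (?g v) = v"
      using f(1) uv by (auto simp: bij_betw_def f_inv_into_f inv_into_into)
    then show "real (graph_dist H u v) = real (graph_dist G (?g u) (?g v))"
      using *(2)[of "?g u" "?g v"] by simp
  qed (rule fin)
  ultimately show ?thesis by blast
qed

lemma (in conn_graph) good_remove:
  assumes "good (add_leaf G u w)" "u \<in> V" "w \<notin> V"
  shows "good G"
  using assms(1) unfolding good_def
  by (rule neg_on_hyperplane_inj[of _ _ id]) (auto simp: finite_V add_leaf[OF assms(2,3)])

section \<open>Local geodesics\<close>

lemma (in conn_graph) good_four_points:
  assumes good: "good G" and pq: "adj G p q" and rs: "adj G r s" and "q \<noteq> r"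
    and k: "d p r = Suc (d q r)" "d q s = Suc (d q r)"
  shows "d p s = Suc (Suc (d q r))"
proof (rule ccontr)
  assume ne: "d p s \<noteq> Suc (Suc (d q r))"
  note V = adjD[OF pq] adjD[OF rs]
  have "d p s \<le> Suc (d p r)" using dist_step rs V by auto
  then have le: "d p s \<le> Suc (d q r)" using k ne by simp
  have "d p q = 1" "d r s = 1" using dist_eq_1_iff V pq rs by auto
  moreover have ps: "p \<noteq> s"
  proof
    assume "p = s"
    then have "d q s = 1" using \<open>d p q = 1\<close> dist_sym V by simp
    then have "d q r = 0" using k by simp
    then show False using dist_eq_0_iff V \<open>q \<noteq> r\<close> by simp
  qed
  moreover have pr: "p \<noteq> r" "q \<noteq> s" using k V by auto
  ultimately have D: "d q p = 1" "d s r = 1" "d p q = 1" "d r s = 1" "d r p = d p r" "d s q = d q s"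
    "d r q = d q r" "d s p = d p s" using dist_sym V by auto
  let ?vs = "[p, q, r, s]"
  let ?D = "\<lambda>i j. real (d (?vs ! i) (?vs ! j))"
  \<comment> \<open>Exchanging \<open>p\<close> with \<open>s\<close> and \<open>q\<close> with
    \<open>r\<close> preserves the four-point distances, negates \<open>?x\<close> and fixes
    \<open>?y\<close>, so the mixed term vanishes. What remains is the value at \<open>?x\<close>,
    namely 2 (\<open>d q r\<close> + 1 - \<open>d p s\<close>), which is nonnegative as soon as
    \<open>d p s\<close> falls short of the sum of the overlapping geodesics.\<close>
  let ?x = "\<lambda>i. [1, - 1, 1, - 1] ! i" and ?y = "\<lambda>i::nat. 1 :: real"
  have "distinct ?vs" using V pr ps \<open>q \<noteq> r\<close> by auto
  then have g: "neg_on_hyperplane ?D {..<4}"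
    using good_points[OF good, of ?vs] V by (simp add: numeral_eq_Suc)
  have four: "{..<4::nat} = {0, 1, 2, 3}" by auto
  have xx: "bform ?D {..<4} ?x ?x = 2 * (Suc (d q r) - real (d p s))"
    and xy: "bform ?D {..<4} ?x ?y = 0"
    and yy: "bform ?D {..<4} ?y ?y \<ge> 0"
    unfolding bform_def four using V D k by (simp_all add: field_simps)
  have sym: "?D u v = ?D v u" if "u \<in> {..<4}" "v \<in> {..<4}" for u v
  proof -
    have "?vs ! u \<in> set ?vs" "?vs ! v \<in> set ?vs" using that by (intro nth_mem; simp)+
    then have "?vs ! u \<in> V" "?vs ! v \<in> V" using V by auto
    then show ?thesis using dist_sym by simp
  qed
  show False
    by (rule neg_on_hyperplane_contradiction[OF g sym, of ?x ?y 0 1])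
      (use xx xy yy le in \<open>auto\<close>)
qed

text \<open>In a good graph a walk in which any three consecutive vertices form a geodesic is a
  geodesic.\<close>

lemma (in conn_graph) good_extend:
  assumes good: "good G" and p: "p \<in> V" and r: "adj G r' r" "adj G r s" "r' \<noteq> s" "\<not> adj G r' s"
    and pr: "d p r = Suc (d p r')"
  shows "d p s = Suc (d p r)"
  using p pr
proof (induction "d p r'" arbitrary: p)
  case 0
  have V: "r' \<in> V" "r \<in> V" "s \<in> V" using adjD r by auto
  have "p = r'" using 0 V by (simp add: dist_eq_0_iff)
  have "d r' s \<le> 2" using dist_step[of r' r s] r V 0 \<open>p = r'\<close> by simp
  moreover have "d r' s \<noteq> 0" "d r' s \<noteq> 1" using V r dist_eq_0_iff dist_eq_1_iff by auto
  ultimately show ?case using 0 \<open>p = r'\<close> by simp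
next
  case (Suc k)
  have V: "r' \<in> V" "r \<in> V" "s \<in> V" using adjD r by auto
  have "p \<noteq> r'" using Suc.hyps(2) V by auto
  \<comment> \<open>The vertex \<open>q\<close> is one step closer to \<open>r'\<close>, so the
    claim holds from \<open>q\<close>; the four points \<open>p\<close>, \<open>q\<close>,
    \<open>r\<close>, \<open>s\<close> then carry it back to \<open>p\<close>.\<close>
  then obtain q where q: "adj G p q" "d p r' = Suc (d q r')" using dist_succ[of p r'] Suc.prems V by metis
  have qV: "q \<in> V" using adjD q by auto
  have "d q r \<le> Suc (d q r')" using dist_step[OF qV] r by simp
  moreover have "d p r \<le> Suc (d q r)"
    using dist_step[of r q p] q(1) V qV Suc.prems dist_sym by (simp add: insert_commute)
  ultimately have qr: "d q r = Suc (d q r')" using Suc.prems q by simp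
  then have "d q s = Suc (d q r)" using Suc.hyps(1)[of q] Suc.hyps(2) q qV by simp
  moreover have "q \<noteq> r" using qr V by auto
  ultimately show ?case using good_four_points[OF good q(1) r(2)] Suc.prems qr q by simp
qed

text \<open>The condition on large entries says that \<open>j\<close> is reached from
  \<open>i\<close> through two last steps \<open>r'\<close>, \<open>r\<close>, \<open>j\<close>
  forming an induced path, with distances from \<open>i\<close> growing by one each time. This is
  the shape to which \<open>good_extend\<close> applies, so in a good graph the entries equal to 1
  determine all others.\<close>

definition geodetic_table :: "nat \<Rightarrow> (nat \<Rightarrow> nat \<Rightarrow> nat) \<Rightarrow> bool" where
  "geodetic_table m M \<longleftrightarrow> (\<forall>i<m. M i i = 0 \<and> (\<forall>j<m. M i j = M j i) \<and> (\<forall>j<i. M i j > 0 \<and> (M i j > 1 \<longrightarrow>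
     (\<exists>r<m. \<exists>r'<m. M r j = 1 \<and> M r' r = 1 \<and> M r' j = 2 \<and> M i r' + 2 = M i j \<and> M i r + 1 = M i j))))"

text \<open>Induction on the size of the entry. The two smaller entries for \<open>r'\<close> and
  \<open>r\<close> are distances already, and \<open>good_extend\<close> adds the last step.\<close>

lemma (in conn_graph) good_geodetic_table:
  assumes good: "good G" and M: "geodetic_table m M"
    and f: "inj_on f {..<m}" "f ` {..<m} \<subseteq> V"
    and a: "\<And>i j. i < m \<Longrightarrow> j < i \<Longrightarrow> adj G (f i) (f j) \<longleftrightarrow> M i j = 1"
    and ij: "i < m" "j < m"
  shows "d (f i) (f j) = M i j"
proof -
  have fV: "f i \<in> V" if "i < m" for i using f that by auto
  have Msym: "M i j = M j i" if "i < m" "j < m" for i j using M that by (auto simp: geodetic_table_def)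
  have a': "adj G (f i) (f j) \<longleftrightarrow> M i j = 1" if "i < m" "j < m" for i j
  proof -
    consider "i < j" | "i = j" | "j < i" by linarith
    then show ?thesis
    proof cases
      case 1
      then show ?thesis using a[of j i] that Msym[of i j] by (simp add: insert_commute)
    next
      case 2
      then show ?thesis using that M adjD(3)[of "f i" "f i"] by (auto simp: geodetic_table_def)
    qed (use a that in simp)
  qed
  show ?thesis using ij
  proof (induction "M i j" arbitrary: i j rule: less_induct)
    case less
    have main: "d (f i) (f j) = M i j" if ij: "i < m" "j < i"
      and IH: "\<And>k. k < m \<Longrightarrow> M i k < M i j \<Longrightarrow> d (f i) (f k) = M i k" for i j
    proof -
      have "M i j > 0" using M ij unfolding geodetic_table_def by blast
      then consider "M i j = 1" | "M i j > 1" by linarith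
      then show ?thesis
      proof cases
        case 1
        then show ?thesis using a'[of i j] dist_eq_1_iff[of "f i" "f j"] fV ij by simp
      next
        case 2
        then obtain r r' where r: "r < m" "r' < m" "M r j = 1" "M r' r = 1" "M r' j = 2"
          "M i r' + 2 = M i j" "M i r + 1 = M i j"
          using M ij unfolding geodetic_table_def by blast
        have "d (f i) (f r') = M i r'" "d (f i) (f r) = M i r"
          using IH[of r'] IH[of r] r by linarith+
        moreover have "r' \<noteq> j" using r M by (auto simp: geodetic_table_def)
        then have "f r' \<noteq> f j" using f r ij by (auto simp: inj_on_def)
        ultimately show ?thesis
          using good_extend[OF good, of "f i" "f r'" "f r" "f j"] a' fV r ij by simp
      qed
    qed
    have hyp: "d (f a) (f b) = M a b" if "a < m" "b < m" "M a b < M i j" for a b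
      using less.hyps that by blast
    consider "i < j" | "i = j" | "j < i" by linarith
    then show ?case
    proof cases
      case 1
      have "d (f j) (f i) = M j i"
        by (rule main[OF _ _ hyp]) (use less.prems 1 Msym[of i j] in auto)
      then show ?thesis using less.prems Msym[of i j] dist_sym[of "f i" "f j"] fV by simp
    next
      case 2
      then show ?thesis using M fV less.prems by (simp add: geodetic_table_def)
    next
      case 3
      show ?thesis by (rule main[OF _ _ hyp]) (use less.prems 3 in auto)
    qed
  qed
qed

section \<open>Certificates against induced configurations\<close>

definition dot :: "int list \<Rightarrow> int list \<Rightarrow> int" where
  "dot xs ys = sum_list (map2 (*) xs ys)"

text \<open>This is twice \<open>bform\<close>. Doubling clears the denominator, so that
  certificates are checked by evaluation over the integers.\<close>

definition doubled_form :: "nat list list \<Rightarrow> int list \<Rightarrow> int list \<Rightarrow> int" where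
  "doubled_form M xs ys = 2 * dot xs (map (\<lambda>r. dot (map int r) ys) M) + dot xs ys"

definition table_of :: "nat list list \<Rightarrow> nat \<Rightarrow> nat \<Rightarrow> nat" where
  "table_of M i j = M ! i ! j"

text \<open>Certificate that the table \<open>M\<close> cannot occur as an induced subgraph of a good graph: such a
  subgraph would inherit the distances \<open>M\<close>, and the form is nonnegative on the plane spanned by
  \<open>xs\<close> and the all-ones vector.\<close>

definition obstruction :: "nat list list \<Rightarrow> int list \<Rightarrow> bool" where
  "obstruction M xs \<longleftrightarrow> (let m = length M; ys = replicate m 1; p = doubled_form M xs xs in
    length xs = m \<and> list_all (\<lambda>r. length r = m) M \<and> m > 1 \<and>
    p \<ge> 0 \<and> (doubled_form M xs ys)\<^sup>2 \<le> p * doubled_form M ys ys \<and> list_ex (\<lambda>e. e \<noteq> xs ! 0) xs \<and>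
    list_all (\<lambda>i. M ! i ! i = 0 \<and> list_all (\<lambda>j. M ! i ! j = M ! j ! i) [0..<i]
      \<and> list_all (\<lambda>j. M ! i ! j > 0 \<and> (M ! i ! j > 1 \<longrightarrow>
       list_ex (\<lambda>r. M ! r ! j = 1 \<and> M ! i ! r + 1 = M ! i ! j \<and> list_ex (\<lambda>r'.
          M ! r' ! r = 1 \<and> M ! r' ! j = 2 \<and> M ! i ! r' + 2 = M ! i ! j) [0..<m]) [0..<m])) [0..<i]) [0..<m])"

lemma dot_eq_sum: "length xs = n \<Longrightarrow> length ys = n \<Longrightarrow> dot xs ys = (\<Sum>i<n. xs ! i * ys ! i)"
  by (simp add: dot_def sum_list_sum_nth atLeast0LessThan)

lemma doubled_form_eq:
  assumes "length M = m" "\<And>r. r \<in> set M \<Longrightarrow> length r = m" "length xs = m" "length ys = m"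
  shows "real_of_int (doubled_form M xs ys)
    = 2 * bform (\<lambda>i j. real (table_of M i j)) {..<m} (\<lambda>i. real_of_int (xs ! i)) (\<lambda>i. real_of_int (ys ! i))"
proof -
  have "dot (map int (M ! i)) ys = (\<Sum>j<m. int (table_of M i j) * ys ! j)" if "i < m" for i
    using assms that by (subst dot_eq_sum[of _ m]) (auto simp: table_of_def)
  then have "doubled_form M xs ys = 2 * (\<Sum>i<m. xs ! i * (\<Sum>j<m. int (table_of M i j) * ys ! j)) + (\<Sum>i<m. xs ! i * ys ! i)"
    unfolding doubled_form_def using assms by (simp add: dot_eq_sum[of _ m])
  then show ?thesis
    by (simp add: bform_def sum_distrib_left mult_ac)
qed

lemma obstructionD:
  assumes "obstruction M xs"
  shows "geodetic_table (length M) (table_of M)"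
    and "\<not> neg_on_hyperplane (\<lambda>i j. real (table_of M i j)) {..<length M}"
proof -
  let ?m = "length M" and ?b = "bform (\<lambda>i j. real (table_of M i j)) {..<length M}"
  let ?ys = "replicate (length M) 1"
  let ?x = "\<lambda>i. real_of_int (xs ! i)" and ?y = "\<lambda>i. real_of_int (?ys ! i)"
  note * = assms[unfolded obstruction_def Let_def list_all_iff list_ex_iff set_upt]
  have l: "length xs = ?m" "\<And>r. r \<in> set M \<Longrightarrow> length r = ?m" "?m > 1"
    and f: "doubled_form M xs xs \<ge> 0"
      "(doubled_form M xs ?ys)\<^sup>2 \<le> doubled_form M xs xs * doubled_form M ?ys ?ys"
    and "\<exists>e\<in>set xs. e \<noteq> xs ! 0"
    using * by blast+
  \<comment> \<open>An entry of \<open>xs\<close> different from the first one makes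
    \<open>xs\<close> independent of the all-ones vector.\<close>
  then obtain k where k: "k < ?m" "xs ! k \<noteq> xs ! 0" by (metis in_set_conv_nth)
  have t0: "M ! i ! i = 0" if "i < ?m" for i
    using * that by (meson atLeastLessThan_iff le0)
  have t1: "M ! i ! j = M ! j ! i" if "i < ?m" "j < i" for i j
    using * that by (meson atLeastLessThan_iff le0)
  have t2: "M ! i ! j > 0 \<and> (M ! i ! j > 1 \<longrightarrow> 
       (\<exists>r<?m. M ! r ! j = 1 \<and> M ! i ! r + 1 = M ! i ! j \<and> (\<exists>r'<?m. 
          M ! r' ! r = 1 \<and> M ! r' ! j = 2 \<and> M ! i ! r' + 2 = M ! i ! j)))"
    if "i < ?m" "j < i" for i j
    using * that by (meson atLeastLessThan_iff le0)
  have sym: "table_of M i j = table_of M j i" if "i < ?m" "j < ?m" for i j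
    using t1[of i j] t1[of j i] that by (cases i j rule: linorder_cases) (auto simp: table_of_def)
  then show "geodetic_table ?m (table_of M)"
    unfolding geodetic_table_def using t0 t2 unfolding table_of_def by blast
  show "\<not> neg_on_hyperplane (\<lambda>i j. real (table_of M i j)) {..<?m}"
  proof
    assume g: "neg_on_hyperplane (\<lambda>i j. real (table_of M i j)) {..<?m}"
    note e = doubled_form_eq[OF refl l(2)]
    have "(?b ?x ?y)\<^sup>2 \<le> ?b ?x ?x * ?b ?y ?y"
    proof -
      have "real_of_int ((doubled_form M xs ?ys)\<^sup>2) \<le> real_of_int (doubled_form M xs xs * doubled_form M ?ys ?ys)"
        using f(2) by (simp only: of_int_le_iff)
      then show ?thesis unfolding of_int_power of_int_mult
        using e[of xs ?ys] e[of xs xs] e[of ?ys ?ys] l by (simp add: power2_eq_square)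
    qed
    moreover have "?b ?x ?x \<ge> 0"
      using e[of xs xs] l f by (smt (verit) of_int_0_le_iff)
    moreover have "?b ?y ?y \<ge> 0"
      unfolding bform_def by (intro add_nonneg_nonneg sum_nonneg divide_nonneg_nonneg) auto
    moreover have m: "0 \<in> {..<?m}" "k \<in> {..<?m}" using k by auto
    moreover have "?x 0 * ?y k \<noteq> ?x k * ?y 0" using k m by (simp add: nth_replicate)
    ultimately show False
      using neg_on_hyperplane_contradiction[OF g, of ?x ?y 0 k] sym by (metis lessThan_iff)
  qed
qed

lemma (in conn_graph) good_no_obstruction:
  assumes "good G" "obstruction M xs"
    and vs: "length vs = length M" "distinct vs" "set vs \<subseteq> V"
    and a: "\<And>i j. i < length M \<Longrightarrow> j < i \<Longrightarrow> adj G (vs ! i) (vs ! j) \<longleftrightarrow> M ! i ! j = 1"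
  shows False
proof -
  have "d (vs ! i) (vs ! j) = table_of M i j" if "i < length M" "j < length M" for i j
    by (rule good_geodetic_table[OF assms(1) obstructionD(1)[OF assms(2)]])
      (use vs a that in \<open>auto simp: table_of_def inj_on_nth\<close>)
  then have "neg_on_hyperplane (\<lambda>i j. real (table_of M i j)) {..<length M}"
    using good_points[OF assms(1) vs(2,3)] vs(1)
    by (elim neg_on_hyperplane_inj[of _ _ id]) auto
  then show False using obstructionD(2)[OF assms(2)] by simp
qed

section \<open>Tripods\<close>

lemma qform_insert:
  assumes "finite S" "w \<notin> S" "d w w = 0" "\<And>v. v \<in> S \<Longrightarrow> d v w = d w v"
  shows "qform d (insert w S) x = qform d S x + 2 * x w * (\<Sum>v\<in>S. d w v * x v) + (x w)\<^sup>2 / 2"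
proof -
  have "(\<Sum>v\<in>S. d v w * x v * x w) = x w * (\<Sum>v\<in>S. d w v * x v)"
    using assms(4) by (simp add: sum_distrib_left mult_ac)
  moreover have "(\<Sum>v\<in>S. d w v * x w * x v) = x w * (\<Sum>v\<in>S. d w v * x v)"
    by (simp add: sum_distrib_left mult_ac)
  ultimately show ?thesis using assms(1-3) by (simp add: qform_def sum.distrib field_simps)
qed

lemma qform_cong:
  assumes "\<And>u v. u \<in> S \<Longrightarrow> v \<in> S \<Longrightarrow> d u v = d' u v" "\<And>v. v \<in> S \<Longrightarrow> x v = y v"
  shows "qform d S x = qform d' S y"
  using assms by (simp add: qform_def cong: sum.cong)

lemma qform_union:
  assumes "finite A" "finite B" "A \<inter> B = {}" "\<And>a b. a \<in> A \<Longrightarrow> b \<in> B \<Longrightarrow> d b a = d a b"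
  shows "qform d (A \<union> B) x = qform d A x + qform d B x + 2 * (\<Sum>a\<in>A. \<Sum>b\<in>B. d a b * x a * x b)"
proof -
  have "(\<Sum>b\<in>B. \<Sum>a\<in>A. d b a * x b * x a) = (\<Sum>a\<in>A. \<Sum>b\<in>B. d a b * x a * x b)"
    by (subst sum.swap) (intro sum.cong refl, simp add: assms(4) mult_ac)
  then show ?thesis
    using assms(1-3) by (simp add: qform_def sum.union_disjoint sum.distrib field_simps)
qed

text \<open>Replacing a cut vertex \<open>c\<close> by a path \<open>c, p, e\<close> that separates its two sides \<open>A\<close> and \<open>B\<close>
  changes the form by the square of the total weight, under a suitable redistribution of weights.\<close>

lemma neg_on_hyperplane_contract:
  fixes d d' :: "'a \<Rightarrow> 'a \<Rightarrow> real"
  assumes g: "neg_on_hyperplane d' (insert c (insert p (insert e (A \<union> B))))"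
    and fin: "finite A" "finite B" and disj: "A \<inter> B = {}"
    and new: "c \<notin> A \<union> B" "p \<notin> A \<union> B" "e \<notin> A \<union> B" "c \<noteq> p" "c \<noteq> e" "p \<noteq> e"
    and sym: "\<And>u v. d u v = d v u" "\<And>u v. d' u v = d' v u" and zero: "\<And>u. d u u = 0" "\<And>u. d' u u = 0"
    and dAA: "\<And>u v. u \<in> A \<Longrightarrow> v \<in> A \<Longrightarrow> d' u v = d u v"
    and dBB: "\<And>u v. u \<in> B \<Longrightarrow> v \<in> B \<Longrightarrow> d' u v = d u v"
    and dAB: "\<And>u v. u \<in> A \<Longrightarrow> v \<in> B \<Longrightarrow> d u v = d c u + d c v"
    and dAB': "\<And>u v. u \<in> A \<Longrightarrow> v \<in> B \<Longrightarrow> d' u v = d c u + d c v + 2"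
    and dA: "\<And>u. u \<in> A \<Longrightarrow> d' c u = d c u" "\<And>u. u \<in> A \<Longrightarrow> d' p u = d c u + 1" "\<And>u. u \<in> A \<Longrightarrow> d' e u = d c u + 2"
    and dB: "\<And>u. u \<in> B \<Longrightarrow> d' c u = d c u + 2" "\<And>u. u \<in> B \<Longrightarrow> d' p u = d c u + 1" "\<And>u. u \<in> B \<Longrightarrow> d' e u = d c u"
    and path: "d' c p = 1" "d' c e = 2" "d' p e = 1"
  shows "neg_on_hyperplane d (insert c (A \<union> B))"
proof -
  \<comment> \<open>The weights on \<open>c\<close>, \<open>p\<close> and \<open>e\<close> add up to
    \<open>x c\<close>, so the total weight is preserved. The value at \<open>p\<close> alone
    already determines \<open>x c\<close>, which makes the map injective.\<close>
  let ?T = "\<lambda>x w. if w = c then x c + sum x B - sum x A else if w = p then - x c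
    else if w = e then x c + sum x A - sum x B else x w"
  have fAB: "finite (A \<union> B)" using fin by simp
  show ?thesis
  proof (rule neg_on_hyperplane_transfer[OF g, of ?T])
    show "?T (\<lambda>v. a * x v + b * y v) = (\<lambda>v. a * ?T x v + b * ?T y v)" for x y :: "'a \<Rightarrow> real" and a b
    proof -
      have "(\<Sum>v\<in>S. a * x v + b * y v) = a * sum x S + b * sum y S" for S
        unfolding sum.distrib sum_distrib_left ..
      then show ?thesis by (intro ext) (auto simp: algebra_simps)
    qed
    show "\<exists>w\<in>insert c (insert p (insert e (A \<union> B))). ?T x w \<noteq> 0"
      if "v \<in> insert c (A \<union> B)" "x v \<noteq> 0" for x :: "'a \<Rightarrow> real" and v
      using that new by (cases "v = c") (auto intro: bexI[of _ p] bexI[of _ v])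
    fix x :: "'a \<Rightarrow> real"
    define a b SA SB g where "a = sum x A" and "b = sum x B" and "SA = (\<Sum>u\<in>A. d c u * x u)"
      and "SB = (\<Sum>u\<in>B. d c u * x u)" and "g = x c"
    define y where "y = ?T x"
    have y: "y c = g + b - a" "y p = - g" "y e = g + a - b" "\<And>u. u \<in> A \<union> B \<Longrightarrow> y u = x u"
      using new by (auto simp: y_def a_def b_def g_def)
    have cross: "(\<Sum>u\<in>A. \<Sum>v\<in>B. (d c u + d c v + k) * x u * x v) = SA * b + a * SB + k * a * b" for k
    proof -
      have "(\<Sum>u\<in>A. \<Sum>v\<in>B. (d c u + d c v + k) * x u * x v)
        = (\<Sum>u\<in>A. \<Sum>v\<in>B. (d c u * x u) * x v) + (\<Sum>u\<in>A. \<Sum>v\<in>B. x u * (d c v * x v))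
          + k * (\<Sum>u\<in>A. \<Sum>v\<in>B. x u * x v)"
        by (simp add: sum.distrib sum_distrib_left algebra_simps)
      then show ?thesis unfolding a_def b_def SA_def SB_def by (simp add: sum_product mult.assoc)
    qed
    have lin: "(\<Sum>u\<in>S. (d c u + k) * x u) = (\<Sum>u\<in>S. d c u * x u) + k * sum x S" for S and k :: real
      by (simp add: sum.distrib sum_distrib_left algebra_simps)
    have splitAB: "sum h (A \<union> B) = sum h A + sum h B" for h :: "'a \<Rightarrow> real"
      using fin disj by (rule sum.union_disjoint)
    have rowc: "(\<Sum>u\<in>A \<union> B. d c u * x u) = SA + SB" unfolding splitAB SA_def SB_def ..
    have row: "(\<Sum>u\<in>A \<union> B. d' c u * y u) = SA + SB + 2 * b"
      "(\<Sum>u\<in>A \<union> B. d' p u * y u) = SA + a + SB + b"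
      "(\<Sum>u\<in>A \<union> B. d' e u * y u) = SA + 2 * a + SB"
    proof -
      have "(\<Sum>u\<in>A. d' c u * y u) = (\<Sum>u\<in>A. (d c u + 0) * x u)"
        "(\<Sum>u\<in>B. d' c u * y u) = (\<Sum>u\<in>B. (d c u + 2) * x u)"
        "(\<Sum>u\<in>A. d' p u * y u) = (\<Sum>u\<in>A. (d c u + 1) * x u)"
        "(\<Sum>u\<in>B. d' p u * y u) = (\<Sum>u\<in>B. (d c u + 1) * x u)"
        "(\<Sum>u\<in>A. d' e u * y u) = (\<Sum>u\<in>A. (d c u + 2) * x u)"
        "(\<Sum>u\<in>B. d' e u * y u) = (\<Sum>u\<in>B. (d c u + 0) * x u)"
        by (intro sum.cong refl; simp add: y(4) dA dB)+
      then show "(\<Sum>u\<in>A \<union> B. d' c u * y u) = SA + SB + 2 * b"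
        "(\<Sum>u\<in>A \<union> B. d' p u * y u) = SA + a + SB + b"
        "(\<Sum>u\<in>A \<union> B. d' e u * y u) = SA + 2 * a + SB"
        unfolding splitAB lin by (simp_all add: SA_def SB_def a_def b_def)
    qed
    have base: "qform d (A \<union> B) x = qform d A x + qform d B x + 2 * (SA * b + a * SB)"
    proof -
      have "(\<Sum>u\<in>A. \<Sum>v\<in>B. d u v * x u * x v) = (\<Sum>u\<in>A. \<Sum>v\<in>B. (d c u + d c v + 0) * x u * x v)"
        by (intro sum.cong refl) (simp add: dAB)
      then show ?thesis unfolding qform_union[OF fin disj sym(1)] cross by simp
    qed
    have base': "qform d' (A \<union> B) y = qform d A x + qform d B x + 2 * (SA * b + a * SB + 2 * a * b)"
    proof -
      have "(\<Sum>u\<in>A. \<Sum>v\<in>B. d' u v * y u * y v) = (\<Sum>u\<in>A. \<Sum>v\<in>B. (d c u + d c v + 2) * x u * x v)"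
        by (intro sum.cong refl) (simp add: dAB' y(4))
      moreover have "qform d' A y = qform d A x" "qform d' B y = qform d B x"
        by (rule qform_cong; simp add: dAA dBB y(4))+
      ultimately show ?thesis unfolding qform_union[OF fin disj sym(2)] cross by simp
    qed
    have "qform d (insert c (A \<union> B)) x = qform d (A \<union> B) x + 2 * g * (SA + SB) + g\<^sup>2 / 2"
      unfolding qform_insert[OF fAB new(1) zero(1) sym(1)] rowc g_def ..
    moreover have "qform d' (insert c (insert p (insert e (A \<union> B)))) y
      = qform d' (A \<union> B) y + 2 * y e * (SA + 2 * a + SB) + (y e)\<^sup>2 / 2
        + 2 * y p * (y e + (SA + a + SB + b)) + (y p)\<^sup>2 / 2
        + 2 * y c * (y p + 2 * y e + (SA + SB + 2 * b)) + (y c)\<^sup>2 / 2"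
    proof -
      have "qform d' (insert c (insert p (insert e (A \<union> B)))) y
        = qform d' (insert p (insert e (A \<union> B))) y
          + 2 * y c * (\<Sum>u\<in>insert p (insert e (A \<union> B)). d' c u * y u) + (y c)\<^sup>2 / 2"
        by (rule qform_insert) (use fAB new sym zero in auto)
      moreover have "qform d' (insert p (insert e (A \<union> B))) y
        = qform d' (insert e (A \<union> B)) y
          + 2 * y p * (\<Sum>u\<in>insert e (A \<union> B). d' p u * y u) + (y p)\<^sup>2 / 2"
        by (rule qform_insert) (use fAB new sym zero in auto)
      moreover have "qform d' (insert e (A \<union> B)) y
        = qform d' (A \<union> B) y + 2 * y e * (\<Sum>u\<in>A \<union> B. d' e u * y u) + (y e)\<^sup>2 / 2"
        by (rule qform_insert) (use fAB new sym zero in auto)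
      moreover have "(\<Sum>u\<in>insert p (insert e (A \<union> B)). d' c u * y u)
          = d' c p * y p + (d' c e * y e + (\<Sum>u\<in>A \<union> B. d' c u * y u))"
        using fAB new by (subst sum.insert, simp, simp, subst sum.insert) auto
      moreover have "(\<Sum>u\<in>insert e (A \<union> B). d' p u * y u) = d' p e * y e + (\<Sum>u\<in>A \<union> B. d' p u * y u)"
        using fAB new by (subst sum.insert) auto
      ultimately show ?thesis unfolding row path by simp
    qed
    ultimately have "qform d' (insert c (insert p (insert e (A \<union> B)))) y
      = qform d (insert c (A \<union> B)) x + (a + b + g)\<^sup>2"
      unfolding base base' y(1-3) by (simp add: power2_eq_square field_simps)
    then have "qform d (insert c (A \<union> B)) x \<le> qform d' (insert c (insert p (insert e (A \<union> B)))) y"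
      by simp
    then show "qform d (insert c (A \<union> B)) x \<le> qform d' (insert c (insert p (insert e (A \<union> B)))) (?T x)"
      by (simp only: y_def)
  qed
qed

text \<open>The tripod: indices 0 and 1 are two leaves at the foot of a path \<open>4, \<dots>, 4 + j\<close>,
  and 2 and 3 complete a triangle at its other end.\<close>

definition tripod :: "nat \<Rightarrow> nat \<Rightarrow> nat \<Rightarrow> nat" where
  "tripod j i k = (if i = k then 0 else if i < 2 \<and> k < 2 then 2 else
     let h = (\<lambda>i. if i < 2 then 0 else if i < 4 then j + 2 else i - 3)
     in if h i = h k then 1 else if h i < h k then h k - h i else h i - h k)"

definition to_table :: "nat \<Rightarrow> (nat \<Rightarrow> nat \<Rightarrow> nat) \<Rightarrow> nat list list" where
  "to_table m M = map (\<lambda>i. map (M i) [0..<m]) [0..<m]"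

lemma not_neg_to_table:
  assumes "obstruction (to_table m M) xs"
  shows "\<not> neg_on_hyperplane (\<lambda>i j. real (M i j)) {..<m}"
proof
  assume "neg_on_hyperplane (\<lambda>i j. real (M i j)) {..<m}"
  then have "neg_on_hyperplane (\<lambda>i j. real (table_of (to_table m M) i j)) {..<length (to_table m M)}"
    by (elim neg_on_hyperplane_inj[of _ _ id]) (auto simp: to_table_def table_of_def)
  then show False using obstructionD(2)[OF assms] by simp
qed

lemma tripod_1: "\<not> neg_on_hyperplane (\<lambda>i k. real (tripod 1 i k)) {..<6}"
  by (rule not_neg_to_table[of _ _ "[-1, -1, 0, 0, 2, -2]"]) code_simp


lemma tripod_4: "\<not> neg_on_hyperplane (\<lambda>i k. real (tripod 4 i k)) {..<9}"
  by (rule not_neg_to_table[of _ _ "[-2, -2, 0, 0, 7, -5, 3, -2, 1]"]) code_simp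

lemma tripod_sym: "tripod j i k = tripod j k i"
  by (auto simp: tripod_def Let_def)

lemma tripod_self [simp]: "tripod j i i = 0"
  by (simp add: tripod_def)

text \<open>The auxiliary \<open>h\<close> of \<open>tripod\<close> is the position along the axis:
  0 for the two leaves, 1 to \<open>j + 1\<close> for the path, \<open>j + 2\<close> for the two
  further triangle vertices. This lemma and the next three resolve the definition by kind of
  vertex.\<close>

lemma tripod_path:
  assumes "4 \<le> i" "2 \<le> k" "i \<le> j + 4"
  shows "tripod j i k = (if k < 4 then j + 5 - i else if i < k then k - i else i - k)"
    "tripod j k i = (if k < 4 then j + 5 - i else if i < k then k - i else i - k)"
  using assms by (auto simp: tripod_def Let_def)

lemma tripod_leg:
  assumes "i < 2" "2 \<le> k"
  shows "tripod j i k = (if k < 4 then j + 2 else k - 3)" "tripod j k i = (if k < 4 then j + 2 else k - 3)"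
  using assms by (simp_all add: tripod_def Let_def)

lemma tripod_legs: "i < 2 \<Longrightarrow> k < 2 \<Longrightarrow> tripod j i k = (if i = k then 0 else 2)"
  by (simp add: tripod_def)

lemma tripod_triangle:
  assumes "2 \<le> i" "2 \<le> k" "i < 4" "k < 4"
  shows "tripod j i k = (if i = k then 0 else 1)"
  using assms by (simp add: tripod_def)

text \<open>The cut vertex is the end \<open>4 + j\<close> of the shorter path. The longer tripod
  replaces it by the path \<open>4 + j\<close>, \<open>5 + j\<close>, \<open>6 + j\<close>; side
  \<open>A\<close> holds the leaves and the rest of the path, side \<open>B\<close> the two triangle
  vertices.\<close>

lemma tripod_contract:
  assumes "neg_on_hyperplane (\<lambda>i k. real (tripod (j + 2) i k)) {..<j + 7}"
  shows "neg_on_hyperplane (\<lambda>i k. real (tripod j i k)) {..<j + 5}"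
proof -
  let ?A = "{0, 1} \<union> {4..<4 + j}" and ?B = "{2, 3 :: nat}"
  have 1: "{..<j + 5} = insert (4 + j) (?A \<union> ?B)"
    "{..<j + 7} = insert (4 + j) (insert (5 + j) (insert (6 + j) (?A \<union> ?B)))" by auto
  note 2 = tripod_path and 3 = tripod_leg and 4 = tripod_legs and 5 = tripod_triangle
  show ?thesis
    unfolding 1(1)
  proof (rule neg_on_hyperplane_contract[OF assms[unfolded 1(2)]])
    fix u v assume uv: "u \<in> ?A" "v \<in> ?A"
    then consider "u < 2" "v < 2" | "u < 2" "4 \<le> v" | "4 \<le> u" "v < 2" | "4 \<le> u" "4 \<le> v" by fastforce
    then show "real (tripod (j + 2) u v) = real (tripod j u v)"
    proof cases
      case 1 then show ?thesis by (simp add: 4)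
    next
      case 2 then show ?thesis by (simp add: 3)
    next
      case 3 then show ?thesis by (simp add: tripod_leg)
    next
      case 4 then show ?thesis using uv by (simp add: 2)
    qed
  next
    fix u v assume "u \<in> ?B" "v \<in> ?B"
    then show "real (tripod (j + 2) u v) = real (tripod j u v)" by (auto simp: 5)
  next
    fix u v assume uv: "u \<in> ?A" "v \<in> ?B"
    then consider "u < 2" | "4 \<le> u" "u < 4 + j" by fastforce
    then show "real (tripod j u v) = real (tripod j (4 + j) u) + real (tripod j (4 + j) v)"
      "real (tripod (j + 2) u v) = real (tripod j (4 + j) u) + real (tripod j (4 + j) v) + 2"
      by (cases; use uv in \<open>auto simp: 2 3 of_nat_diff\<close>)+
  qed (auto simp: tripod_sym 2 3 of_nat_diff)
qed

text \<open>Contraction preserves the parity of \<open>j\<close>. Odd values descend to 1. Even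
  values must stop at 4, since the tripod with \<open>j = 2\<close> does occur in the good graph
  \<open>B1\<close>.\<close>

lemma tripod_not_neg:
  assumes "j \<ge> 1" "j \<noteq> 2"
  shows "\<not> neg_on_hyperplane (\<lambda>i k. real (tripod j i k)) {..<j + 5}"
  using assms
proof (induction j rule: less_induct)
  case (less j)
  show ?case
  proof (cases "j = 1 \<or> j = 4")
    case True
    then show ?thesis using tripod_1 tripod_4 by auto
  next
    case False
    then obtain i where i: "j = i + 2" "i \<ge> 1" "i \<noteq> 2"
      using less.prems that[of "j - 2"] by auto
    then have "\<not> neg_on_hyperplane (\<lambda>i' k. real (tripod i i' k)) {..<i + 5}" using less.IH[of i] by simp
    moreover have "{..<i + 7} = {..<j + 5}" using i by auto
    ultimately show ?thesis using tripod_contract[of i] i by metis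
  qed
qed

text \<open>The vertex before a leaf is the foot \<open>4\<close>, and the path reaches a triangle
  vertex through \<open>4 + j\<close>; these supply the witnesses. Between the two leaves,
  \<open>r'\<close> is the starting leaf itself.\<close>

lemma geodetic_table_tripod:
  assumes "j \<ge> 1"
  shows "geodetic_table (j + 5) (tripod j)"
proof -
  have "\<exists>r<j + 5. \<exists>r'<j + 5. tripod j r k = 1 \<and> tripod j r' r = 1 \<and> tripod j r' k = 2
      \<and> tripod j i r' + 2 = tripod j i k \<and> tripod j i r + 1 = tripod j i k"
    if ik: "i < j + 5" "k < i" "tripod j i k > 1" for i k
  proof -
    have "tripod j 3 2 = 1" by (simp add: tripod_def)
    then have "\<not> (i = 3 \<and> k = 2)" using ik by auto
    then have "i = 1 \<or> (2 \<le> i \<and> i < 4 \<and> k < 2) \<or> (i \<ge> 4 \<and> k < 2) \<or> (i \<ge> 4 \<and> 2 \<le> k \<and> k < 4) \<or> (i \<ge> 4 \<and> k \<ge> 4)"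
      using ik by presburger
    then consider "i = 1" | "2 \<le> i" "i < 4" "k < 2" | "i \<ge> 4" "k < 2" | "i \<ge> 4" "2 \<le> k" "k < 4" | "i \<ge> 4" "k \<ge> 4"
      by blast
    then show ?thesis
    proof cases
      case 1
      then show ?thesis using ik
        by (intro exI[of _ 4] conjI exI[of _ 1]) (auto simp: tripod_leg tripod_legs)
    next
      case 2
      then show ?thesis using ik assms
        by (intro exI[of _ 4] conjI exI[of _ 5]) (simp_all add: tripod_leg tripod_path)
    next
      case 3
      then have "i > 4" using ik by (simp add: tripod_leg)
      with 3 show ?thesis using ik
        by (intro exI[of _ 4] conjI exI[of _ 5]) (simp_all add: tripod_leg tripod_path)
    next
      case 4
      then have "i < 4 + j" using ik by (simp add: tripod_path)
      then have "tripod j (4 + j) k = 1" "tripod j (3 + j) k = 2" "tripod j (3 + j) (4 + j) = 1"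
        "tripod j i (3 + j) + 2 = tripod j i k" "tripod j i (4 + j) + 1 = tripod j i k"
        using 4 tripod_path(1)[of "4 + j" k j] tripod_path(1)[of "3 + j" k j] tripod_path(1)[of "3 + j" "4 + j" j]
          tripod_path(1)[of i k j] tripod_path(1)[of i "3 + j" j] tripod_path(1)[of i "4 + j" j]
        by (simp_all) arith
      then show ?thesis by (intro exI[of _ "4 + j"] conjI exI[of _ "3 + j"]) simp_all
    next
      case 5
      then have "i > k + 1" using ik by (simp add: tripod_path)
      with 5 show ?thesis using ik
        by (intro exI[of _ "k + 1"] conjI exI[of _ "k + 2"]) (simp_all add: tripod_path)
    qed
  qed
  note ex = this
  have "tripod j i k > 0" if "i \<noteq> k" for i k
    using that by (auto simp: tripod_def Let_def)
  then show ?thesis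
    unfolding geodetic_table_def
  proof (intro allI impI conjI)
    show "\<exists>r<j + 5. \<exists>r'<j + 5. tripod j r k = 1 \<and> tripod j r' r = 1 \<and> tripod j r' k = 2
      \<and> tripod j i r' + 2 = tripod j i k \<and> tripod j i r + 1 = tripod j i k"
      if "i < j + 5" "k < i" "1 < tripod j i k" for i k using ex that by blast
  qed (simp_all add: tripod_sym)
qed

lemma (in conn_graph) good_tripod:
  assumes good: "good G" and j: "j \<ge> 1"
    and f: "inj_on f {..<j + 5}" "f ` {..<j + 5} \<subseteq> V"
    and a: "\<And>i k. i < j + 5 \<Longrightarrow> k < i \<Longrightarrow> adj G (f i) (f k) \<longleftrightarrow> tripod j i k = 1"
  shows "j = 2"
proof (rule ccontr)
  assume "j \<noteq> 2"
  have "d (f i) (f k) = tripod j i k" if "i < j + 5" "k < j + 5" for i k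
    by (rule good_geodetic_table[OF good geodetic_table_tripod[OF j] f a that])
  then have "neg_on_hyperplane (\<lambda>i k. real (tripod j i k)) {..<j + 5}"
    using good f finite_V unfolding good_def
    by (elim neg_on_hyperplane_inj[of _ _ f]) auto
  then show False using tripod_not_neg[OF j \<open>j \<noteq> 2\<close>] by simp
qed

section \<open>Good bicyclic graphs without leaves\<close>

lemma graph_isoI_image:
  assumes H: "simple_graph H" and g: "inj_on g (verts H)"
    and V: "verts G = g ` verts H" and E: "edges G = (`) g ` edges H"
  shows "graph_iso H G"
  unfolding graph_iso_def
proof (intro exI[of _ g] conjI ballI)
  show "bij_betw g (verts H) (verts G)" using g V by (simp add: bij_betw_def)
  fix u v assume uv: "u \<in> verts H" "v \<in> verts H"
  show "adj H u v \<longleftrightarrow> adj G (g u) (g v)"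
  proof
    assume "adj H u v"
    then have "g ` {u, v} \<in> edges G" unfolding E by (rule imageI)
    then show "adj G (g u) (g v)" by simp
  next
    assume "adj G (g u) (g v)"
    then obtain e where e: "e \<in> edges H" "g ` {u, v} = g ` e" unfolding E by auto
    then have "e \<subseteq> verts H" using H by (auto simp: simple_graph_def)
    then have "{u, v} = e" using inj_on_image_eq_iff[OF g, of "{u, v}" e] e uv by auto
    then show "adj H u v" using e by simp
  qed
qed

lemma (in conn_graph) crossing_edge:
  assumes "U \<subseteq> V" "U \<noteq> {}" "U \<noteq> V"
  obtains w r where "adj G w r" "w \<in> U" "r \<in> V - U"
proof -
  obtain u r0 where u: "u \<in> U" "r0 \<in> V - U" using assms by blast
  obtain r where r: "r \<in> V - U" "\<forall>y. y \<in> V - U \<longrightarrow> d u r \<le> d u y"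
    using ex_has_least_nat[of "\<lambda>r. r \<in> V - U" r0 "d u"] u by blast
  obtain w where w: "adj G w r" "d u r = Suc (d u w)" using dist_pred[of u r] u r assms by blast
  have "w \<in> U"
  proof (rule ccontr)
    assume "w \<notin> U"
    then have "d u r \<le> d u w" using r adjD[OF w(1)] by simp
    then show False using w by simp
  qed
  then show ?thesis using that w r by blast
qed

lemma (in conn_graph) finite_E: "finite (edges G)"
  using simple finite_V by (auto simp: simple_graph_def intro: finite_subset[of _ "Pow V"])

text \<open>Exactly as many edges lie outside \<open>F\<close> as vertices lie outside
  \<open>U\<close>. Each of these vertices has degree at least two and each such edge has at most
  two ends among them, so double counting forces all these edges to avoid \<open>U\<close>. If
  \<open>U\<close> were not everything, connectedness would give an edge leaving
  \<open>U\<close>.\<close>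

lemma (in conn_graph) leafless_core:
  assumes bic: "card (edges G) = card V + 1"
    and leafless: "\<And>w. w \<in> V \<Longrightarrow> \<exists>x y. x \<noteq> y \<and> adj G x w \<and> adj G y w"
    and U: "U \<subseteq> V" "U \<noteq> {}" and F: "F \<subseteq> edges G" "\<And>e. e \<in> F \<Longrightarrow> e \<subseteq> U" "card F = card U + 1"
  shows "U = V" "edges G = F"
proof -
  let ?R = "V - U"
  have deg: "2 \<le> card {e \<in> edges G. w \<in> e}" if w: "w \<in> V" for w
  proof -
    obtain x y where xy: "x \<noteq> y" "adj G x w" "adj G y w" using leafless w by blast
    then have "{x, w} \<noteq> {y, w}" by (auto simp: doubleton_eq_iff)
    then have "2 = card {{x, w}, {y, w}}" by simp
    also have "\<dots> \<le> card {e \<in> edges G. w \<in> e}" using xy finite_E by (intro card_mono) auto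
    finally show ?thesis .
  qed
  have c2: "card e = 2" if "e \<in> edges G" for e using simple that by (auto simp: simple_graph_def)
  have fe: "finite e" if "e \<in> edges G" for e using c2[OF that] by (metis card.infinite zero_neq_numeral)
  have le2: "card (e \<inter> ?R) \<le> 2" if "e \<in> edges G" for e
    using card_mono[of e "e \<inter> ?R"] c2 fe that by auto
  have "2 * card ?R = (\<Sum>w\<in>?R. 2)" by simp
  also have "\<dots> \<le> (\<Sum>w\<in>?R. card {e \<in> edges G. w \<in> e})" by (rule sum_mono) (use deg in auto)
  also have "\<dots> = (\<Sum>w\<in>?R. \<Sum>e\<in>edges G. if w \<in> e then 1 else 0)"
    by (intro sum.cong refl) (subst sum.inter_filter[OF finite_E, symmetric], simp)
  also have "\<dots> = (\<Sum>e\<in>edges G. \<Sum>w\<in>?R. if w \<in> e then 1 else 0)" by (rule sum.swap)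
  also have "\<dots> = (\<Sum>e\<in>edges G. card (e \<inter> ?R))"
  proof (intro sum.cong refl)
    fix e
    have "(\<Sum>w\<in>?R. if w \<in> e then 1 else 0) = card {w \<in> ?R. w \<in> e}"
      using finite_V by (subst sum.inter_filter[symmetric]) auto
    also have "{w \<in> ?R. w \<in> e} = e \<inter> ?R" by auto
    finally show "(\<Sum>w\<in>?R. if w \<in> e then 1 else 0) = card (e \<inter> ?R)" .
  qed
  also have "\<dots> = (\<Sum>e\<in>edges G - F. card (e \<inter> ?R))"
  proof (rule sum.mono_neutral_right)
    show "\<forall>e\<in>edges G - (edges G - F). card (e \<inter> ?R) = 0"
    proof
      fix e assume "e \<in> edges G - (edges G - F)"
      then have "e \<inter> ?R = {}" using F(2)[of e] by blast
      then show "card (e \<inter> ?R) = 0" by simp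
    qed
  qed (use finite_E in auto)
  finally have 1: "2 * card ?R \<le> (\<Sum>e\<in>edges G - F. card (e \<inter> ?R))" .
  have cEF: "card (edges G - F) = card V + 1 - (card U + 1)"
    using F bic finite_E by (simp add: card_Diff_subset finite_subset)
  have cR: "card ?R = card V - card U" using U finite_V by (simp add: card_Diff_subset finite_subset)
  show UV: "U = V"
  proof (rule ccontr)
    assume "U \<noteq> V"
    obtain w r where wr: "adj G w r" "w \<in> U" "r \<in> V - U" using crossing_edge[OF U \<open>U \<noteq> V\<close>] .
    have "{w, r} \<in> edges G - F" using wr F(2)[of "{w, r}"] by auto
    moreover have "{w, r} \<inter> ?R = {r}" using wr by auto
    ultimately have "(\<Sum>e\<in>edges G - F. card (e \<inter> ?R)) < (\<Sum>e\<in>edges G - F. 2)"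
      using finite_E le2 by (intro sum_strict_mono_ex1) (auto intro!: bexI[of _ "{w, r}"])
    then show False using 1 cEF cR by simp
  qed
  have "card F = card (edges G)" using F(3) bic UV by simp
  then show "edges G = F" using card_subset_eq[OF finite_E F(1)] by simp
qed

text \<open>An injective map that preserves edges is automatically an isomorphism here, because the
  counting argument shows that its image already contains all vertices and edges.\<close>

lemma (in conn_graph) leafless_core_iso:
  assumes bic: "card (edges G) = card V + 1"
    and leafless: "\<And>w. w \<in> V \<Longrightarrow> \<exists>x y. x \<noteq> y \<and> adj G x w \<and> adj G y w"
    and H: "simple_graph H" "verts H \<noteq> {}" "card (edges H) = card (verts H) + 1"
    and g: "inj_on g (verts H)" "g ` verts H \<subseteq> V" "\<And>e. e \<in> edges H \<Longrightarrow> g ` e \<in> edges G"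
  shows "graph_iso G H"
proof -
  have eH: "e \<subseteq> verts H" if "e \<in> edges H" for e using H that by (auto simp: simple_graph_def)
  have inj: "inj_on ((`) g) (edges H)"
    using inj_on_image_eq_iff[OF g(1)] eH by (auto simp: inj_on_def)
  have "g ` verts H \<noteq> {}" "(`) g ` edges H \<subseteq> edges G"
    "\<And>e. e \<in> (`) g ` edges H \<Longrightarrow> e \<subseteq> g ` verts H"
    "card ((`) g ` edges H) = card (g ` verts H) + 1"
    subgoal using H by simp
    subgoal using g by blast
    subgoal using eH by blast
    subgoal using g H by (simp add: card_image inj)
    done
  note leafless_core[OF bic leafless g(2) this]
  then have "graph_iso H G" by (intro graph_isoI_image[OF H(1) g(1)]) auto
  then show ?thesis by (rule graph_iso_sym)
qed

lemma edges_infinity_graph: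
  "edges (infinity_graph s) = (\<lambda>i. {i, Suc i}) ` {..<s} \<union>
     {{0, s + 1}, {0, s + 2}, {s + 1, s + 2}, {s, s + 3}, {s, s + 4}, {s + 3, s + 4}}"
proof -
  have "{{i, Suc i} |i. i < s} = (\<lambda>i. {i, Suc i}) ` {..<s}" by blast
  then show ?thesis
    unfolding infinity_graph_def snd_conv by (simp only: Un_assoc Un_insert_left Un_empty_left)
qed

lemma verts_infinity_graph: "verts (infinity_graph s) = {0..s + 4}"
  by (simp add: infinity_graph_def)

lemma simple_infinity_graph: "simple_graph (infinity_graph s)"
  unfolding simple_graph_def verts_infinity_graph edges_infinity_graph by auto

lemma card_edges_infinity_graph: "card (edges (infinity_graph s)) = card (verts (infinity_graph s)) + 1"
proof -
  let ?P = "(\<lambda>i. {i, Suc i}) ` {..<s}"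
    and ?T = "{{0, s + 1}, {0, s + 2}, {s + 1, s + 2}, {s, s + 3}, {s, s + 4}, {s + 3, s + 4}}"
  have P: "card ?P = s" by (subst card_image) (auto simp: inj_on_def doubleton_eq_iff)
  have T: "card ?T = 6" by (simp add: doubleton_eq_iff card_insert_if)
  have "A \<inter> B = {}" if "\<forall>e\<in>A. e \<subseteq> {..s}" "\<forall>e\<in>B. \<not> e \<subseteq> {..s}" for A B
    using that by blast
  then have "?P \<inter> ?T = {}" by this auto
  moreover have "finite ?P" "finite ?T" by simp_all
  ultimately have "card (?P \<union> ?T) = card ?P + card ?T" by (intro card_Un_disjoint)
  then show ?thesis unfolding edges_infinity_graph verts_infinity_graph P T by simp
qed

lemma simple_theta_graph: "simple_graph theta_graph"
  unfolding simple_graph_def theta_graph_def by auto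

lemma card_edges_theta_graph: "card (edges theta_graph) = card (verts theta_graph) + 1"
  by (simp add: theta_graph_def doubleton_eq_iff card_insert_if)

text \<open>Completeness would mean n (n - 3) = 2 for the number n of vertices, so n divides 2,
  while the equation also forces n to be at least 3. The non-adjacent pair gives diameter at least
  two.\<close>

lemma (in conn_graph) bicyclic_not_complete:
  assumes bic: "card (edges G) = card V + 1"
  obtains u v where "u \<in> V" "v \<in> V" "u \<noteq> v" "\<not> adj G u v"
proof (rule ccontr)
  assume "\<not> thesis"
  then have "edges G = {e. e \<subseteq> V \<and> card e = 2}"
    using simple that by (auto simp: simple_graph_def card_2_iff)
  then have "card V choose 2 = card V + 1" using n_subsets[OF finite_V, of 2] bic by simp
  then have "card V * (card V - 1) = 2 * (card V + 1)"
  proof -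
    have "even (card V * (card V - 1))" by (cases "card V") auto
    then have "card V * (card V - 1) = 2 * (card V * (card V - 1) div 2)" by simp
    then show ?thesis using \<open>card V choose 2 = card V + 1\<close> by (simp only: choose_two)
  qed
  moreover from this have "card V \<noteq> 0" "card V \<noteq> 1" "card V \<noteq> 2" by auto
  then have "card V \<ge> 3" by linarith
  ultimately have "card V * (card V - 3) = 2" by (simp add: algebra_simps diff_mult_distrib2)
  then have "card V dvd 2" by (metis dvd_triv_left)
  then have "card V \<le> 2" by (simp add: dvd_imp_le)
  then show False using \<open>card V * (card V - 3) = 2\<close> by simp
qed

lemma (in conn_graph) good_leafless_bicyclic:
  assumes good: "good G" and bic: "card (edges G) = card V + 1"
    and leafless: "\<And>w. w \<in> V \<Longrightarrow> \<exists>x y. x \<noteq> y \<and> adj G x w \<and> adj G y w"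
  shows "graph_iso G theta_graph \<or> (\<exists>s. graph_iso G (infinity_graph s))"
proof -
  obtain u v where uv: "u \<in> V" "v \<in> V" "u \<noteq> v" "\<not> adj G u v" using bicyclic_not_complete[OF bic] .
  define L where "L = Max ((\<lambda>(u, v). d u v) ` (V \<times> V))"
  have fin: "finite ((\<lambda>(u, v). d u v) ` (V \<times> V))" using finite_V by simp
  have maxL: "d a b \<le> L" if "a \<in> V" "b \<in> V" for a b
    unfolding L_def by (rule Max_ge[OF fin]) (use that in auto)
  have "L \<in> (\<lambda>(u, v). d u v) ` (V \<times> V)" unfolding L_def by (rule Max_in[OF fin]) (use V_nonempty in auto)
  then obtain p q where pq: "p \<in> V" "q \<in> V" "d p q = L" by auto
  have "d u v \<noteq> 0" "d u v \<noteq> 1" using uv dist_eq_0_iff dist_eq_1_iff by auto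
  then have L2: "L \<ge> 2" using maxL[OF uv(1,2)] by linarith
  \<comment> \<open>A further neighbour \<open>c\<close> of an end \<open>b\<close> of a diametral
    path must close a triangle: otherwise the path continues to \<open>c\<close> as a geodesic of
    length \<open>L + 1\<close>.\<close>
  have ends: "adj G b' c" if "a \<in> V" "b \<in> V" "d a b = L" "adj G b' b" "d a b = Suc (d a b')" "adj G b c" "c \<noteq> b'"
    for a b b' c
  proof (rule ccontr)
    assume "\<not> adj G b' c"
    then have "d a c = Suc L" using good_extend[OF good, of a b' b c] that by auto
    moreover have "c \<in> V" using adjD that by blast
    ultimately show False using maxL[of a c] that by simp
  qed
  obtain x where x: "x 0 = p" "x L = q" "\<And>i. i \<le> L \<Longrightarrow> x i \<in> V"
    "\<And>i. i < L \<Longrightarrow> adj G (x i) (x (Suc i))" "\<And>i j. i \<le> j \<Longrightarrow> j \<le> L \<Longrightarrow> d (x i) (x j) = j - i"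
    using geodesic[OF pq(1,2)] unfolding pq(3) by metis
  have xs: "d (x j) (x i) = j - i" if "i \<le> j" "j \<le> L" for i j
    using x(5)[OF that] dist_sym[of "x i" "x j"] x(3) that by simp
  have xinj: "x i = x j \<longleftrightarrow> i = j" if "i \<le> L" "j \<le> L" for i j
  proof
    assume "x i = x j"
    then have "d (x i) (x j) = 0" using x that by simp
    then show "i = j" using x(5)[of i j] xs[of j i] that by (cases "i \<le> j") auto
  qed simp
  have L1: "Suc (L - 1) = L" "L - 1 \<le> L" "L - 1 < L" "(1::nat) \<le> L" "0 < L" using L2 by auto
  obtain c where c: "adj G c (x 0)" "c \<noteq> x 1" using leafless[of "x 0"] x(3) by (metis zero_le)
  obtain c' where c': "adj G c' (x L)" "c' \<noteq> x (L - 1)" using leafless[of "x L"] x(3) by (metis le_refl)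
  have cV: "c \<in> V" "c' \<in> V" using adjD c c' by auto
  have cx1: "adj G c (x 1)"
    using ends[of "x L" "x 0" "x 1" c] x(3)[of 0] x(3)[of L] x(4)[of 0] xs[of 0 L] xs[of 1 L] c L1
    by (simp add: insert_commute)
  have cx2: "adj G c' (x (L - 1))"
    using ends[of "x 0" "x L" "x (L - 1)" c'] x(3)[of 0] x(3)[of L] x(4)[of "L - 1"] x(5)[of 0 L] x(5)[of 0 "L - 1"] c' L1
    by (simp add: insert_commute)
  have cx: "c \<noteq> x i" if "i \<le> L" for i
  proof
    assume "c = x i"
    then have "d (x 0) (x i) = 1" using c x(3)[of 0] cV dist_eq_1_iff by (simp add: insert_commute)
    then show False using x(5)[of 0 i] that c \<open>c = x i\<close> by simp
  qed
  have c'x: "c' \<noteq> x i" if "i \<le> L" for i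
  proof
    assume "c' = x i"
    then have "d (x i) (x L) = 1" using c' x(3)[of L] cV dist_eq_1_iff by simp
    then have "i = L - 1" using x(5)[of i L] that by simp
    then show False using c' \<open>c' = x i\<close> by simp
  qed
  show ?thesis
  proof (cases "c = c'")
    case True
    \<comment> \<open>A common apex joins both ends by a walk of length two. The two triangles then
      share the edge between \<open>x 1\<close> and the apex, and these become the two vertices of
      degree three.\<close>
    have "L = 2"
    proof -
      have "d (x 0) c = 1" using c cV x(3)[of 0] dist_eq_1_iff by (simp add: insert_commute)
      then have "d (x 0) (x L) \<le> 2" using dist_step[of "x 0" c "x L"] True c' x(3)[of 0] by simp
      then show ?thesis using x(5)[of 0 L] L2 by simp
    qed
    let ?g = "\<lambda>i. [x 1, c, x 0, x 2] ! i"
    have "graph_iso G theta_graph"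
    proof (rule leafless_core_iso[OF bic leafless simple_theta_graph _ card_edges_theta_graph, of ?g])
      show "inj_on ?g (verts theta_graph)"
        using cx[of 0] cx[of 1] cx[of 2] xinj[of 0 1] xinj[of 0 2] xinj[of 1 2] \<open>L = 2\<close>
        by (auto simp: theta_graph_def inj_on_def)
      show "?g ` verts theta_graph \<subseteq> V"
        using x(3)[of 0] x(3)[of 1] x(3)[of 2] cV \<open>L = 2\<close> by (auto simp: theta_graph_def)
      show "?g ` e \<in> edges G" if "e \<in> edges theta_graph" for e
        using that c c' cx1 x(4)[of 0] x(4)[of 1] True \<open>L = 2\<close>
        by (auto simp: theta_graph_def insert_commute numeral_2_eq_2)
    qed (auto simp: theta_graph_def)
    then show ?thesis by simp
  next
    case False
    \<comment> \<open>The triangles occupy the first and the last edge of the diametral path, so the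
      path between them runs from \<open>x 1\<close> to \<open>x (L - 1)\<close>. For
      \<open>L = 2\<close> it is the single shared vertex.\<close>
    define s where "s = L - 2"
    have Ls: "L = s + 2" using L2 by (simp add: s_def)
    let ?g = "\<lambda>i. if i \<le> s then x (Suc i) else if i = s + 1 then x 0 else if i = s + 2 then c
      else if i = s + 3 then x L else c'"
    have "graph_iso G (infinity_graph s)"
    proof (rule leafless_core_iso[OF bic leafless simple_infinity_graph _ card_edges_infinity_graph, of _ ?g])
      show "inj_on ?g (verts (infinity_graph s))"
        unfolding verts_infinity_graph inj_on_def
        using cx[unfolded Ls] c'x[unfolded Ls] cx[unfolded Ls, THEN not_sym] c'x[unfolded Ls, THEN not_sym]
          xinj[unfolded Ls] False False[THEN not_sym] unfolding Ls by (auto split: if_splits)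
      show "?g ` verts (infinity_graph s) \<subseteq> V" using x(3) cV Ls by auto
      show "?g ` e \<in> edges G" if "e \<in> edges (infinity_graph s)" for e
        using that c c' cx1 cx2 x(4) Ls unfolding edges_infinity_graph
        by (auto simp: insert_commute)
    qed (auto simp: verts_infinity_graph)
    then show ?thesis by blast
  qed
qed

section \<open>Core graphs with pendant paths\<close>

text \<open>\<open>spider C l\<close> is the core graph \<open>C\<close> with, at each core vertex \<open>x\<close> and for each index \<open>k\<close>,
  a pendant path of length \<open>l x k\<close>; its vertices are \<open>(x, k, 1), \<dots>, (x, k, l x k)\<close>,
  and the core vertex \<open>x\<close> itself is \<open>(x, 0, 0)\<close>.\<close>

definition node :: "nat \<Rightarrow> nat \<Rightarrow> nat \<Rightarrow> nat \<times> nat \<times> nat" where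
  "node x k i = (x, if i = 0 then 0 else k, i)"

definition spider :: "nat graph \<Rightarrow> (nat \<Rightarrow> nat \<Rightarrow> nat) \<Rightarrow> (nat \<times> nat \<times> nat) graph" where
  "spider C l = ({node x k i | x k i. x \<in> verts C \<and> i \<le> l x k},
     {{node x 0 0, node y 0 0} | x y. adj C x y} \<union>
     {{node x k i, node x k (Suc i)} | x k i. x \<in> verts C \<and> i < l x k})"

text \<open>Leg indices range over all natural numbers and an absent leg has length 0. The condition
  keeps the graph finite and always leaves a fresh index for one more leg.\<close>

definition finite_legs :: "nat graph \<Rightarrow> (nat \<Rightarrow> nat \<Rightarrow> nat) \<Rightarrow> bool" where
  "finite_legs C l \<longleftrightarrow> (\<forall>x\<in>verts C. finite {k. 0 < l x k})"

lemma verts_spider: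
  "(x, k, i) \<in> verts (spider C l) \<longleftrightarrow> x \<in> verts C \<and> (if i = 0 then k = 0 else i \<le> l x k)"
  by (auto simp: spider_def node_def)

lemma node_in_spider: "x \<in> verts C \<Longrightarrow> i \<le> l x k \<Longrightarrow> node x k i \<in> verts (spider C l)"
  by (auto simp: spider_def)

lemma adj_spider:
  "adj (spider C l) (x, k, i) (y, k', i') \<longleftrightarrow>
     (if i = 0 \<and> i' = 0 then k = 0 \<and> k' = 0 \<and> adj C x y
      else x = y \<and> x \<in> verts C \<and> (i' = Suc i \<and> i < l x k' \<and> k = (if i = 0 then 0 else k')
        \<or> i = Suc i' \<and> i' < l x k \<and> k' = (if i' = 0 then 0 else k)))"
  (is "?L \<longleftrightarrow> ?R")
proof
  assume ?L
  then consider a b where "{(x, k, i), (y, k', i')} = {(a, 0, 0), (b, 0, 0)}" "adj C a b"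
    | a m j where "{(x, k, i), (y, k', i')} = {node a m j, node a m (Suc j)}" "a \<in> verts C" "j < l a m"
    by (auto simp: spider_def node_def)
  then show ?R
    by cases (auto simp: doubleton_eq_iff node_def insert_commute)
next
  assume R: ?R
  show ?L
  proof (cases "i = 0 \<and> i' = 0")
    case True
    then show ?thesis using R by (auto simp: spider_def node_def)
  next
    case False
    then consider "x = y" "x \<in> verts C" "i' = Suc i" "i < l x k'" "k = (if i = 0 then 0 else k')"
      | "x = y" "x \<in> verts C" "i = Suc i'" "i' < l x k" "k' = (if i' = 0 then 0 else k)"
      using R by auto
    then show ?thesis
    proof cases
      case 1
      then have "{(x, k, i), (y, k', i')} = {node x k' i, node x k' (Suc i)}" by (auto simp: node_def)
      then show ?thesis using 1 by (auto simp: spider_def)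
    next
      case 2
      then have "{(x, k, i), (y, k', i')} = {node x k i', node x k (Suc i')}" by (auto simp: node_def)
      then show ?thesis using 2 by (auto simp: spider_def)
    qed
  qed
qed

lemma simple_spider:
  assumes C: "simple_graph C" and l: "finite_legs C l"
  shows "simple_graph (spider C l)"
proof -
  have "verts (spider C l) \<subseteq> (\<Union>x\<in>verts C. insert (x, 0, 0) (\<Union>k\<in>{k. 0 < l x k}. (\<lambda>i. (x, k, i)) ` {..l x k}))"
  proof
    fix v assume v: "v \<in> verts (spider C l)"
    obtain x k i where xki: "v = (x, k, i)" by (cases v)
    have x: "x \<in> verts C" "if i = 0 then k = 0 else i \<le> l x k" using v xki by (auto simp: verts_spider)
    have "v \<in> insert (x, 0, 0) (\<Union>k\<in>{k. 0 < l x k}. (\<lambda>i. (x, k, i)) ` {..l x k})"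
    proof (cases "i = 0")
      case False
      then have "k \<in> {k. 0 < l x k}" "v \<in> (\<lambda>i. (x, k, i)) ` {..l x k}" using x xki by auto
      then show ?thesis by blast
    qed (use x xki in auto)
    then show "v \<in> (\<Union>x\<in>verts C. insert (x, 0, 0) (\<Union>k\<in>{k. 0 < l x k}. (\<lambda>i. (x, k, i)) ` {..l x k}))"
      using x by blast
  qed
  moreover have "finite (\<Union>x\<in>verts C. insert (x, 0, 0) (\<Union>k\<in>{k. 0 < l x k}. (\<lambda>i. (x, k, i)) ` {..l x k}))"
    using C l by (auto simp: simple_graph_def finite_legs_def)
  ultimately have "finite (verts (spider C l))" by (rule finite_subset)
  moreover have "e \<subseteq> verts (spider C l) \<and> card e = 2" if e: "e \<in> edges (spider C l)" for e
  proof -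
    consider x y where "e = {node x 0 0, node y 0 0}" "adj C x y"
      | x k i where "e = {node x k i, node x k (Suc i)}" "x \<in> verts C" "i < l x k"
      using e by (auto simp: spider_def)
    then show ?thesis
    proof cases
      case 1
      then show ?thesis using simple_graph_adjD[OF C 1(2)] by (auto simp: node_def verts_spider)
    next
      case 2
      then show ?thesis by (auto simp: node_in_spider) (simp add: node_def)
    qed
  qed
  ultimately show ?thesis by (auto simp: simple_graph_def)
qed

lemma spider_cong:
  assumes "\<And>x k. x \<in> verts C \<Longrightarrow> l x k = l' x k"
  shows "spider C l = spider C l'"
proof -
  have "x \<in> verts C \<and> i \<le> l x k \<longleftrightarrow> x \<in> verts C \<and> i \<le> l' x k"
    "x \<in> verts C \<and> i < l x k \<longleftrightarrow> x \<in> verts C \<and> i < l' x k" for x k i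
    using assms by auto
  then show ?thesis by (simp only: spider_def)
qed

text \<open>Two situations in one: \<open>l x k = 0\<close> starts a new leg at the core vertex,
  otherwise the leg grows at its tip.\<close>

lemma spider_extend:
  assumes "x \<in> verts C"
  shows "spider C (l(x := (l x)(k := Suc (l x k)))) = add_leaf (spider C l) (node x k (l x k)) (node x k (Suc (l x k)))"
proof (rule prod_eqI)
  let ?l = "l(x := (l x)(k := Suc (l x k)))"
  show "verts (spider C ?l) = verts (add_leaf (spider C l) (node x k (l x k)) (node x k (Suc (l x k))))"
    using assms by (auto simp: verts_spider node_def split: if_splits)
  have *: "i < ?l y m \<longleftrightarrow> i < l y m \<or> (y = x \<and> m = k \<and> i = l x k)" for y m i by auto
  show "edges (spider C ?l) = edges (add_leaf (spider C l) (node x k (l x k)) (node x k (Suc (l x k))))"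
    unfolding edges_add_leaf unfolding spider_def snd_conv * using assms by blast
qed

lemma node_new: "node x k (Suc (l x k)) \<notin> verts (spider C l)"
  by (simp add: node_def verts_spider)

lemma spider_no_legs:
  shows "bij_betw fst (verts (spider C (\<lambda>_ _. 0))) (verts C)"
    and "\<lbrakk>u \<in> verts (spider C (\<lambda>_ _. 0)); v \<in> verts (spider C (\<lambda>_ _. 0))\<rbrakk>
      \<Longrightarrow> adj (spider C (\<lambda>_ _. 0)) u v \<longleftrightarrow> adj C (fst u) (fst v)"
proof -
  show "bij_betw fst (verts (spider C (\<lambda>_ _. 0))) (verts C)"
    by (auto simp: bij_betw_def inj_on_def spider_def node_def image_def)
  show "adj (spider C (\<lambda>_ _. 0)) u v \<longleftrightarrow> adj C (fst u) (fst v)"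
    if "u \<in> verts (spider C (\<lambda>_ _. 0))" "v \<in> verts (spider C (\<lambda>_ _. 0))"
    using that by (cases u; cases v) (auto simp: verts_spider adj_spider split: if_splits)
qed

lemma graph_iso_spider_no_legs: "graph_iso (spider C (\<lambda>_ _. 0)) C"
  unfolding graph_iso_def using spider_no_legs by blast

definition core_automorphism :: "nat graph \<Rightarrow> (nat \<Rightarrow> nat) \<Rightarrow> bool" where
  "core_automorphism C r \<longleftrightarrow> bij_betw r (verts C) (verts C) \<and>
     (\<forall>u\<in>verts C. \<forall>v\<in>verts C. adj C u v \<longleftrightarrow> adj C (r u) (r v))"

text \<open>The automorphism acts on the first coordinate and takes the legs along, so each
  exclusion has to be proved for one representative position only.\<close>

lemma spider_automorphism:
  assumes C: "simple_graph C" and r: "core_automorphism C r"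
  defines "f \<equiv> \<lambda>(x, k, i). (r x, k, i)"
  shows "bij_betw f (verts (spider C (\<lambda>x. l (r x)))) (verts (spider C l))"
    and "\<forall>u\<in>verts (spider C (\<lambda>x. l (r x))). \<forall>v\<in>verts (spider C (\<lambda>x. l (r x))).
      adj (spider C (\<lambda>x. l (r x))) u v \<longleftrightarrow> adj (spider C l) (f u) (f v)"
proof -
  have r1: "inj_on r (verts C)" "r ` verts C = verts C" using r by (auto simp: core_automorphism_def bij_betw_def)
  have "inj_on f (verts (spider C (\<lambda>x. l (r x))))"
    using r1(1) by (auto simp: f_def inj_on_def verts_spider)
  moreover have "v \<in> f ` verts (spider C (\<lambda>x. l (r x)))" if v: "v \<in> verts (spider C l)" for v
  proof -
    obtain x k i where xki: "v = (x, k, i)" by (cases v)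
    then have "x \<in> verts C" using v by (simp add: verts_spider)
    then obtain y where "y \<in> verts C" "x = r y" using r1(2) by blast
    then have "(y, k, i) \<in> verts (spider C (\<lambda>x. l (r x)))" "v = f (y, k, i)"
      using v xki by (auto simp: verts_spider f_def)
    then show ?thesis by blast
  qed
  moreover have "f ` verts (spider C (\<lambda>x. l (r x))) \<subseteq> verts (spider C l)"
    using r1 by (auto simp: verts_spider f_def)
  ultimately show "bij_betw f (verts (spider C (\<lambda>x. l (r x)))) (verts (spider C l))"
    by (auto simp: bij_betw_def)
  show "\<forall>u\<in>verts (spider C (\<lambda>x. l (r x))). \<forall>v\<in>verts (spider C (\<lambda>x. l (r x))).
      adj (spider C (\<lambda>x. l (r x))) u v \<longleftrightarrow> adj (spider C l) (f u) (f v)"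
  proof (intro ballI)
    fix u v assume uv: "u \<in> verts (spider C (\<lambda>x. l (r x)))" "v \<in> verts (spider C (\<lambda>x. l (r x)))"
    obtain x k i y m j where xy: "u = (x, k, i)" "v = (y, m, j)" by (cases u, cases v)
    then have V: "x \<in> verts C" "y \<in> verts C" "r x \<in> verts C" using uv r1 by (auto simp: verts_spider)
    then have "r x = r y \<longleftrightarrow> x = y" "adj C x y \<longleftrightarrow> adj C (r x) (r y)"
      using r1(1) r by (auto simp: inj_on_def core_automorphism_def)
    then show "adj (spider C (\<lambda>x. l (r x))) u v \<longleftrightarrow> adj (spider C l) (f u) (f v)"
      using V unfolding xy f_def by (simp add: adj_spider)
  qed
qed

lemma graph_iso_spider_automorphism:
  assumes "simple_graph C" "core_automorphism C r"
  shows "graph_iso (spider C (\<lambda>x. l (r x))) (spider C l)"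
  unfolding graph_iso_def using spider_automorphism[OF assms] by blast

lemma finite_legs_automorphism:
  assumes "core_automorphism C r" "finite_legs C l"
  shows "finite_legs C (\<lambda>x. l (r x))"
  using assms by (auto simp: finite_legs_def core_automorphism_def bij_betw_def)

text \<open>The extended bijection is stated explicitly because attaching paths repeatedly requires
  knowing where the named vertices go, and not merely that an isomorphism exists.\<close>

lemma add_leaf_iso_fun:
  assumes G: "simple_graph G" and H: "simple_graph H"
    and f: "bij_betw f (verts G) (verts H)"
      "\<forall>u\<in>verts G. \<forall>v\<in>verts G. adj G u v \<longleftrightarrow> adj H (f u) (f v)"
    and u: "u \<in> verts G" and w: "w \<notin> verts G" "w' \<notin> verts H"
  shows "bij_betw (f(w := w')) (verts (add_leaf G u w)) (verts (add_leaf H (f u) w')) \<and>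
    (\<forall>a\<in>verts (add_leaf G u w). \<forall>b\<in>verts (add_leaf G u w).
      adj (add_leaf G u w) a b \<longleftrightarrow> adj (add_leaf H (f u) w') ((f(w := w')) a) ((f(w := w')) b))"
proof (intro conjI ballI)
  let ?f = "f(w := w')"
  have fV: "f x \<in> verts H" "f x \<noteq> w'" "x \<noteq> w" if "x \<in> verts G" for x using f(1) that w by (auto simp: bij_betw_def)
  have finj: "f x = f y \<longleftrightarrow> x = y" if "x \<in> verts G" "y \<in> verts G" for x y
    using f(1) that by (auto simp: bij_betw_def inj_on_def)
  have "bij_betw ?f (verts G) (verts H)" using f(1) w by (subst bij_betw_cong[of _ _ f]) auto
  then show "bij_betw ?f (verts (add_leaf G u w)) (verts (add_leaf H (f u) w'))"
    using w notIn_Un_bij_betw3[of w "verts G" ?f "verts H"] by simp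
  have nG: "\<not> adj G w y" "\<not> adj G y w" and nH: "\<not> adj H w' z" "\<not> adj H z w'" for y z
    using simple_graph_adjD[OF G] simple_graph_adjD[OF H] w by blast+
  fix a b assume ab: "a \<in> verts (add_leaf G u w)" "b \<in> verts (add_leaf G u w)"
  then consider "a = w" "b = w" | "a = w" "b \<in> verts G" | "a \<in> verts G" "b = w" | "a \<in> verts G" "b \<in> verts G"
    by auto
  then show "adj (add_leaf G u w) a b \<longleftrightarrow> adj (add_leaf H (f u) w') (?f a) (?f b)"
  proof cases
    case 1
    then show ?thesis using fV[OF u] u w nG[of w] nH[of w'] by auto
  next
    case 2
    then show ?thesis using fV[OF u] fV[of b] finj[of u b] u w nG nH by (auto simp: doubleton_eq_iff)
  next
    case 3
    then show ?thesis using fV[OF u] fV[of a] finj[of u a] u w nG nH by (auto simp: doubleton_eq_iff)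
  next
    case 4
    then show ?thesis using fV[OF u] fV[of a] fV[of b] f(2) u w by (auto simp: doubleton_eq_iff)
  qed
qed

lemma add_leaf_iso:
  assumes "simple_graph G" "simple_graph H" "bij_betw f (verts G) (verts H)"
    "\<forall>u\<in>verts G. \<forall>v\<in>verts G. adj G u v \<longleftrightarrow> adj H (f u) (f v)"
    "u \<in> verts G" "w \<notin> verts G" "w' \<notin> verts H"
  shows "graph_iso (add_leaf G u w) (add_leaf H (f u) w')"
  unfolding graph_iso_def using add_leaf_iso_fun[OF assms] by blast

lemma adj_infinity_graph:
  "adj (infinity_graph s) i j \<longleftrightarrow> (i < s \<and> j = Suc i \<or> j < s \<and> i = Suc j) \<or>
    (i = 0 \<and> j = s + 1 \<or> i = s + 1 \<and> j = 0) \<or> (i = 0 \<and> j = s + 2 \<or> i = s + 2 \<and> j = 0) \<or>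
    (i = s + 1 \<and> j = s + 2 \<or> i = s + 2 \<and> j = s + 1) \<or>
    (i = s \<and> j = s + 3 \<or> i = s + 3 \<and> j = s) \<or> (i = s \<and> j = s + 4 \<or> i = s + 4 \<and> j = s) \<or>
    (i = s + 3 \<and> j = s + 4 \<or> i = s + 4 \<and> j = s + 3)"
proof -
  have "(\<exists>k. (i = k \<and> j = Suc k \<or> i = Suc k \<and> j = k) \<and> k < s) \<longleftrightarrow> i < s \<and> j = Suc i \<or> j < s \<and> i = Suc j"
    by auto
  then show ?thesis
    unfolding infinity_graph_def snd_conv
    by (simp only: Un_iff insert_iff mem_Collect_eq doubleton_eq_iff empty_iff disj_assoc simp_thms)
qed

lemma adj_theta_graph:
  "adj theta_graph i j \<longleftrightarrow> i \<noteq> j \<and> i < 4 \<and> j < 4 \<and> (i < 2 \<or> j < 2)"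
  by (simp add: theta_graph_def doubleton_eq_iff) presburger

lemma verts_theta_graph: "verts theta_graph = {..<4}"
  by (auto simp: theta_graph_def)

definition swap :: "nat \<Rightarrow> nat \<Rightarrow> nat \<Rightarrow> nat" where
  "swap a b i = (if i = a then b else if i = b then a else i)"

definition reflect :: "nat \<Rightarrow> nat \<Rightarrow> nat" where
  "reflect s i = (if i \<le> s then s - i else if i \<le> s + 2 then i + 2 else i - 2)"

lemma core_automorphismI:
  assumes "\<And>x. x \<in> verts C \<Longrightarrow> r x \<in> verts C" "\<And>x. x \<in> verts C \<Longrightarrow> r (r x) = x"
    and "\<And>e. e \<in> edges C \<Longrightarrow> r ` e \<in> edges C"
  shows "core_automorphism C r"
  unfolding core_automorphism_def
proof (intro conjI ballI)
  show "bij_betw r (verts C) (verts C)" by (rule bij_betwI[of _ _ _ r]) (use assms in auto)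
  fix u v assume "u \<in> verts C" "v \<in> verts C"
  then show "adj C u v \<longleftrightarrow> adj C (r u) (r v)"
    using assms(2)[of u] assms(2)[of v] assms(3)[of "{u, v}"] assms(3)[of "{r u, r v}"] by auto
qed

text \<open>Each swap exchanges the two outer vertices of one triangle and the reflection exchanges
  the triangles. Together they move \<open>s + 1\<close> to any of the four outer vertices.\<close>

lemma core_automorphism_infinity:
  "core_automorphism (infinity_graph s) (swap (s + 1) (s + 2))"
  "core_automorphism (infinity_graph s) (swap (s + 3) (s + 4))"
  "core_automorphism (infinity_graph s) (reflect s)"
proof -
  let ?C = "infinity_graph s"
  have edge: "r ` e \<in> edges ?C"
    if "e \<in> edges ?C" and path: "\<And>i. i < s \<Longrightarrow> {r i, r (Suc i)} \<in> edges ?C"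
      and tri: "{r 0, r (s + 1)} \<in> edges ?C" "{r 0, r (s + 2)} \<in> edges ?C" "{r (s + 1), r (s + 2)} \<in> edges ?C"
        "{r s, r (s + 3)} \<in> edges ?C" "{r s, r (s + 4)} \<in> edges ?C" "{r (s + 3), r (s + 4)} \<in> edges ?C"
    for r e
    using that(1) unfolding edges_infinity_graph[of s]
    by (elim UnE imageE insertE emptyE; simp only: image_insert image_empty edges_infinity_graph[symmetric]
      path tri lessThan_iff)
  have p: "{i, Suc i} \<in> edges ?C" if "i < s" for i using that by (auto simp: edges_infinity_graph)
  have t: "{0, s + 1} \<in> edges ?C" "{0, s + 2} \<in> edges ?C" "{s + 1, s + 2} \<in> edges ?C" "{s + 2, s + 1} \<in> edges ?C"
    "{s, s + 3} \<in> edges ?C" "{s, s + 4} \<in> edges ?C" "{s + 3, s + 4} \<in> edges ?C" "{s + 4, s + 3} \<in> edges ?C"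
    by (simp_all add: edges_infinity_graph insert_commute)
  show "core_automorphism ?C (swap (s + 1) (s + 2))"
  proof (rule core_automorphismI)
    fix e assume "e \<in> edges ?C"
    then show "swap (s + 1) (s + 2) ` e \<in> edges ?C"
      by (rule edge) (use p t in \<open>simp_all add: swap_def\<close>)
  qed (auto simp: verts_infinity_graph swap_def)
  show "core_automorphism ?C (swap (s + 3) (s + 4))"
  proof (rule core_automorphismI)
    fix e assume "e \<in> edges ?C"
    then show "swap (s + 3) (s + 4) ` e \<in> edges ?C"
      by (rule edge) (use p t in \<open>simp_all add: swap_def\<close>)
  qed (auto simp: verts_infinity_graph swap_def)
  show "core_automorphism ?C (reflect s)"
  proof (rule core_automorphismI)
    fix e assume "e \<in> edges ?C"
    then show "reflect s ` e \<in> edges ?C"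
    proof (rule edge)
      fix i assume i: "i < s"
      then have "{reflect s i, reflect s (Suc i)} = {s - Suc i, Suc (s - Suc i)}"
        by (simp add: reflect_def Suc_diff_Suc insert_commute)
      then show "{reflect s i, reflect s (Suc i)} \<in> edges ?C" using p[of "s - Suc i"] i by simp
    qed (use t in \<open>simp_all add: reflect_def numeral_eq_Suc\<close>)
  qed (auto simp: verts_infinity_graph reflect_def)
qed

lemma swap_swap [simp]: "swap a b (swap a b x) = x"
  by (auto simp: swap_def)

lemma core_automorphism_theta:
  "core_automorphism theta_graph (swap 2 3)" "core_automorphism theta_graph (swap 0 1)"
proof -
  have "e \<in> {{0, 1}, {0, 2}, {0, 3}, {1, 2}, {1, 3}}" if "e \<in> edges theta_graph" for e
    using that by (simp add: theta_graph_def)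
  note e = this
  show "core_automorphism theta_graph (swap 2 3)"
  proof (rule core_automorphismI)
    fix e assume "e \<in> edges theta_graph"
    from e[OF this] show "swap 2 3 ` e \<in> edges theta_graph"
      by (elim insertE; simp add: theta_graph_def swap_def)
  qed (simp_all add: verts_theta_graph, simp add: swap_def)
  show "core_automorphism theta_graph (swap 0 1)"
  proof (rule core_automorphismI)
    fix e assume "e \<in> edges theta_graph"
    from e[OF this] show "swap 0 1 ` e \<in> edges theta_graph"
      by (elim insertE; simp add: theta_graph_def swap_def insert_commute)
  qed (simp_all add: verts_theta_graph, simp add: swap_def)
qed

section \<open>Leg configurations excluded by explicit tables\<close>

lemma good_no_obstruction_list:
  assumes "conn_graph G" "good G" "obstruction M xs"
    and "length vs = length M" "distinct vs" "set vs \<subseteq> verts G"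
    and "list_all (\<lambda>i. list_all (\<lambda>j. adj G (vs ! i) (vs ! j) = (M ! i ! j = 1)) [0..<i]) [0..<length M]"
  shows False
  using assms(7) by (intro conn_graph.good_no_obstruction[OF assms(1-6)]) (simp add: list_all_iff)

text \<open>The pattern of all exclusions that follow: the list names the vertices of an induced
  configuration in the order of the rows of the table. Evaluation checks the certificate and
  simplification the adjacencies; the distances then come for free.\<close>

lemma center_leg_excluded:
  assumes "conn_graph (spider (infinity_graph 0) l)" "good (spider (infinity_graph 0) l)"
    and "l 0 k \<ge> 2"
  shows False
proof -
  have "obstruction [[0,1,1,1,1,1,2], [1,0,1,2,2,2,3], [1,1,0,2,2,2,3], [1,2,2,0,1,2,3], [1,2,2,1,0,2,3], [1,2,2,2,2,0,1], [2,3,3,3,3,1,0]]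
      [-4, 1, 1, 1, 1, 3, -1]"
    by code_simp
  then show False
    by (rule good_no_obstruction_list[OF assms(1,2), of _ _
          "[(0, 0, 0), (1, 0, 0), (2, 0, 0), (3, 0, 0), (4, 0, 0), (0, k, 1), (0, k, 2)]"])
      (use assms in \<open>simp_all add: verts_spider adj_spider adj_infinity_graph verts_infinity_graph\<close>)
qed

text \<open>The table is the tripod with \<open>j = 2\<close>, the one length that is allowed, with
  one of its two leaves prolonged by an edge. It serves again in \<open>middle_excluded\<close>,
  \<open>double_leg_excluded\<close> and \<open>left_near_excluded\<close>, where the prolonged leaf
  runs partly through core vertices or along a leg.\<close>

lemma left_leg_excluded:
  assumes "conn_graph (spider (infinity_graph 2) l)" "good (spider (infinity_graph 2) l)"
    and "l 0 k \<ge> 2"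
  shows False
proof -
  have "obstruction [[0,1,1,1,2,3,3,4], [1,0,1,2,3,4,4,5], [1,1,0,2,3,4,4,5], [1,2,2,0,1,2,2,3], [2,3,3,1,0,1,1,2], [3,4,4,2,1,0,2,3], [3,4,4,2,1,2,0,1], [4,5,5,3,2,3,1,0]]
      [-1, 0, 0, 2, -4, 1, 2, -1]"
    by code_simp
  then show False
    by (rule good_no_obstruction_list[OF assms(1,2), of _ _
          "[(2, 0, 0), (5, 0, 0), (6, 0, 0), (1, 0, 0), (0, 0, 0), (3, 0, 0), (0, k, 1), (0, k, 2)]"])
      (use assms in \<open>simp_all add: verts_spider adj_spider adj_infinity_graph verts_infinity_graph\<close>)
qed

lemma middle_excluded:
  assumes "conn_graph (spider (infinity_graph 4) l)" "good (spider (infinity_graph 4) l)"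
    and "l 2 k > 0"
  shows False
proof -
  have "obstruction [[0,1,1,1,2,3,3,4], [1,0,1,2,3,4,4,5], [1,1,0,2,3,4,4,5], [1,2,2,0,1,2,2,3], [2,3,3,1,0,1,1,2], [3,4,4,2,1,0,2,3], [3,4,4,2,1,2,0,1], [4,5,5,3,2,3,1,0]]
      [-1, 0, 0, 2, -4, 1, 2, -1]"
    by code_simp
  then show False
    by (rule good_no_obstruction_list[OF assms(1,2), of _ _
          "[(4, 0, 0), (7, 0, 0), (8, 0, 0), (3, 0, 0), (2, 0, 0), (2, k, 1), (1, 0, 0), (0, 0, 0)]"])
      (use assms in \<open>simp_all add: verts_spider adj_spider adj_infinity_graph verts_infinity_graph\<close>)
qed

lemma double_leg_excluded:
  assumes "conn_graph (spider (infinity_graph 1) l)" "good (spider (infinity_graph 1) l)"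
    and "l 2 k \<ge> 2" "l 2 m > 0" "k \<noteq> m"
  shows False
proof -
  have "obstruction [[0,1,1,1,2,3,3,4], [1,0,1,2,3,4,4,5], [1,1,0,2,3,4,4,5], [1,2,2,0,1,2,2,3], [2,3,3,1,0,1,1,2], [3,4,4,2,1,0,2,3], [3,4,4,2,1,2,0,1], [4,5,5,3,2,3,1,0]]
      [-1, 0, 0, 2, -4, 1, 2, -1]"
    by code_simp
  then show False
    by (rule good_no_obstruction_list[OF assms(1,2), of _ _
          "[(1, 0, 0), (4, 0, 0), (5, 0, 0), (0, 0, 0), (2, 0, 0), (2, m, 1), (2, k, 1), (2, k, 2)]"])
      (use assms in \<open>simp_all add: verts_spider adj_spider adj_infinity_graph verts_infinity_graph\<close>)
qed

text \<open>Two leaves at vertex 2 are allowed, as \<open>B1\<close> shows, so the third leaf needs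
  a table containing the whole core.\<close>

lemma three_legs_excluded:
  assumes "conn_graph (spider (infinity_graph 1) l)" "good (spider (infinity_graph 1) l)"
    and "l 2 k > 0" "l 2 m > 0" "l 2 j > 0" "distinct [k, m, j]"
  shows False
proof -
  have "obstruction [[0,1,1,1,2,2,2,2,2], [1,0,2,2,1,1,3,3,3], [1,2,0,1,3,3,1,1,1], [1,2,1,0,3,3,2,2,2], [2,1,3,3,0,1,4,4,4], [2,1,3,3,1,0,4,4,4], [2,3,1,2,4,4,0,2,2], [2,3,1,2,4,4,2,0,2], [2,3,1,2,4,4,2,2,0]]
      [-2, 0, 3, 0, 0, 0, -1, -1, -1]"
    by code_simp
  then show False
    by (rule good_no_obstruction_list[OF assms(1,2), of _ _
          "[(0, 0, 0), (1, 0, 0), (2, 0, 0), (3, 0, 0), (4, 0, 0), (5, 0, 0), (2, k, 1), (2, m, 1), (2, j, 1)]"])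
      (use assms in \<open>simp_all add: verts_spider adj_spider adj_infinity_graph verts_infinity_graph\<close>)
qed

lemma double_sibling_excluded:
  assumes "conn_graph (spider (infinity_graph 1) l)" "good (spider (infinity_graph 1) l)"
    and "l 2 k > 0" "l 2 m > 0" "k \<noteq> m" "l 3 j > 0"
  shows False
proof -
  have "obstruction [[0,1,1,1,2,2,2,2,2], [1,0,2,2,1,1,3,3,3], [1,2,0,1,3,3,1,1,2], [1,2,1,0,3,3,2,2,1], [2,1,3,3,0,1,4,4,4], [2,1,3,3,1,0,4,4,4], [2,3,1,2,4,4,0,2,3], [2,3,1,2,4,4,2,0,3], [2,3,2,1,4,4,3,3,0]]
      [-3, 1, 7, -3, 0, 0, -2, -2, 1]"
    by code_simp
  then show False
    by (rule good_no_obstruction_list[OF assms(1,2), of _ _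
          "[(0, 0, 0), (1, 0, 0), (2, 0, 0), (3, 0, 0), (4, 0, 0), (5, 0, 0), (2, k, 1), (2, m, 1), (3, j, 1)]"])
      (use assms in \<open>simp_all add: verts_spider adj_spider adj_infinity_graph verts_infinity_graph\<close>)
qed

lemma double_opposite_excluded:
  assumes "conn_graph (spider (infinity_graph 1) l)" "good (spider (infinity_graph 1) l)"
    and "l 2 k > 0" "l 2 m > 0" "k \<noteq> m" "l 4 j > 0"
  shows False
proof -
  have "obstruction [[0,1,1,1,2,2,2,2,3], [1,0,2,2,1,1,3,3,2], [1,2,0,1,3,3,1,1,4], [1,2,1,0,3,3,2,2,4], [2,1,3,3,0,1,4,4,1], [2,1,3,3,1,0,4,4,2], [2,3,1,2,4,4,0,2,5], [2,3,1,2,4,4,2,0,5], [3,2,4,4,1,2,5,5,0]]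
      [-5, 3, 7, 0, -2, 0, -2, -2, 1]"
    by code_simp
  then show False
    by (rule good_no_obstruction_list[OF assms(1,2), of _ _
          "[(0, 0, 0), (1, 0, 0), (2, 0, 0), (3, 0, 0), (4, 0, 0), (5, 0, 0), (2, k, 1), (2, m, 1), (4, j, 1)]"])
      (use assms in \<open>simp_all add: verts_spider adj_spider adj_infinity_graph verts_infinity_graph\<close>)
qed

lemma two_center_excluded:
  assumes "conn_graph (spider (infinity_graph 0) l)" "good (spider (infinity_graph 0) l)"
    and "l 0 k > 0" "l 0 m > 0" "k \<noteq> m" "l 1 j > 0"
  shows False
proof -
  have "obstruction [[0,1,1,1,1,1,1,2], [1,0,1,2,2,2,2,1], [1,1,0,2,2,2,2,2], [1,2,2,0,1,2,2,3], [1,2,2,1,0,2,2,3], [1,2,2,2,2,0,2,3], [1,2,2,2,2,2,0,3], [2,1,2,3,3,3,3,0]]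
      [-2, 1, 0, 0, 0, 0, 0, -1]"
    by code_simp
  then show False
    by (rule good_no_obstruction_list[OF assms(1,2), of _ _
          "[(0, 0, 0), (1, 0, 0), (2, 0, 0), (3, 0, 0), (4, 0, 0), (0, k, 1), (0, m, 1), (1, j, 1)]"])
      (use assms in \<open>simp_all add: verts_spider adj_spider adj_infinity_graph verts_infinity_graph\<close>)
qed

lemma center_siblings_excluded:
  assumes "conn_graph (spider (infinity_graph 0) l)" "good (spider (infinity_graph 0) l)"
    and "l 0 k > 0" "l 1 m > 0" "l 2 j > 0"
  shows False
proof -
  have "obstruction [[0,1,1,1,1,1,2,2], [1,0,1,2,2,2,1,2], [1,1,0,2,2,2,2,1], [1,2,2,0,1,2,3,3], [1,2,2,1,0,2,3,3], [1,2,2,2,2,0,3,3], [2,1,2,3,3,3,0,3], [2,2,1,3,3,3,3,0]]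
      [-5, 2, 2, 1, 1, 1, -1, -1]"
    by code_simp
  then show False
    by (rule good_no_obstruction_list[OF assms(1,2), of _ _
          "[(0, 0, 0), (1, 0, 0), (2, 0, 0), (3, 0, 0), (4, 0, 0), (0, k, 1), (1, m, 1), (2, j, 1)]"])
      (use assms in \<open>simp_all add: verts_spider adj_spider adj_infinity_graph verts_infinity_graph\<close>)
qed

lemma center_opposite_excluded:
  assumes "conn_graph (spider (infinity_graph 0) l)" "good (spider (infinity_graph 0) l)"
    and "l 0 k > 0" "l 1 m > 0" "l 3 j > 0"
  shows False
proof -
  have "obstruction [[0,1,1,1,1,1,2,2], [1,0,1,2,2,2,1,3], [1,1,0,2,2,2,2,3], [1,2,2,0,1,2,3,1], [1,2,2,1,0,2,3,2], [1,2,2,2,2,0,3,3], [2,1,2,3,3,3,0,4], [2,3,3,1,2,3,4,0]]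
      [-3, 2, 0, 2, 0, 1, -1, -1]"
    by code_simp
  then show False
    by (rule good_no_obstruction_list[OF assms(1,2), of _ _
          "[(0, 0, 0), (1, 0, 0), (2, 0, 0), (3, 0, 0), (4, 0, 0), (0, k, 1), (1, m, 1), (3, j, 1)]"])
      (use assms in \<open>simp_all add: verts_spider adj_spider adj_infinity_graph verts_infinity_graph\<close>)
qed

text \<open>The configuration is a triangle with a leaf and a path of length four at one of its
  vertices; its first path vertex is the core vertex 1. The same table occurs in
  \<open>left_far_excluded\<close>.\<close>

lemma center_long_excluded:
  assumes "conn_graph (spider (infinity_graph 0) l)" "good (spider (infinity_graph 0) l)"
    and "l 0 k > 0" "l 1 m \<ge> 3"
  shows False
proof -
  have "obstruction [[0,1,1,1,1,2,3,4], [1,0,1,2,2,3,4,5], [1,1,0,2,2,3,4,5], [1,2,2,0,2,3,4,5], [1,2,2,2,0,1,2,3], [2,3,3,3,1,0,1,2], [3,4,4,4,2,1,0,1], [4,5,5,5,3,2,1,0]]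
      [-5, 1, 1, 1, 3, -2, 2, -1]"
    by code_simp
  then show False
    by (rule good_no_obstruction_list[OF assms(1,2), of _ _
          "[(0, 0, 0), (3, 0, 0), (4, 0, 0), (0, k, 1), (1, 0, 0), (1, m, 1), (1, m, 2), (1, m, 3)]"])
      (use assms in \<open>simp_all add: verts_spider adj_spider adj_infinity_graph verts_infinity_graph\<close>)
qed

lemma left_double_excluded:
  assumes "conn_graph (spider (infinity_graph 2) l)" "good (spider (infinity_graph 2) l)"
    and "l 0 k > 0" "l 0 m > 0" "k \<noteq> m"
  shows False
proof -
  have "obstruction [[0,1,2,1,1,3,3,1,1], [1,0,1,2,2,2,2,2,2], [2,1,0,3,3,1,1,3,3], [1,2,3,0,1,4,4,2,2], [1,2,3,1,0,4,4,2,2], [3,2,1,4,4,0,1,4,4], [3,2,1,4,4,1,0,4,4], [1,2,3,2,2,4,4,0,2], [1,2,3,2,2,4,4,2,0]]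
      [-5, 3, -1, 1, 1, 0, 0, 1, 1]"
    by code_simp
  then show False
    by (rule good_no_obstruction_list[OF assms(1,2), of _ _
          "[(0, 0, 0), (1, 0, 0), (2, 0, 0), (3, 0, 0), (4, 0, 0), (5, 0, 0), (6, 0, 0), (0, k, 1), (0, m, 1)]"])
      (use assms in \<open>simp_all add: verts_spider adj_spider adj_infinity_graph verts_infinity_graph\<close>)
qed

lemma left_near_excluded:
  assumes "conn_graph (spider (infinity_graph 2) l)" "good (spider (infinity_graph 2) l)"
    and "l 0 k > 0" "l 3 m > 0"
  shows False
proof -
  have "obstruction [[0,1,1,1,2,3,3,4], [1,0,1,2,3,4,4,5], [1,1,0,2,3,4,4,5], [1,2,2,0,1,2,2,3], [2,3,3,1,0,1,1,2], [3,4,4,2,1,0,2,3], [3,4,4,2,1,2,0,1], [4,5,5,3,2,3,1,0]]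
      [-1, 0, 0, 2, -4, 1, 2, -1]"
    by code_simp
  then show False
    by (rule good_no_obstruction_list[OF assms(1,2), of _ _
          "[(2, 0, 0), (5, 0, 0), (6, 0, 0), (1, 0, 0), (0, 0, 0), (0, k, 1), (3, 0, 0), (3, m, 1)]"])
      (use assms in \<open>simp_all add: verts_spider adj_spider adj_infinity_graph verts_infinity_graph\<close>)
qed

lemma left_far_excluded:
  assumes "conn_graph (spider (infinity_graph 2) l)" "good (spider (infinity_graph 2) l)"
    and "l 0 k > 0" "l 5 m > 0"
  shows False
proof -
  have "obstruction [[0,1,1,1,1,2,3,4], [1,0,1,2,2,3,4,5], [1,1,0,2,2,3,4,5], [1,2,2,0,2,3,4,5], [1,2,2,2,0,1,2,3], [2,3,3,3,1,0,1,2], [3,4,4,4,2,1,0,1], [4,5,5,5,3,2,1,0]]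
      [-5, 1, 1, 1, 3, -2, 2, -1]"
    by code_simp
  then show False
    by (rule good_no_obstruction_list[OF assms(1,2), of _ _
          "[(0, 0, 0), (3, 0, 0), (4, 0, 0), (0, k, 1), (1, 0, 0), (2, 0, 0), (5, 0, 0), (5, m, 1)]"])
      (use assms in \<open>simp_all add: verts_spider adj_spider adj_infinity_graph verts_infinity_graph\<close>)
qed

lemma theta_side_excluded:
  assumes "conn_graph (spider (theta_graph) l)" "good (spider (theta_graph) l)"
    and "l 2 k > 0"
  shows False
proof -
  have "obstruction [[0,1,1,1,2], [1,0,1,1,2], [1,1,0,2,1], [1,1,2,0,3], [2,2,1,3,0]]
      [-2, -2, 2, 1, -1]"
    by code_simp
  then show False
    by (rule good_no_obstruction_list[OF assms(1,2), of _ _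
          "[(0, 0, 0), (1, 0, 0), (2, 0, 0), (3, 0, 0), (2, k, 1)]"])
      (use assms in \<open>simp_all add: verts_spider adj_spider adj_theta_graph verts_theta_graph\<close>)
qed

lemma theta_leg_excluded:
  assumes "conn_graph (spider (theta_graph) l)" "good (spider (theta_graph) l)"
    and "l 0 k \<ge> 2"
  shows False
proof -
  have "obstruction [[0,1,1,1,1,2], [1,0,1,1,2,3], [1,1,0,2,2,3], [1,1,2,0,2,3], [1,2,2,2,0,1], [2,3,3,3,1,0]]
      [-3, -1, 1, 1, 2, -1]"
    by code_simp
  then show False
    by (rule good_no_obstruction_list[OF assms(1,2), of _ _
          "[(0, 0, 0), (1, 0, 0), (2, 0, 0), (3, 0, 0), (0, k, 1), (0, k, 2)]"])
      (use assms in \<open>simp_all add: verts_spider adj_spider adj_theta_graph verts_theta_graph\<close>)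
qed

lemma theta_two_two_excluded:
  assumes "conn_graph (spider (theta_graph) l)" "good (spider (theta_graph) l)"
    and "l 0 k > 0" "l 0 m > 0" "k \<noteq> m" "l 1 i > 0" "l 1 j > 0" "i \<noteq> j"
  shows False
proof -
  have "obstruction [[0,1,1,1,1,1,2,2], [1,0,1,1,2,2,1,1], [1,1,0,2,2,2,2,2], [1,1,2,0,2,2,2,2], [1,2,2,2,0,2,3,3], [1,2,2,2,2,0,3,3], [2,1,2,2,3,3,0,2], [2,1,2,2,3,3,2,0]]
      [-3, 3, 0, 0, 1, 1, -1, -1]"
    by code_simp
  then show False
    by (rule good_no_obstruction_list[OF assms(1,2), of _ _
          "[(0, 0, 0), (1, 0, 0), (2, 0, 0), (3, 0, 0), (0, k, 1), (0, m, 1), (1, i, 1), (1, j, 1)]"])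
      (use assms in \<open>simp_all add: verts_spider adj_spider adj_theta_graph verts_theta_graph\<close>)
qed

lemma theta_three_one_excluded:
  assumes "conn_graph (spider (theta_graph) l)" "good (spider (theta_graph) l)"
    and "l 0 k > 0" "l 0 m > 0" "l 0 j > 0" "distinct [k, m, j]" "l 1 i > 0"
  shows False
proof -
  have "obstruction [[0,1,1,1,1,1,1,2], [1,0,1,1,2,2,2,1], [1,1,0,2,2,2,2,2], [1,1,2,0,2,2,2,2], [1,2,2,2,0,2,2,3], [1,2,2,2,2,0,2,3], [1,2,2,2,2,2,0,3], [2,1,2,2,3,3,3,0]]
      [-4, 2, 0, 0, 1, 1, 1, -1]"
    by code_simp
  then show False
    by (rule good_no_obstruction_list[OF assms(1,2), of _ _
          "[(0, 0, 0), (1, 0, 0), (2, 0, 0), (3, 0, 0), (0, k, 1), (0, m, 1), (0, j, 1), (1, i, 1)]"])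
      (use assms in \<open>simp_all add: verts_spider adj_spider adj_theta_graph verts_theta_graph\<close>)
qed

section \<open>Leg configurations excluded by tripods\<close>

text \<open>Only adjacencies among the chosen vertices matter, since these fix the distances. In
  particular \<open>w1\<close> and \<open>w2\<close> may have further neighbours in
  \<open>G\<close>, which allows core vertices to play the part of leaves.\<close>

lemma (in conn_graph) good_tripod_at:
  assumes good: "good G" and j: "j \<ge> 1"
    and q: "inj_on q {..j}" "\<And>t. t \<le> j \<Longrightarrow> q t \<in> V"
      "\<And>t t'. t < t' \<Longrightarrow> t' \<le> j \<Longrightarrow> adj G (q t) (q t') \<longleftrightarrow> t' = Suc t"
    and V: "{w1, w2, a, b} \<subseteq> V" "distinct [w1, w2, a, b]"
    and nq: "\<And>t. t \<le> j \<Longrightarrow> q t \<notin> {w1, w2, a, b}"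
    and w: "\<And>t. t \<le> j \<Longrightarrow> adj G (q t) w1 \<longleftrightarrow> t = 0" "\<And>t. t \<le> j \<Longrightarrow> adj G (q t) w2 \<longleftrightarrow> t = 0"
      "\<not> adj G w2 w1"
    and ab: "\<And>t. t \<le> j \<Longrightarrow> adj G (q t) a \<longleftrightarrow> t = j" "\<And>t. t \<le> j \<Longrightarrow> adj G (q t) b \<longleftrightarrow> t = j"
      "adj G b a"
    and wab: "\<not> adj G a w1" "\<not> adj G a w2" "\<not> adj G b w1" "\<not> adj G b w2"
  shows "j = 2"
proof -
  define f where "f i = (if i = 0 then w1 else if i = 1 then w2 else if i = 2 then a else if i = 3 then b else q (i - 4))"
    for i :: nat
  have f: "f 0 = w1" "f 1 = w2" "f 2 = a" "f 3 = b" "\<And>t. f (4 + t) = q t" by (simp_all add: f_def)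
  have idx: "i = 0 \<or> i = 1 \<or> i = 2 \<or> i = 3 \<or> (\<exists>t\<le>j. i = 4 + t)" if "i < j + 5" for i
    using that by presburger
  have q': "q t = q t' \<longleftrightarrow> t = t'" if "t \<le> j" "t' \<le> j" for t t' using q(1) that by (auto simp: inj_on_def)
  have ne: "q t \<noteq> w1" "q t \<noteq> w2" "q t \<noteq> a" "q t \<noteq> b" if "t \<le> j" for t using nq[OF that] by auto
  have qs: "adj G (q t) (q t') \<longleftrightarrow> t = Suc t'" if "t' < t" "t \<le> j" for t t'
    using q(3)[OF that] by (simp add: insert_commute)
  show ?thesis
  proof (rule good_tripod[OF good j, of f])
    show "inj_on f {..<j + 5}"
    proof (rule inj_onI)
      fix i k assume ik: "i \<in> {..<j + 5}" "k \<in> {..<j + 5}" "f i = f k"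
      then have "i < j + 5" "k < j + 5" by auto
      from idx[OF this(1)] idx[OF this(2)] show "i = k"
        using ik(3) V(2) by (elim disjE exE conjE; simp add: f f(2)[simplified] ne ne[THEN not_sym] q')
    qed
    show "f ` {..<j + 5} \<subseteq> V"
    proof
      fix v assume "v \<in> f ` {..<j + 5}"
      then obtain i where i: "i < j + 5" "v = f i" by auto
      from idx[OF i(1)] show "v \<in> V" using i V q(2) by (elim disjE exE conjE; simp add: f f(2)[simplified])
    qed
    fix i k assume ik: "i < j + 5" "k < i"
    then have "k < j + 5" by simp
    from idx[OF ik(1)] idx[OF this] ik(2) show "adj G (f i) (f k) \<longleftrightarrow> tripod j i k = 1"
      by (elim disjE exE conjE; simp add: f f(2)[simplified] w ab wab qs w(3)
          tripod_leg tripod_legs tripod_path tripod_triangle; linarith?)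
  qed
qed

lemma adj_infinity_path:
  "i \<le> s \<Longrightarrow> j \<le> s \<Longrightarrow> adj (infinity_graph s) i j \<longleftrightarrow> j = Suc i \<or> i = Suc j"
  "i \<le> s \<Longrightarrow> adj (infinity_graph s) i (Suc s) \<longleftrightarrow> i = 0"
  "i \<le> s \<Longrightarrow> adj (infinity_graph s) i (s + 2) \<longleftrightarrow> i = 0"
  "i \<le> s \<Longrightarrow> adj (infinity_graph s) i (s + 3) \<longleftrightarrow> i = s"
  "i \<le> s \<Longrightarrow> adj (infinity_graph s) i (s + 4) \<longleftrightarrow> i = s"
  "i \<le> s \<Longrightarrow> adj (infinity_graph s) (Suc s) i \<longleftrightarrow> i = 0"
  "i \<le> s \<Longrightarrow> adj (infinity_graph s) (s + 2) i \<longleftrightarrow> i = 0"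
  "i \<le> s \<Longrightarrow> adj (infinity_graph s) (s + 3) i \<longleftrightarrow> i = s"
  "i \<le> s \<Longrightarrow> adj (infinity_graph s) (s + 4) i \<longleftrightarrow> i = s"
  unfolding adj_infinity_graph by auto

lemma adj_infinity_ends:
  "adj (infinity_graph s) (s + 4) (s + 3)" "adj (infinity_graph s) (s + 2) (Suc s)"
  "\<not> adj (infinity_graph s) (s + 3) (Suc s)" "\<not> adj (infinity_graph s) (s + 4) (Suc s)"
  "\<not> adj (infinity_graph s) (s + 3) (s + 2)" "\<not> adj (infinity_graph s) (s + 4) (s + 2)"
  "\<not> adj (infinity_graph s) (Suc s) (s + 3)" "\<not> adj (infinity_graph s) (Suc s) (s + 4)"
  "adj (infinity_graph s) (Suc s) (Suc (Suc s))" "adj (infinity_graph s) (Suc (Suc s)) 0"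
  unfolding adj_infinity_graph by auto

lemma adj_infinity_fresh: "\<not> adj (infinity_graph s) i (s + 5)" "\<not> adj (infinity_graph s) (s + 5) i"
  unfolding adj_infinity_graph by auto

definition good_spider :: "nat graph \<Rightarrow> (nat \<Rightarrow> nat \<Rightarrow> nat) \<Rightarrow> bool" where
  "good_spider C l \<longleftrightarrow> finite_legs C l \<and> conn_graph (spider C l) \<and> good (spider C l)"

lemma good_spider_automorphism:
  assumes C: "simple_graph C" and r: "core_automorphism C r" and l: "good_spider C l"
  shows "good_spider C (\<lambda>x. l (r x))"
proof -
  have fin: "finite_legs C (\<lambda>x. l (r x))" using finite_legs_automorphism[OF r] l by (simp add: good_spider_def)
  have S: "simple_graph (spider C (\<lambda>x. l (r x)))" using simple_spider[OF C fin] .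
  have iso: "graph_iso (spider C l) (spider C (\<lambda>x. l (r x)))"
    using graph_iso_spider_automorphism[OF C r] by (rule graph_iso_sym)
  have conn: "conn_graph (spider C l)" and g: "good (spider C l)" using l by (auto simp: good_spider_def)
  have "conn_graph (spider C (\<lambda>x. l (r x)))"
    using iso graph_iso_conn_graph(1)[OF conn S] by (auto simp: graph_iso_def)
  moreover have "good (spider C (\<lambda>x. l (r x)))" using good_iso[OF conn S iso] g by simp
  ultimately show ?thesis using fin by (simp add: good_spider_def)
qed

text \<open>The tripod stands at the path vertex \<open>m\<close>. Its leaves are the first vertex
  of the leg and the core neighbour on the left, which is a triangle vertex when
  \<open>m = 0\<close>; its triangle is the one at \<open>s\<close>.\<close>

lemma infinity_leg_right:
  assumes l: "good_spider (infinity_graph s) l" and m: "m < s" "l m k > 0"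
  shows "s - m = 2"
proof -
  interpret conn_graph "spider (infinity_graph s) l" using l by (simp add: good_spider_def)
  let ?p = "if m = 0 then s + 1 else m - 1"
  show ?thesis
    by (rule good_tripod_at[of _ "\<lambda>t. (m + t, 0, 0)" "(m, k, 1)" "(?p, 0, 0)" "(s + 3, 0, 0)" "(s + 4, 0, 0)"])
      (use l m in \<open>auto simp: good_spider_def inj_on_def verts_spider verts_infinity_graph adj_spider
        adj_infinity_path adj_infinity_ends\<close>)
qed

text \<open>The tripod stands at \<open>s + 1\<close> with the two legs as leaves. Its path
  \<open>s + 1\<close>, 0, ..., \<open>s\<close> has \<open>s + 1\<close> edges.\<close>

lemma infinity_double_leg:
  assumes l: "good_spider (infinity_graph s) l" and k: "l (s + 1) k > 0" "l (s + 1) k' > 0" "k \<noteq> k'"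
  shows "s = 1"
proof -
  interpret conn_graph "spider (infinity_graph s) l" using l by (simp add: good_spider_def)
  have "s + 1 = 2"
    by (rule good_tripod_at[of _ "\<lambda>t. (if t = 0 then s + 1 else t - 1, 0, 0)"
          "(s + 1, k, 1)" "(s + 1, k', 1)" "(s + 3, 0, 0)" "(s + 4, 0, 0)"])
      (use l k in \<open>auto simp: good_spider_def inj_on_def verts_spider verts_infinity_graph adj_spider
        adj_infinity_path adj_infinity_ends\<close>)
  then show ?thesis by simp
qed


lemma reflect_bounds:
  "m \<le> s \<Longrightarrow> reflect s (s - m) = m" "reflect s (s + 1) = s + 3" "reflect s (s + 2) = s + 4"
  "reflect s (s + 3) = s + 1" "reflect s (s + 4) = s + 2"
  by (simp_all add: reflect_def)

text \<open>Tripods towards the right triangle give \<open>m = s\<close> or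
  \<open>s - m = 2\<close>; by reflection, \<open>m = 0\<close> or \<open>m = 2\<close>. Of the four
  combinations, \<open>s = 4\<close> with \<open>m = 2\<close> falls to a separate table.\<close>

lemma infinity_path_leg:
  assumes l: "good_spider (infinity_graph s) l" and m: "m \<le> s" "l m k > 0"
  shows "(s, m) \<in> {(0, 0), (2, 0), (2, 2)}" "l m k = 1"
proof -
  have C: "conn_graph (spider (infinity_graph s) l)" "good (spider (infinity_graph s) l)"
    using l by (auto simp: good_spider_def)
  let ?l = "\<lambda>x. l (reflect s x)"
  have l': "good_spider (infinity_graph s) ?l"
    using good_spider_automorphism[OF simple_infinity_graph core_automorphism_infinity(3) l] .
  have C': "conn_graph (spider (infinity_graph s) ?l)" "good (spider (infinity_graph s) ?l)"
    using l' by (auto simp: good_spider_def)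
  have "m = s \<or> s - m = 2" using infinity_leg_right[OF l, of m k] m by linarith
  moreover have "m = 0 \<or> m = 2"
    using infinity_leg_right[OF l', of "s - m" k] m by (cases "m = 0") (simp_all add: reflect_bounds)
  moreover have "\<not> (s = 4 \<and> m = 2)" using middle_excluded[of l k] C m by auto
  ultimately show sm: "(s, m) \<in> {(0, 0), (2, 0), (2, 2)}" using m by auto
  show "l m k = 1"
  proof (rule ccontr)
    assume "l m k \<noteq> 1"
    then have two: "l m k \<ge> 2" using m by linarith
    from sm consider "s = 0" "m = 0" | "s = 2" "m = 0" | "s = 2" "m = 2" by auto
    then show False
    proof cases
      case 1 then show False using center_leg_excluded[of l k] C two by simp
    next
      case 2 then show False using left_leg_excluded[of l k] C two by simp
    next
      case 3
      then show False using left_leg_excluded[of ?l k] C' two by (simp add: reflect_def)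
    qed
  qed
qed

lemma adj_add_leaf:
  "adj (add_leaf G u w) a b \<longleftrightarrow> a = u \<and> b = w \<or> a = w \<and> b = u \<or> adj G a b"
  by (simp add: doubleton_eq_iff)

text \<open>Two tripods stand at the branching vertex of depth \<open>i\<close>, with the new leaf
  and the next leg vertex as leaves. One ends in the near triangle and has length \<open>i\<close>,
  the other in the far triangle with length \<open>i + 1 + s\<close>; both lengths cannot be 2. The
  name \<open>(s + 5, 0, 0)\<close> is free because \<open>s + 5\<close> is no core vertex.\<close>

lemma infinity_interior_leaf:
  fixes s l k i
  defines "H \<equiv> add_leaf (spider (infinity_graph s) l) (s + 1, k, i) (s + 5, 0, 0)"
  assumes H: "conn_graph H" "good H" and i: "0 < i" "i < l (s + 1) k"
  shows False
proof -
  interpret conn_graph H by (rule H)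
  have "i = 2"
    by (rule good_tripod_at[of _ "\<lambda>t. (s + 1, if t < i then k else 0, i - t)"
          "(s + 5, 0, 0)" "(s + 1, k, Suc i)" "(0, 0, 0)" "(s + 2, 0, 0)"])
      (use H i in \<open>auto simp: H_def inj_on_def verts_spider verts_infinity_graph adj_spider adj_add_leaf
        adj_infinity_path adj_infinity_ends adj_infinity_fresh simp del: edges_add_leaf\<close>)
  moreover have "i + 1 + s = 2"
    by (rule good_tripod_at[of _ "\<lambda>t. if t \<le> i then (s + 1, if t < i then k else 0, i - t) else (t - Suc i, 0, 0)"
          "(s + 5, 0, 0)" "(s + 1, k, Suc i)" "(s + 3, 0, 0)" "(s + 4, 0, 0)"])
      (use H i in \<open>auto simp: H_def inj_on_def verts_spider verts_infinity_graph adj_spider adj_add_leaf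
        adj_infinity_path adj_infinity_ends adj_infinity_fresh simp del: edges_add_leaf\<close>)
  ultimately show False by simp
qed


lemma core_automorphism_comp:
  assumes "core_automorphism C r" "core_automorphism C r'"
  shows "core_automorphism C (r \<circ> r')"
proof -
  have "r' x \<in> verts C" if "x \<in> verts C" for x
    using assms(2) that by (auto simp: core_automorphism_def bij_betw_def)
  then show ?thesis
    using assms bij_betw_trans[of r' "verts C" "verts C" r "verts C"] by (simp add: core_automorphism_def)
qed

lemma infinity_automorphism_to:
  assumes "x \<in> {s + 1, s + 2, s + 3, s + 4}"
  obtains r where "core_automorphism (infinity_graph s) r" "r (s + 1) = x"
    "\<And>m. m \<le> s \<Longrightarrow> r m \<le> s"
proof -
  note a = core_automorphism_infinity[of s]
  from assms consider "x = s + 1" | "x = s + 2" | "x = s + 3" | "x = s + 4" by auto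
  then show ?thesis
  proof cases
    case 1
    \<comment> \<open>The swap composed with itself stands for the identity.\<close>
    then show ?thesis by (intro that[OF core_automorphism_comp[OF a(1) a(1)]]) auto
  next
    case 2
    then show ?thesis by (intro that[OF a(1)]) (auto simp: swap_def)
  next
    case 3
    then show ?thesis by (intro that[OF a(3)]) (auto simp: reflect_def)
  next
    case 4
    then show ?thesis by (intro that[OF core_automorphism_comp[OF a(3) a(1)]]) (auto simp: reflect_def swap_def)
  qed
qed

lemma theta_leg:
  assumes l: "good_spider theta_graph l" and x: "x < 4" "l x k > 0"
  shows "x < 2" "l x k = 1"
proof -
  have *: "conn_graph (spider theta_graph l)" "good (spider theta_graph l)"
      "conn_graph (spider theta_graph (\<lambda>x. l (r x)))" "good (spider theta_graph (\<lambda>x. l (r x)))"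
    if "r = swap 2 3 \<or> r = swap 0 1" for r
    using l good_spider_automorphism[OF simple_theta_graph _ l] core_automorphism_theta that
    by (auto simp: good_spider_def)
  show "x < 2"
  proof (rule ccontr)
    assume "\<not> x < 2"
    then consider "x = 2" | "x = 3" using x by linarith
    then show False
      using theta_side_excluded[of l k] theta_side_excluded[of "\<lambda>x. l (swap 2 3 x)" k] *[of "swap 2 3"] x
      by cases (auto simp: swap_def)
  qed
  show "l x k = 1"
  proof (rule ccontr)
    assume "l x k \<noteq> 1"
    then have "l x k \<ge> 2" "x = 0 \<or> x = 1" using x \<open>x < 2\<close> by linarith+
    then show False
      using theta_leg_excluded[of l k] theta_leg_excluded[of "\<lambda>x. l (swap 0 1 x)" k] *[of "swap 0 1"]
      by (auto simp: swap_def)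
  qed
qed

text \<open>Legs of the theta core and legs at path vertices have length one, hence no interior. The
  remaining legs sit at outer triangle vertices, where an automorphism moves them to
  \<open>s + 1\<close>.\<close>

lemma interior_leaf:
  assumes C: "C = theta_graph \<or> C = infinity_graph s" and fin: "finite_legs C l"
    and conn: "conn_graph (spider C l)"
    and H: "conn_graph (add_leaf (spider C l) (x, k, i) w)" "good (add_leaf (spider C l) (x, k, i) w)"
    and w: "w \<notin> verts (spider C l)" and x: "x \<in> verts C" and i: "0 < i" "i < l x k"
  shows False
proof -
  have u: "(x, k, i) \<in> verts (spider C l)" using x i by (simp add: verts_spider)
  have l: "good_spider C l"
    using conn_graph.good_remove[OF conn H(2) u w] fin conn by (simp add: good_spider_def)
  show False
  proof (cases "C = theta_graph")
    case True
    then show False using theta_leg(2)[of l x k] l x i by (simp add: verts_theta_graph)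
  next
    case False
    then have C: "C = infinity_graph s" using C by simp
    have "s < x" using infinity_path_leg(2)[of s l x k] l i C by (cases "x \<le> s") auto
    then have "x \<in> {s + 1, s + 2, s + 3, s + 4}" using x C by (auto simp: verts_infinity_graph)
    then obtain r where r: "core_automorphism (infinity_graph s) r" "r (s + 1) = x"
      by (rule infinity_automorphism_to)
    let ?l = "\<lambda>x. l (r x)"
    have l': "good_spider C ?l" unfolding C
      by (rule good_spider_automorphism[OF simple_infinity_graph r(1)]) (use l C in simp)
    let ?H = "add_leaf (spider C ?l) (s + 1, k, i) (s + 5, 0, 0)"
    have u': "(s + 1, k, i) \<in> verts (spider C ?l)" "(s + 5, 0, 0) \<notin> verts (spider C ?l)"
      using i r C by (auto simp: verts_spider verts_infinity_graph)
    have S: "simple_graph C" using C simple_infinity_graph by simp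
    have ss: "simple_graph (spider C ?l)" "simple_graph (spider C l)"
      using simple_spider[OF S] l l' by (auto simp: good_spider_def)
    have iso: "graph_iso ?H (add_leaf (spider C l) (x, k, i) w)"
      using add_leaf_iso[OF ss spider_automorphism[OF S, of r l] u' w] r C by simp
    have H': "conn_graph ?H" using conn_graph.add_leaf(1)[of "spider C ?l"] l' u' by (simp add: good_spider_def)
    then have "good ?H" using good_iso[OF H' _ iso] H by (simp add: conn_graph_def)
    then show False using infinity_interior_leaf[of s ?l k i] H' i r C by simp
  qed
qed

text \<open>Induction on the number of vertices. After a leaf is removed, its neighbour corresponds
  to a core vertex, to the tip of a leg or to the interior of a leg. The first two cases enlarge the
  spider, and the third is impossible.\<close>

theorem good_bicyclic_spider:
  assumes "conn_graph G" "good G" "card (edges G) = card (verts G) + 1"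
  shows "\<exists>C l. (C = theta_graph \<or> (\<exists>s. C = infinity_graph s)) \<and> finite_legs C l \<and> graph_iso G (spider C l)"
  using assms
proof (induction "card (verts G)" arbitrary: G rule: less_induct)
  case less
  interpret conn_graph G by (rule less.prems)
  show ?case
  proof (cases "\<forall>w\<in>V. \<exists>x y. x \<noteq> y \<and> adj G x w \<and> adj G y w")
    case True
    then have "graph_iso G theta_graph \<or> (\<exists>s. graph_iso G (infinity_graph s))"
      by (intro good_leafless_bicyclic less.prems) blast
    then obtain C where C: "C = theta_graph \<or> (\<exists>s. C = infinity_graph s)" "graph_iso G C" by blast
    have "graph_iso G (spider C (\<lambda>_ _. 0))"
      using C(2) graph_iso_sym[OF graph_iso_spider_no_legs] by (rule graph_iso_trans)
    then show ?thesis using C(1) by (intro exI conjI) (auto simp: finite_legs_def)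
  next
    case False
    then obtain w where w: "w \<in> V" "\<And>x y. adj G x w \<Longrightarrow> adj G y w \<Longrightarrow> x = y" by blast
    have "V \<noteq> {w}"
    proof
      assume "V = {w}"
      then have "edges G \<subseteq> {}" using simple by (auto simp: simple_graph_def subset_singleton_iff)
      then show False using less.prems(3) by simp
    qed
    then obtain v where "v \<in> V" "v \<noteq> w" using w by blast
    then obtain u where u: "adj G u w" using dist_pred[of v w] w by metis
    let ?G = "(V - {w}, edges G - {{u, w}})"
    have G: "G = add_leaf ?G u w" and conn: "conn_graph ?G"
      using remove_leaf[OF w(1) u w(2)[OF _ u]] by auto
    have uV: "u \<in> verts ?G" "w \<notin> verts ?G" using adjD[OF u] by auto
    have "good ?G" using conn_graph.good_remove[OF conn _ uV] less.prems(2) G by simp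
    moreover have card: "card (V - {w}) < card V" "card (V - {w}) = card V - 1"
      using card_Diff1_less[OF finite_V w(1)] w finite_V by (simp_all add: card_Diff_singleton)
    moreover have "card (edges ?G) = card (verts ?G) + 1"
      using u less.prems(3) finite_E card by (auto simp: card_gt_0_iff)
    ultimately obtain C l where Cl: "C = theta_graph \<or> (\<exists>s. C = infinity_graph s)" "finite_legs C l"
      "graph_iso ?G (spider C l)"
      using less.hyps[of ?G] conn by auto
    obtain s where Cs: "C = theta_graph \<or> C = infinity_graph s" using Cl by blast
    have S: "simple_graph C" using Cs simple_theta_graph simple_infinity_graph by auto
    have sp: "simple_graph (spider C l)" using simple_spider[OF S Cl(2)] .
    obtain f where f: "bij_betw f (verts ?G) (verts (spider C l))"
      "\<forall>u\<in>verts ?G. \<forall>v\<in>verts ?G. adj ?G u v \<longleftrightarrow> adj (spider C l) (f u) (f v)"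
      using Cl(3) unfolding graph_iso_def by blast
    have csp: "conn_graph (spider C l)" using graph_iso_conn_graph(1)[OF conn sp f] .
    have sG: "simple_graph ?G" using conn by (simp add: conn_graph_def)
    obtain x k i where xki: "f u = (x, k, i)" by (cases "f u")
    have fu: "(x, k, i) \<in> verts (spider C l)" using bij_betwE[OF f(1)] uV xki by metis
    then have x: "x \<in> verts C" by (simp add: verts_spider)
    have iso: "graph_iso G (add_leaf (spider C l) (x, k, i) w')" if "w' \<notin> verts (spider C l)" for w'
      using add_leaf_iso[OF sG sp f uV that] xki G by simp
    have *: ?thesis if "f u = node x m (l x m)" for m
    proof -
      let ?l = "l(x := (l x)(m := Suc (l x m)))"
      have "graph_iso G (spider C ?l)"
        unfolding spider_extend[OF x] using iso[OF node_new[of x m l C]] that xki by simp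
      moreover have "finite_legs C ?l"
      proof -
        have "{k. 0 < ?l y k} \<subseteq> insert m {k. 0 < l y k}" for y by auto
        then show ?thesis using Cl(2) unfolding finite_legs_def by (meson finite_insert finite_subset)
      qed
      ultimately show ?thesis using Cl(1) by blast
    qed
    show ?thesis
    proof (cases "i = 0")
      case True
      have "finite {k. 0 < l x k}" using Cl(2) x by (simp add: finite_legs_def)
      then obtain m where "m \<notin> {k. 0 < l x k}" using ex_new_if_finite infinite_UNIV_nat by blast
      then show ?thesis using *[of m] True fu xki by (simp add: node_def verts_spider)
    next
      case i0: False
      show ?thesis
      proof (cases "i = l x k")
        case True
        then show ?thesis using *[of k] i0 xki by (simp add: node_def)
      next
        case False
        then have i: "i < l x k" using fu i0 by (simp add: verts_spider)
        have "finite {k. 0 < l x k}" using Cl(2) x by (simp add: finite_legs_def)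
        then obtain m where "m \<notin> {k. 0 < l x k}" using ex_new_if_finite infinite_UNIV_nat by blast
        then have w': "(x, m, 1) \<notin> verts (spider C l)" by (simp add: verts_spider)
        let ?H = "add_leaf (spider C l) (x, k, i) (x, m, 1)"
        have H: "conn_graph ?H" using conn_graph.add_leaf(1)[OF csp fu w'] .
        then have "good ?H" using good_iso[OF less.prems(1) _ iso[OF w']] less.prems(2) by (simp add: conn_graph_def)
        then have False using interior_leaf[OF Cs Cl(2) csp H _ w' x _ i] i0 by simp
        then show ?thesis ..
      qed
    qed
  qed
qed

section \<open>Classification of the good bicyclic graphs\<close>

definition legs :: "(nat \<times> nat \<times> nat) list \<Rightarrow> nat \<Rightarrow> nat \<Rightarrow> nat" where
  "legs ts x k = sum_list (map (\<lambda>(y, m, r). if y = x \<and> m = k then r else 0) ts)"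

text \<open>The index \<open>k\<close> has no counterpart in \<open>attach_path\<close>; it only
  tells apart the legs at one vertex on the side of the spider.\<close>

definition attach_legs :: "(nat \<times> nat \<times> nat) list \<Rightarrow> nat graph \<Rightarrow> nat graph" where
  "attach_legs ts C = fold (\<lambda>(x, k, r). attach_path x r) ts C"

lemma attach_path_0 [simp]: "attach_path x 0 K = K"
  by (simp add: attach_path_def)

lemma attach_path_Suc:
  fixes x r K
  defines "w \<equiv> \<lambda>i. if i = 0 then x else Max (verts K) + i"
  shows "attach_path x (Suc r) K = add_leaf (attach_path x r K) (w r) (w (Suc r))"
proof -
  have "w ` {1..Suc r} = insert (w (Suc r)) (w ` {1..r})" by (simp add: atLeastAtMostSuc_conv)
  moreover have "{{w i, w (Suc i)} |i. i < Suc r} = insert {w r, w (Suc r)} {{w i, w (Suc i)} |i. i < r}"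
    by (auto simp: less_Suc_eq)
  ultimately show ?thesis unfolding attach_path_def add_leaf_def w_def[symmetric] Let_def by simp
qed

lemma verts_attach_path:
  "verts (attach_path x r K) = verts K \<union> (\<lambda>i. if i = 0 then x else Max (verts K) + i) ` {1..r}"
  by (simp add: attach_path_def Let_def)

lemma attach_path_new:
  assumes "finite (verts K)" "verts K \<noteq> {}"
  shows "Max (verts K) + Suc r \<notin> verts (attach_path x r K)"
  using assms by (auto simp: verts_attach_path dest: Max_ge)

lemma simple_add_leaf:
  assumes "simple_graph G" "u \<in> verts G" "w \<notin> verts G"
  shows "simple_graph (add_leaf G u w)"
proof -
  have "u \<noteq> w" using assms by auto
  then show ?thesis using assms by (auto simp: simple_graph_def)
qed

lemma simple_attach_path:
  assumes "simple_graph K" "x \<in> verts K"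
  shows "simple_graph (attach_path x r K)"
proof (induction r)
  case (Suc r)
  have "finite (verts K)" "verts K \<noteq> {}" using assms by (auto simp: simple_graph_def)
  then show ?case
    unfolding attach_path_Suc using Suc assms attach_path_new[of K r x]
    by (intro simple_add_leaf) (auto simp: verts_attach_path)
qed (use assms in simp)

text \<open>Core vertices keep their labels under the isomorphism, so that a later
  \<open>attach_path\<close> at \<open>x\<close> acts on the image of
  \<open>(x, 0, 0)\<close>.\<close>

definition core_iso :: "nat graph \<Rightarrow> (nat \<Rightarrow> nat \<Rightarrow> nat) \<Rightarrow> nat graph \<Rightarrow> bool" where
  "core_iso C l K \<longleftrightarrow> (\<exists>f. bij_betw f (verts (spider C l)) (verts K) \<and>
     (\<forall>u\<in>verts (spider C l). \<forall>v\<in>verts (spider C l). adj (spider C l) u v \<longleftrightarrow> adj K (f u) (f v)) \<and>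
     (\<forall>x\<in>verts C. f (x, 0, 0) = x))"

lemma core_iso_no_legs: "core_iso C (\<lambda>_ _. 0) C"
  unfolding core_iso_def using spider_no_legs by (intro exI[of _ fst]) simp

lemma core_iso_attach:
  assumes C: "simple_graph C" and l: "finite_legs C l" "l x k = 0" and x: "x \<in> verts C"
    and K: "simple_graph K" "x \<in> verts K" and iso: "core_iso C l K"
  shows "core_iso C (l(x := (l x)(k := r))) (attach_path x r K)"
proof -
  define w where "w = (\<lambda>i. if i = 0 then x else Max (verts K) + i)"
  let ?l = "\<lambda>r. l(x := (l x)(k := r))"
  have K': "finite (verts K)" "verts K \<noteq> {}" using K by (auto simp: simple_graph_def)
  \<comment> \<open>The induction also records that the vertex at depth \<open>i\<close> of the
    growing leg goes to \<open>w i\<close>; otherwise the next leaf could not be matched.\<close>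
  have "\<exists>f. bij_betw f (verts (spider C (?l r))) (verts (attach_path x r K)) \<and>
     (\<forall>u\<in>verts (spider C (?l r)). \<forall>v\<in>verts (spider C (?l r)). adj (spider C (?l r)) u v \<longleftrightarrow> adj (attach_path x r K) (f u) (f v)) \<and>
     (\<forall>y\<in>verts C. f (y, 0, 0) = y) \<and> (\<forall>i\<le>r. f (node x k i) = w i)"
  proof (induction r)
    case 0
    have "(l x)(k := 0) = l x" using l(2) by (simp add: fun_upd_idem)
    then have l0: "?l 0 = l" by simp
    show ?case unfolding l0 using iso x by (auto simp: core_iso_def node_def w_def)
  next
    case (Suc r)
    then obtain f where f: "bij_betw f (verts (spider C (?l r))) (verts (attach_path x r K))"
      "\<forall>u\<in>verts (spider C (?l r)). \<forall>v\<in>verts (spider C (?l r)). adj (spider C (?l r)) u v \<longleftrightarrow> adj (attach_path x r K) (f u) (f v)"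
      "\<forall>y\<in>verts C. f (y, 0, 0) = y" "\<forall>i\<le>r. f (node x k i) = w i" by blast
    have "{k'. 0 < ?l r y k'} \<subseteq> insert k {k. 0 < l y k}" for y by auto
    then have "finite_legs C (?l r)" using l(1) unfolding finite_legs_def by (meson finite_insert finite_subset)
    then have S: "simple_graph (spider C (?l r))" by (rule simple_spider[OF C])
    have u: "node x k r \<in> verts (spider C (?l r))" using x by (intro node_in_spider) auto
    have new: "node x k (Suc r) \<notin> verts (spider C (?l r))" using node_new[of x k "?l r" C] by simp
    have new': "w (Suc r) \<notin> verts (attach_path x r K)" using attach_path_new[OF K'] by (simp add: w_def)
    have ext: "spider C (?l (Suc r)) = add_leaf (spider C (?l r)) (node x k r) (node x k (Suc r))"
      using spider_extend[OF x, of "?l r" k] by simp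
    have att: "attach_path x (Suc r) K = add_leaf (attach_path x r K) (f (node x k r)) (w (Suc r))"
      using attach_path_Suc[of x r K] f(4) by (simp add: w_def)
    let ?f = "f(node x k (Suc r) := w (Suc r))"
    have "\<forall>y\<in>verts C. ?f (y, 0, 0) = y" using f(3) by (simp add: node_def)
    moreover have "\<forall>i\<le>Suc r. ?f (node x k i) = w i" using f(4) by (auto simp: node_def le_Suc_eq)
    ultimately show ?case
      using add_leaf_iso_fun[OF S simple_attach_path[OF K] f(1,2) u new new']
      unfolding ext att by blast
  qed
  then show ?thesis unfolding core_iso_def by blast
qed

lemma legs_append: "legs (ts @ [(x, k, r)]) = (legs ts)(x := (legs ts x)(k := legs ts x k + r))"
  by (intro ext) (auto simp: legs_def)

lemma legs_0: "(x, k) \<notin> (\<lambda>(x, k, r). (x, k)) ` set ts \<Longrightarrow> legs ts x k = 0"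
  by (force simp: legs_def sum_list_eq_0_iff split: if_splits)

lemma finite_legs_legs: "finite_legs C (legs ts)"
proof -
  have "{k. 0 < legs ts x k} \<subseteq> (\<lambda>(x, k, r). k) ` set ts" for x
    using legs_0[of x _ ts] by force
  then show ?thesis unfolding finite_legs_def by (meson finite_imageI finite_set finite_subset)
qed

lemma attach_legs_props:
  assumes "simple_graph C" "\<forall>(x, k, r)\<in>set ts. x \<in> verts C"
  shows "simple_graph (attach_legs ts C) \<and> verts C \<subseteq> verts (attach_legs ts C)"
  using assms(2)
proof (induction ts rule: rev_induct)
  case (snoc t ts)
  obtain x k r where t: "t = (x, k, r)" by (cases t)
  then show ?case using snoc simple_attach_path[of "attach_legs ts C" x r]
    by (auto simp: attach_legs_def verts_attach_path)
qed (use assms in \<open>simp add: attach_legs_def\<close>)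

lemma core_iso_attach_legs:
  assumes C: "simple_graph C" and ts: "\<forall>(x, k, r)\<in>set ts. x \<in> verts C"
    "distinct (map (\<lambda>(x, k, r). (x, k)) ts)"
  shows "core_iso C (legs ts) (attach_legs ts C)"
  using ts
proof (induction ts rule: rev_induct)
  case Nil
  then show ?case using core_iso_no_legs[of C] by (simp add: legs_def attach_legs_def)
next
  case (snoc t ts)
  obtain x k r where t: "t = (x, k, r)" by (cases t)
  have "(x, k) \<notin> (\<lambda>(x, k, r). (x, k)) ` set ts" using snoc.prems t by auto
  then have "legs ts x k = 0" by (rule legs_0)
  moreover have "x \<in> verts C" using snoc.prems t by simp
  moreover have "simple_graph (attach_legs ts C)" "x \<in> verts (attach_legs ts C)"
    using attach_legs_props[OF C, of ts] snoc.prems t by auto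
  moreover have "attach_legs (ts @ [t]) C = attach_path x r (attach_legs ts C)"
    by (simp add: attach_legs_def t)
  moreover have "core_iso C (legs ts) (attach_legs ts C)" using snoc by auto
  moreover have "legs (ts @ [t]) = (legs ts)(x := (legs ts x)(k := r))"
    unfolding t legs_append \<open>legs ts x k = 0\<close> by simp
  ultimately show ?case
    using core_iso_attach[OF C finite_legs_legs, of ts x k "attach_legs ts C" r] by metis
qed

lemma spider_iso_attach_legs:
  assumes C: "simple_graph C" and ts: "\<forall>(x, k, r)\<in>set ts. x \<in> verts C"
    "distinct (map (\<lambda>(x, k, r). (x, k)) ts)" and l: "\<And>x k. x \<in> verts C \<Longrightarrow> l x k = legs ts x k"
  shows "graph_iso (spider C l) (attach_legs ts C)"
proof -
  have "graph_iso (spider C (legs ts)) (attach_legs ts C)"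
    using core_iso_attach_legs[OF C ts] unfolding core_iso_def graph_iso_def by blast
  then show ?thesis using spider_cong[of C l "legs ts"] l by simp
qed

lemma attach_legs_edges:
  "length ks = n \<Longrightarrow> attach_legs (map (\<lambda>k. (x, k, 1)) ks) C = attach_edges x n C"
  by (induction ks arbitrary: n rule: rev_induct) (auto simp: attach_legs_def attach_edges_def)

lemma legs_Cons: "legs ((x, k, r) # ts) y m = (if y = x \<and> m = k then r else 0) + legs ts y m"
  and legs_Nil: "legs [] y m = 0"
  by (auto simp: legs_def)

section \<open>Sorting good spiders into the list\<close>

definition listed :: "'a graph \<Rightarrow> bool" where
  "listed G \<longleftrightarrow> (\<exists>B \<in> {B1, B2, B3, B4, B5, B6, B7}. graph_iso G B)
    \<or> (\<exists>s h1 h2 h3 h4. graph_iso G (B_paths s h1 h2 h3 h4))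
    \<or> (\<exists>t. graph_iso G (B_inf t)) \<or> (\<exists>k. graph_iso G (B_theta k))"

lemma listed_iso: "graph_iso G H \<Longrightarrow> listed H \<Longrightarrow> listed G"
  unfolding listed_def using graph_iso_trans by blast

lemma listed_automorphism:
  assumes "simple_graph C" "core_automorphism C r" "listed (spider C (\<lambda>x. l (r x)))"
  shows "listed (spider C l)"
  using listed_iso[OF graph_iso_sym[OF graph_iso_spider_automorphism[OF assms(1,2)]] assms(3)] .

lemma attach_edges_numeral:
  "attach_edges x (Suc 0) C = attach_path x (Suc 0) C" "attach_edges x 1 C = attach_path x 1 C"
  "attach_edges x 2 C = attach_path x 1 (attach_path x 1 C)"
  by (simp_all add: attach_edges_def numeral_2_eq_2)

lemma attach_legs_simps:
  "attach_legs [] C = C" "attach_legs ((x, k, r) # ts) C = attach_legs ts (attach_path x r C)"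
  by (simp_all add: attach_legs_def)

text \<open>With at most one leg at each outer vertex the graph is a \<open>B_paths\<close>. Two
  legs at one outer vertex force \<open>s = 1\<close>; then the tables leave room only for these two
  legs, of length one, which is \<open>B1\<close>.\<close>

lemma listed_infinity_path_free:
  assumes l: "good_spider (infinity_graph s) l" and free: "\<And>m k. m \<le> s \<Longrightarrow> l m k = 0"
  shows "listed (spider (infinity_graph s) l)"
proof (cases "\<exists>x\<in>{s + 1, s + 2, s + 3, s + 4}. \<exists>k k'. k \<noteq> k' \<and> l x k > 0 \<and> l x k' > 0")
  case False
  then have "\<forall>x\<in>{s + 1, s + 2, s + 3, s + 4}. \<exists>k. \<forall>m. m \<noteq> k \<longrightarrow> l x m = 0" by (metis gr0I)
  then obtain k where k: "\<And>x m. x \<in> {s + 1, s + 2, s + 3, s + 4} \<Longrightarrow> m \<noteq> k x \<Longrightarrow> l x m = 0" by metis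
  let ?t = "\<lambda>x. (x, k x, l x (k x))"
  let ?ts = "[?t (s + 1), ?t (s + 2), ?t (s + 3), ?t (s + 4)]"
  have "graph_iso (spider (infinity_graph s) l) (attach_legs ?ts (infinity_graph s))"
  proof (rule spider_iso_attach_legs[OF simple_infinity_graph])
    fix x m assume "x \<in> verts (infinity_graph s)"
    then consider "x \<le> s" | "x \<in> {s + 1, s + 2, s + 3, s + 4}" by (force simp: verts_infinity_graph)
    then show "l x m = legs ?ts x m"
      using free[of x m] k[of x m] by cases (auto simp: legs_Cons legs_Nil)
  qed (auto simp: verts_infinity_graph)
  moreover have "attach_legs ?ts (infinity_graph s) =
      B_paths s (l (s + 1) (k (s + 1))) (l (s + 2) (k (s + 2))) (l (s + 3) (k (s + 3))) (l (s + 4) (k (s + 4)))"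
    by (simp add: B_paths_def attach_legs_simps)
  ultimately show ?thesis unfolding listed_def by metis
next
  case True
  then obtain x k m where x: "x \<in> {s + 1, s + 2, s + 3, s + 4}" "k \<noteq> m" "l x k > 0" "l x m > 0" by blast
  obtain r where r: "core_automorphism (infinity_graph s) r" "r (s + 1) = x" "\<And>m. m \<le> s \<Longrightarrow> r m \<le> s"
    using infinity_automorphism_to[OF x(1)] by metis
  define l' where "l' = (\<lambda>x. l (r x))"
  have l': "good_spider (infinity_graph s) l'"
    unfolding l'_def by (rule good_spider_automorphism[OF simple_infinity_graph r(1) l])
  have free': "l' y j = 0" if "y \<le> s" for y j using free r(3) that by (simp add: l'_def)
  have km: "l' (s + 1) k > 0" "l' (s + 1) m > 0" using x r by (simp_all add: l'_def)
  have s: "s = 1" using infinity_double_leg[OF l' km x(2)] .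
  have good: "conn_graph (spider (infinity_graph 1) l')" "good (spider (infinity_graph 1) l')"
    using l' s by (auto simp: good_spider_def)
  have km: "l' 2 k > 0" "l' 2 m > 0" using km s by (simp_all add: numeral_2_eq_2)
  have "\<not> l' 2 k \<ge> 2" "\<not> l' 2 m \<ge> 2"
    using km double_leg_excluded[OF good, of k m] double_leg_excluded[OF good, of m k] x(2) by auto
  then have km: "l' 2 k = 1" "l' 2 m = 1" using km by linarith+
  have "l' 2 j = 0" if "j \<noteq> k" "j \<noteq> m" for j
    using three_legs_excluded[OF good, of k m j] km that x(2) by auto
  moreover have "l' 3 j = 0" for j
    using double_sibling_excluded[OF good, of k m j] km x(2) by auto
  moreover have "l' 4 j = 0" for j
    using double_opposite_excluded[OF good, of k m j] km x(2) by auto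
  moreover have "l' 5 j = 0" for j
  proof -
    have "core_automorphism (infinity_graph 1) (swap 4 5)" using core_automorphism_infinity(2)[of 1] by simp
    then have "good_spider (infinity_graph 1) (\<lambda>x. l' (swap 4 5 x))"
      using good_spider_automorphism[OF simple_infinity_graph _ l'] s by simp
    then show ?thesis
      using double_opposite_excluded[of "\<lambda>x. l' (swap 4 5 x)" k m j] km x(2)
      by (auto simp: good_spider_def swap_def)
  qed
  moreover have "l' 0 j = 0" "l' 1 j = 0" for j using free' s by auto
  ultimately have z: "l' y j = legs [(2, k, 1), (2, m, 1)] y j" if "y \<le> 5" for y j
    using that km x(2) by (auto simp: legs_Cons legs_Nil numeral_eq_Suc le_Suc_eq)
  have "graph_iso (spider (infinity_graph 1) l') (attach_legs [(2, k, 1), (2, m, 1)] (infinity_graph 1))"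
    by (rule spider_iso_attach_legs[OF simple_infinity_graph]) (use z x(2) in \<open>auto simp: verts_infinity_graph\<close>)
  then have "listed (spider (infinity_graph s) l')"
    unfolding listed_def by (simp add: s B1_def attach_legs_simps attach_edges_numeral)
  then show ?thesis
    unfolding l'_def by (rule listed_automorphism[OF simple_infinity_graph r(1)])
qed


text \<open>Leaves at one vertex may carry arbitrary indices; only their number survives in
  \<open>attach_edges\<close>.\<close>

lemma spider_iso_attach_edges:
  assumes C: "simple_graph C" and x: "x \<in> verts C" and fin: "finite_legs C l"
    and one: "\<And>k. l x k \<le> 1" and zero: "\<And>y k. y \<in> verts C \<Longrightarrow> y \<noteq> x \<Longrightarrow> l y k = 0"
  shows "graph_iso (spider C l) (attach_edges x (card {k. 0 < l x k}) C)"
proof -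
  let ?K = "{k. 0 < l x k}"
  have finK: "finite ?K" using fin x by (simp add: finite_legs_def)
  define ks where "ks = sorted_list_of_set ?K"
  have ks: "distinct ks" "set ks = ?K" "length ks = card ?K" using finK by (auto simp: ks_def)
  have legs: "legs (map (\<lambda>k. (x, k, 1)) ks) y m = (if y = x \<and> m \<in> set ks then 1 else 0)" for y m
    using ks(1) by (induction ks) (auto simp: legs_Cons legs_Nil)
  have "graph_iso (spider C l) (attach_legs (map (\<lambda>k. (x, k, 1)) ks) C)"
  proof (rule spider_iso_attach_legs[OF C])
    show "distinct (map (\<lambda>(x, k, r). (x, k)) (map (\<lambda>k. (x, k, 1)) ks))"
      using ks(1) by (simp add: distinct_map inj_on_def)
    fix y m assume y: "y \<in> verts C"
    show "l y m = legs (map (\<lambda>k. (x, k, 1)) ks) y m"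
      unfolding legs using one[of m] zero[OF y, of m] ks(2) by auto
  qed (use x in auto)
  then show ?thesis using attach_legs_edges[OF ks(3)] by simp
qed

text \<open>Leaves at the centre alone give \<open>B_inf\<close>. As soon as an outer vertex carries
  a leg, the centre has just one leaf, no further leg exists and the outer one has length 1 or 2,
  which gives \<open>B5\<close> or \<open>B4\<close>.\<close>

lemma listed_infinity_0:
  assumes l: "good_spider (infinity_graph 0) l" and k: "l 0 k > 0"
  shows "listed (spider (infinity_graph 0) l)"
proof (cases "\<exists>x\<in>{1, 2, 3, 4}. \<exists>j. l x j > 0")
  case False
  have "graph_iso (spider (infinity_graph 0) l) (attach_edges 0 (card {k. 0 < l 0 k}) (infinity_graph 0))"
  proof (rule spider_iso_attach_edges[OF simple_infinity_graph])
    show "l 0 k \<le> 1" for k using infinity_path_leg(2)[OF l, of 0 k] by (cases "l 0 k = 0") auto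
    fix y k assume "y \<in> verts (infinity_graph 0)" "y \<noteq> 0"
    then have "y \<in> {1, 2, 3, 4}" by (auto simp: verts_infinity_graph)
    then show "l y k = 0" using False by auto
  qed (use l in \<open>auto simp: verts_infinity_graph good_spider_def\<close>)
  then show ?thesis unfolding listed_def B_inf_def by blast
next
  case True
  then obtain x j where "x \<in> {1, 2, 3, 4}" "l x j > 0" by blast
  then have x: "x \<in> {0 + 1, 0 + 2, 0 + 3, 0 + 4}" "l x j > 0" by auto
  obtain r where r: "core_automorphism (infinity_graph 0) r" "r (0 + 1) = x" "\<And>m. m \<le> 0 \<Longrightarrow> r m \<le> 0"
    using infinity_automorphism_to[OF x(1)] by metis
  define l' where "l' = (\<lambda>x. l (r x))"
  have l': "good_spider (infinity_graph 0) l'"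
    unfolding l'_def by (rule good_spider_automorphism[OF simple_infinity_graph r(1) l])
  then have good: "conn_graph (spider (infinity_graph 0) l')" "good (spider (infinity_graph 0) l')"
    by (auto simp: good_spider_def)
  have k0: "l' 0 k > 0" and j: "l' 1 j > 0" using k x r by (simp_all add: l'_def)
  have k1: "l' 0 k = 1" using infinity_path_leg(2)[OF l' _ k0] by simp
  have "l' 0 m = 0" if "m \<noteq> k" for m
    using two_center_excluded[OF good, of k m j] k0 j that by auto
  moreover have "l' 1 m = 0" if "m \<noteq> j" for m
    using infinity_double_leg[OF l', of j m] j that by auto
  moreover have "l' 2 m = 0" for m
    using center_siblings_excluded[OF good, of k j m] k0 j by auto
  moreover have "l' 3 m = 0" for m
    using center_opposite_excluded[OF good, of k j m] k0 j by auto
  moreover have "l' 4 m = 0" for m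
  proof -
    have "core_automorphism (infinity_graph 0) (swap 3 4)" using core_automorphism_infinity(2)[of 0] by simp
    then have "good_spider (infinity_graph 0) (\<lambda>x. l' (swap 3 4 x))"
      using good_spider_automorphism[OF simple_infinity_graph _ l'] by simp
    then show ?thesis
      using center_opposite_excluded[of "\<lambda>x. l' (swap 3 4 x)" k j m] k0 j
      by (auto simp: good_spider_def swap_def)
  qed
  moreover define h where "h = l' 1 j"
  ultimately have z: "l' y m = legs [(0, k, 1), (1, j, h)] y m" if "y \<le> 4" for y m
    using that k1 by (auto simp: legs_Cons legs_Nil numeral_eq_Suc le_Suc_eq)
  have iso: "graph_iso (spider (infinity_graph 0) l') (attach_legs [(0, k, 1), (1, j, h)] (infinity_graph 0))"
    by (rule spider_iso_attach_legs[OF simple_infinity_graph]) (use z in \<open>auto simp: verts_infinity_graph\<close>)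
  have "\<not> l' 1 j \<ge> 3" using center_long_excluded[OF good, of k j] k0 by auto
  then have "h = 1 \<or> h = 2" using j by (auto simp: h_def)
  then have "listed (spider (infinity_graph 0) l')"
    using iso unfolding listed_def by (auto simp: B5_def B4_def attach_legs_simps attach_edges_numeral)
  then show ?thesis
    unfolding l'_def by (rule listed_automorphism[OF simple_infinity_graph r(1)])
qed

text \<open>A leaf at one end of the path rules out all legs except a single leaf at the other end,
  which leaves \<open>B3\<close> and \<open>B2\<close>.\<close>

lemma listed_infinity_2:
  assumes l: "good_spider (infinity_graph 2) l" and k: "l 0 k > 0"
  shows "listed (spider (infinity_graph 2) l)"
proof -
  have good: "conn_graph (spider (infinity_graph 2) l)" "good (spider (infinity_graph 2) l)"
    using l by (auto simp: good_spider_def)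
  have auto: "conn_graph (spider (infinity_graph 2) (\<lambda>x. l (r x)))" "good (spider (infinity_graph 2) (\<lambda>x. l (r x)))"
    if "core_automorphism (infinity_graph 2) r" for r
    using good_spider_automorphism[OF simple_infinity_graph that l] by (auto simp: good_spider_def)
  have a: "core_automorphism (infinity_graph 2) (swap 3 4)" "core_automorphism (infinity_graph 2) (swap 5 6)"
    "core_automorphism (infinity_graph 2) (reflect 2)"
    using core_automorphism_infinity[of 2] by simp_all
  have k1: "l 0 k = 1" using infinity_path_leg(2)[OF l _ k] by simp
  have p0: "l 0 m = 0" if "m \<noteq> k" for m using left_double_excluded[OF good, of k m] k that by auto
  have p1: "l 1 m = 0" for m using infinity_path_leg(1)[OF l, of 1 m] by auto
  have p3: "l 3 m = 0" for m using left_near_excluded[OF good, of k m] k by auto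
  have p4: "l 4 m = 0" for m
    using left_near_excluded[OF auto[OF a(1)], of k m] k by (auto simp: swap_def)
  have p5: "l 5 m = 0" for m using left_far_excluded[OF good, of k m] k by auto
  have p6: "l 6 m = 0" for m
    using left_far_excluded[OF auto[OF a(2)], of k m] k by (auto simp: swap_def)
  note p = p0 p1 p3 p4 p5 p6
  show ?thesis
  proof (cases "\<exists>j. l 2 j > 0")
    case False
    then have z: "l y m = legs [(0, k, 1)] y m" if "y \<le> 6" for y m
      using that k1 p by (auto simp: legs_Cons legs_Nil numeral_eq_Suc le_Suc_eq)
    have "graph_iso (spider (infinity_graph 2) l) (attach_legs [(0, k, 1)] (infinity_graph 2))"
      by (rule spider_iso_attach_legs[OF simple_infinity_graph]) (use z in \<open>auto simp: verts_infinity_graph\<close>)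
    then show ?thesis
      unfolding listed_def by (auto simp: B3_def attach_legs_simps attach_edges_numeral)
  next
    case True
    then obtain j where j: "l 2 j > 0" by blast
    have "l 2 j = 1" using infinity_path_leg(2)[OF l _ j] by simp
    moreover have "l 2 m = 0" if "m \<noteq> j" for m
      using left_double_excluded[OF auto[OF a(3)], of j m] j that by (auto simp: reflect_def)
    ultimately have z: "l y m = legs [(0, k, 1), (2, j, 1)] y m" if "y \<le> 6" for y m
      using that k1 p by (auto simp: legs_Cons legs_Nil numeral_eq_Suc le_Suc_eq)
    have "graph_iso (spider (infinity_graph 2) l) (attach_legs [(0, k, 1), (2, j, 1)] (infinity_graph 2))"
      by (rule spider_iso_attach_legs[OF simple_infinity_graph]) (use z in \<open>auto simp: verts_infinity_graph\<close>)
    then show ?thesis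
      unfolding listed_def by (auto simp: B2_def attach_legs_simps attach_edges_numeral)
  qed
qed

lemma listed_infinity:
  assumes l: "good_spider (infinity_graph s) l"
  shows "listed (spider (infinity_graph s) l)"
proof (cases "\<exists>m\<le>s. \<exists>k. l m k > 0")
  case False
  then show ?thesis by (intro listed_infinity_path_free[OF l]) auto
next
  case True
  then obtain m k where m: "m \<le> s" "l m k > 0" by blast
  from infinity_path_leg(1)[OF l m] consider "s = 0" "m = 0" | "s = 2" "m = 0" | "s = 2" "m = 2" by auto
  then show ?thesis
  proof cases
    case 1
    then show ?thesis using listed_infinity_0[of l k] l m by simp
  next
    case 2
    then show ?thesis using listed_infinity_2[of l k] l m by simp
  next
    case 3
    have "good_spider (infinity_graph 2) (\<lambda>x. l (reflect 2 x))"
      using good_spider_automorphism[OF simple_infinity_graph core_automorphism_infinity(3)] l 3 by simp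
    then have "listed (spider (infinity_graph 2) (\<lambda>x. l (reflect 2 x)))"
      using listed_infinity_2[of "\<lambda>x. l (reflect 2 x)" k] m 3 by (simp add: reflect_def)
    then show ?thesis
      using listed_automorphism[OF simple_infinity_graph core_automorphism_infinity(3)] 3 by simp
  qed
qed

text \<open>All legs are single leaves at 0 and 1. Leaves at one of the two vertices only give
  \<open>B_theta\<close>; if both carry leaves, the patterns two-two and three-one are excluded, so
  one vertex has a single leaf and the other one or two, giving \<open>B6\<close> and
  \<open>B7\<close>.\<close>

lemma listed_theta:
  assumes l: "good_spider theta_graph l"
  shows "listed (spider theta_graph l)"
proof -
  have B: "listed (spider theta_graph l)" if l: "good_spider theta_graph l" and none: "\<And>k. l 1 k = 0" for l
  proof -
    have "graph_iso (spider theta_graph l) (attach_edges 0 (card {k. 0 < l 0 k}) theta_graph)"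
    proof (rule spider_iso_attach_edges[OF simple_theta_graph])
      show "l 0 k \<le> 1" for k using theta_leg(2)[OF l, of 0 k] by (cases "l 0 k = 0") auto
      fix y k assume "y \<in> verts theta_graph" "y \<noteq> 0"
      then show "l y k = 0" using theta_leg(1)[OF l, of y k] none by (cases "y = 1") (auto simp: verts_theta_graph)
    qed (use l in \<open>auto simp: verts_theta_graph good_spider_def\<close>)
    then show ?thesis unfolding listed_def B_theta_def by blast
  qed
  have B': "listed (spider theta_graph l)"
    if l: "good_spider theta_graph l" and j: "l 1 j > 0" "\<And>m. m \<noteq> j \<Longrightarrow> l 1 m = 0" and k: "l 0 k > 0" for l j k
  proof -
    have good: "conn_graph (spider theta_graph l)" "good (spider theta_graph l)"
      using l by (auto simp: good_spider_def)
    have one: "l x m = 1" if "x < 4" "l x m > 0" for x m using theta_leg(2)[OF l that] .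
    have zero: "l x m = 0" if "x < 4" "x \<ge> 2" for x m using theta_leg(1)[OF l that(1), of m] that by auto
    show ?thesis
    proof (cases "\<exists>m. m \<noteq> k \<and> l 0 m > 0")
      case False
      then have z: "l y m = legs [(0, k, 1), (1, j, 1)] y m" if "y < 4" for y m
        using that one[of 0 k] one[of 1 j] zero[of y m] j k
        by (cases "y = 0"; cases "y = 1") (auto simp: legs_Cons legs_Nil)
      have "graph_iso (spider theta_graph l) (attach_legs [(0, k, 1), (1, j, 1)] theta_graph)"
        by (rule spider_iso_attach_legs[OF simple_theta_graph]) (use z in \<open>auto simp: verts_theta_graph\<close>)
      then show ?thesis
        unfolding listed_def by (auto simp: B6_def attach_legs_simps attach_edges_numeral)
    next
      case True
      then obtain m where m: "m \<noteq> k" "l 0 m > 0" by blast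
      have "l 0 i = 0" if "i \<noteq> k" "i \<noteq> m" for i
        using theta_three_one_excluded[OF good, of k m i j] j k m that by auto
      then have z: "l y i = legs [(0, k, 1), (0, m, 1), (1, j, 1)] y i" if "y < 4" for y i
        using that one[of 0 k] one[of 0 m] one[of 1 j] zero[of y i] j k m
        by (cases "y = 0"; cases "y = 1") (auto simp: legs_Cons legs_Nil)
      have "graph_iso (spider theta_graph l) (attach_legs [(0, k, 1), (0, m, 1), (1, j, 1)] theta_graph)"
        by (rule spider_iso_attach_legs[OF simple_theta_graph]) (use z m in \<open>auto simp: verts_theta_graph\<close>)
      then show ?thesis
        unfolding listed_def by (auto simp: B7_def attach_legs_simps attach_edges_numeral)
    qed
  qed
  let ?l = "\<lambda>x. l (swap 0 1 x)"
  have l': "good_spider theta_graph ?l"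
    using good_spider_automorphism[OF simple_theta_graph core_automorphism_theta(2) l] .
  have unswap: "listed (spider theta_graph ?l) \<Longrightarrow> listed (spider theta_graph l)"
    by (rule listed_automorphism[OF simple_theta_graph core_automorphism_theta(2)])
  have sw: "?l 0 = l 1" "?l 1 = l 0" by (simp_all add: swap_def)
  show ?thesis
  proof (cases "(\<forall>k. l 1 k = 0) \<or> (\<forall>k. l 0 k = 0)")
    case True
    then show ?thesis using B[OF l] B[OF l'] unswap sw by auto
  next
    case False
    then obtain j k where jk: "l 1 j > 0" "l 0 k > 0" by auto
    show ?thesis
    proof (cases "\<exists>m. m \<noteq> j \<and> l 1 m > 0")
      case False
      then show ?thesis using B'[OF l jk(1) _ jk(2)] by auto
    next
      case True
      then obtain m where m: "m \<noteq> j" "l 1 m > 0" by blast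
      have good: "conn_graph (spider theta_graph l)" "good (spider theta_graph l)"
        using l by (auto simp: good_spider_def)
      have "l 0 i = 0" if "i \<noteq> k" for i
        using theta_two_two_excluded[OF good, of k i j m] jk m that by auto
      then have "listed (spider theta_graph ?l)"
        using B'[OF l', of k j] jk sw by simp
      then show ?thesis by (rule unswap)
    qed
  qed
qed

section \<open>Goodness of the listed graphs\<close>

text \<open>Used to compensate for a deleted block by extra weight on the vertex where it was
  attached, which brings the remaining vector back to the hyperplane of the smaller graph.\<close>

lemma qform_add_point:
  assumes "finite V" "u \<in> V" "d u u = 0" "\<And>v. v \<in> V \<Longrightarrow> d v u = d u v"
  shows "qform d V (y(u := y u + c)) = qform d V y + 2 * c * (\<Sum>v\<in>V. d u v * y v) + ((y u + c)\<^sup>2 - (y u)\<^sup>2) / 2"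
proof -
  let ?S = "V - {u}"
  have V: "V = insert u ?S" using assms(2) by blast
  have q: "qform d (insert u ?S) x = qform d ?S x + 2 * x u * (\<Sum>v\<in>?S. d u v * x v) + (x u)\<^sup>2 / 2" for x
    by (rule qform_insert) (auto simp: assms(1,3) intro: assms(4))
  have "qform d ?S (y(u := y u + c)) = qform d ?S y" by (rule qform_cong) auto
  moreover have "(\<Sum>v\<in>?S. d u v * (y(u := y u + c)) v) = (\<Sum>v\<in>?S. d u v * y v)" by (rule sum.cong) auto
  moreover have "(\<Sum>v\<in>V. d u v * y v) = (\<Sum>v\<in>?S. d u v * y v)"
    using sum.remove[OF assms(1,2), of "\<lambda>v. d u v * y v"] assms(3) by simp
  ultimately show ?thesis
    using q[of y] q[of "y(u := y u + c)"] unfolding V[symmetric] by (simp add: field_simps)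
qed

abbreviation rdist :: "'a graph \<Rightarrow> 'a \<Rightarrow> 'a \<Rightarrow> real" where
  "rdist G u v \<equiv> real (graph_dist G u v)"

text \<open>In a block graph the distance form on vectors of sum zero is minus a sum of squares, one for
  each pair of a block and one of its vertices. The vertices in \<open>I\<close> lie in a single block, so a
  vertex on a new block may still be hung on them.\<close>

definition block_bound :: "'a graph \<Rightarrow> 'a set \<Rightarrow> bool" where
  "block_bound G I \<longleftrightarrow> conn_graph G \<and> I \<subseteq> verts G \<and> (\<forall>x. sum x (verts G) = 0 \<longrightarrow>
     qform (rdist G) (verts G) x \<le> - (\<Sum>v\<in>I. (x v)\<^sup>2) / 2 \<and>
     ((\<exists>v\<in>verts G. x v \<noteq> 0) \<longrightarrow> qform (rdist G) (verts G) x < 0))"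

lemma block_bound_good: "block_bound G I \<Longrightarrow> good G"
  unfolding good_def neg_on_hyperplane_def block_bound_def
  by (intro exI[of _ "\<lambda>x. sum x (verts G)"])
    (auto simp: linear_functional_def sum.distrib sum_distrib_left)

lemma block_boundD:
  assumes "block_bound G I" "sum x (verts G) = 0"
  shows "qform (rdist G) (verts G) x \<le> - (\<Sum>v\<in>I. (x v)\<^sup>2) / 2"
    and "v \<in> verts G \<Longrightarrow> x v \<noteq> 0 \<Longrightarrow> qform (rdist G) (verts G) x < 0"
  using assms unfolding block_bound_def by blast+

lemma block_bound_finite: "block_bound G I \<Longrightarrow> finite I"
  unfolding block_bound_def using conn_graph.finite_V finite_subset by blast

lemma block_bound_mono:
  assumes "block_bound G I" "J \<subseteq> I"
  shows "block_bound G J"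
proof -
  have "finite I" using assms(1) by (rule block_bound_finite)
  then have le: "(\<Sum>v\<in>J. (x v)\<^sup>2) \<le> (\<Sum>v\<in>I. (x v)\<^sup>2)" for x :: "'a \<Rightarrow> real"
    using assms(2) by (intro sum_mono2) auto
  show ?thesis unfolding block_bound_def
  proof (intro conjI allI impI)
    fix x :: "'a \<Rightarrow> real" assume x: "sum x (verts G) = 0"
    show "qform (rdist G) (verts G) x \<le> - (\<Sum>v\<in>J. (x v)\<^sup>2) / 2"
      using block_boundD(1)[OF assms(1) x] le[of x] by simp
    show "qform (rdist G) (verts G) x < 0" if "\<exists>v\<in>verts G. x v \<noteq> 0"
      using block_boundD(2)[OF assms(1) x] that by blast
  qed (use assms in \<open>auto simp: block_bound_def\<close>)
qed

text \<open>\<open>q\<close> is the form after hanging a block of total weight \<open>c\<close> at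
  \<open>u\<close>, apart from the squares of its new vertices. It is the same expression for an
  edge and for a triangle. The square at \<open>u\<close> in the bound for the old graph is spent in
  the estimate, which is why \<open>u\<close> leaves \<open>I\<close>.\<close>

lemma block_bound_attach:
  assumes G: "block_bound G I" and u: "u \<in> I"
    and x: "sum x (verts G) = - c"
  defines "q \<equiv> qform (rdist G) (verts G) x + 2 * c * (\<Sum>v\<in>verts G. rdist G u v * x v) - c\<^sup>2"
  shows "q \<le> - (\<Sum>v\<in>I - {u}. (x v)\<^sup>2) / 2"
    and "c = 0 \<Longrightarrow> v \<in> verts G \<Longrightarrow> x v \<noteq> 0 \<Longrightarrow> q < 0"
proof -
  interpret conn_graph G using G by (simp add: block_bound_def)
  have I: "I \<subseteq> V" "finite I" using G finite_V finite_subset by (auto simp: block_bound_def)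
  have uV: "u \<in> V" using u I by auto
  \<comment> \<open>Moving the weight of the new block onto \<open>u\<close> restores total weight
    zero.\<close>
  let ?y = "x(u := x u + c)"
  have q: "qform (rdist G) V ?y = qform (rdist G) V x + 2 * c * (\<Sum>v\<in>V. rdist G u v * x v)
      + ((x u + c)\<^sup>2 - (x u)\<^sup>2) / 2"
    by (rule qform_add_point) (use uV finite_V dist_sym in auto)
  have "sum ?y V = sum ?y (V - {u}) + ?y u" using uV finite_V by (simp add: sum.remove)
  moreover have "sum ?y (V - {u}) = sum x (V - {u})" by (rule sum.cong) auto
  moreover have "sum x V = sum x (V - {u}) + x u" using uV finite_V by (simp add: sum.remove)
  ultimately have y0: "sum ?y V = 0" using x by simp
  have "(\<Sum>v\<in>I. (?y v)\<^sup>2) = (?y u)\<^sup>2 + (\<Sum>v\<in>I - {u}. (?y v)\<^sup>2)" using u I by (simp add: sum.remove)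
  also have "(\<Sum>v\<in>I - {u}. (?y v)\<^sup>2) = (\<Sum>v\<in>I - {u}. (x v)\<^sup>2)" by (rule sum.cong) auto
  finally have "qform (rdist G) V ?y \<le> - ((x u + c)\<^sup>2 + (\<Sum>v\<in>I - {u}. (x v)\<^sup>2)) / 2"
    using block_boundD(1)[OF G y0] by (simp only: fun_upd_same)
  moreover have "q = qform (rdist G) V ?y - (x u + c)\<^sup>2 / 2 + (x u)\<^sup>2 / 2 - c\<^sup>2"
    unfolding q q_def by (simp add: field_simps)
  \<comment> \<open>The difference of the two sides is half the square of
    \<open>x u + 2 * c\<close>, the square belonging to \<open>u\<close> as a vertex of the new
    block.\<close>
  moreover have "(x u)\<^sup>2 / 2 \<le> (x u + c)\<^sup>2 + c\<^sup>2"
  proof -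
    have "(x u + c)\<^sup>2 + c\<^sup>2 - (x u)\<^sup>2 / 2 = (x u + 2 * c)\<^sup>2 / 2" by (simp add: power2_eq_square field_simps)
    then show ?thesis by (smt (verit) zero_le_power2 divide_nonneg_nonneg)
  qed
  ultimately show "q \<le> - (\<Sum>v\<in>I - {u}. (x v)\<^sup>2) / 2" by simp
  show "q < 0" if "c = 0" "v \<in> V" "x v \<noteq> 0"
  proof -
    have "?y = x" using that by auto
    then show ?thesis using G x that by (auto simp: q_def block_bound_def)
  qed
qed

lemma block_bound_add_leaf:
  assumes G: "block_bound G I" and u: "u \<in> I" and w: "w \<notin> verts G"
  shows "block_bound (add_leaf G u w) (insert w (I - {u}))"
proof -
  interpret conn_graph G using G by (simp add: block_bound_def)
  have I: "I \<subseteq> V" "finite I" using G finite_V finite_subset by (auto simp: block_bound_def)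
  have uV: "u \<in> V" using u I by auto
  note L = add_leaf[OF uV w]
  let ?H = "add_leaf G u w"
  have main: "qform (rdist ?H) (verts ?H) x \<le> - (\<Sum>v\<in>insert w (I - {u}). (x v)\<^sup>2) / 2 \<and>
     ((\<exists>v\<in>verts ?H. x v \<noteq> 0) \<longrightarrow> qform (rdist ?H) (verts ?H) x < 0)" if "sum x (verts ?H) = 0" for x
  proof -
    let ?c = "x w"
    have sV: "sum x V = - ?c" using that w finite_V by simp
    have "qform (rdist ?H) (verts ?H) x = qform (rdist ?H) V x + 2 * x w * (\<Sum>v\<in>V. rdist ?H w v * x v) + (x w)\<^sup>2 / 2"
      unfolding verts_add_leaf by (rule qform_insert) (use finite_V w L uV in \<open>auto simp: dist_sym[OF uV]\<close>)
    also have "qform (rdist ?H) V x = qform (rdist G) V x" by (rule qform_cong) (use L in auto)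
    also have "(\<Sum>v\<in>V. rdist ?H w v * x v) = (\<Sum>v\<in>V. rdist G u v * x v) + sum x V"
      unfolding sum.distrib[symmetric] by (intro sum.cong refl) (simp add: L algebra_simps)
    finally have "qform (rdist ?H) (verts ?H) x
      = (qform (rdist G) V x + 2 * ?c * (\<Sum>v\<in>V. rdist G u v * x v) - ?c\<^sup>2) - ?c\<^sup>2 / 2"
      unfolding sV by (simp add: power2_eq_square field_simps)
    moreover define q where "q = qform (rdist G) V x + 2 * ?c * (\<Sum>v\<in>V. rdist G u v * x v) - ?c\<^sup>2"
    ultimately have qH: "qform (rdist ?H) (verts ?H) x = q - ?c\<^sup>2 / 2" by simp
    note b = block_bound_attach[OF G u sV, folded q_def]
    have "w \<notin> I - {u}" using I w by auto
    then have s: "(\<Sum>v\<in>insert w (I - {u}). (x v)\<^sup>2) = ?c\<^sup>2 + (\<Sum>v\<in>I - {u}. (x v)\<^sup>2)" using I by simp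
    have nn: "(\<Sum>v\<in>I - {u}. (x v)\<^sup>2) \<ge> 0" by (simp add: sum_nonneg)
    have "qform (rdist ?H) (verts ?H) x < 0" if v: "v \<in> verts ?H" "x v \<noteq> 0" for v
    proof (cases "?c = 0")
      case True
      then have "v \<in> V" using v by auto
      then show ?thesis using qH b(2)[OF True _ v(2)] True by simp
    next
      case False
      then have "?c\<^sup>2 > 0" by simp
      then show ?thesis using qH b(1) nn by linarith
    qed
    moreover have "qform (rdist ?H) (verts ?H) x \<le> - (?c\<^sup>2 + (\<Sum>v\<in>I - {u}. (x v)\<^sup>2)) / 2" using qH b(1) by (simp add: field_simps)
    ultimately show ?thesis unfolding s by blast
  qed
  show ?thesis unfolding block_bound_def using L(1) main I by auto
qed

definition add_triangle :: "'a graph \<Rightarrow> 'a \<Rightarrow> 'a \<Rightarrow> 'a \<Rightarrow> 'a graph" where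
  "add_triangle G u w w' = (insert w' (insert w (verts G)), insert {w, w'} (insert {u, w'} (insert {u, w} (edges G))))"

lemma (in conn_graph) add_triangle:
  assumes u: "u \<in> V" and w: "w \<notin> V" "w' \<notin> V" "w \<noteq> w'"
  defines "H \<equiv> add_triangle G u w w'"
  shows "conn_graph H" and "\<And>a b. a \<in> V \<Longrightarrow> b \<in> V \<Longrightarrow> graph_dist H a b = d a b"
    and "\<And>a. a \<in> V \<Longrightarrow> graph_dist H w a = Suc (d u a) \<and> graph_dist H a w = Suc (d u a)"
    and "\<And>a. a \<in> V \<Longrightarrow> graph_dist H w' a = Suc (d u a) \<and> graph_dist H a w' = Suc (d u a)"
    and "graph_dist H w w = 0" "graph_dist H w' w' = 0" "graph_dist H w w' = 1" "graph_dist H w' w = 1"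
proof -
  \<comment> \<open>\<open>p\<close> sends the new vertices to \<open>u\<close> and \<open>h\<close>
    is the distance to that projection, so all distances except those inside the new block have one
    formula.\<close>
  define p where "p a = (if a = w \<or> a = w' then u else a)" for a
  define h where "h a = (if a = w \<or> a = w' then 1 else 0 :: nat)" for a
  define f where "f a b = (if a = b then 0 else if h a = 1 \<and> h b = 1 then 1 else h a + d (p a) (p b) + h b)" for a b
  have HV: "verts H = insert w' (insert w V)" by (simp add: H_def add_triangle_def)
  have HE: "adj H a b \<longleftrightarrow> adj G a b \<or> {a, b} = {u, w} \<or> {a, b} = {u, w'} \<or> {a, b} = {w, w'}" for a b
    unfolding H_def add_triangle_def snd_conv insert_iff by argo
  have uw: "u \<noteq> w" "u \<noteq> w'" using u w by auto
  have s: "simple_graph H"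
    using simple u w uw by (auto simp: simple_graph_def H_def add_triangle_def)
  have V: "p a = a" "h a = 0" "a \<noteq> w" "a \<noteq> w'" if "a \<in> V" for a using that w by (auto simp: p_def h_def)
  have hw: "p w = u" "p w' = u" "h w = 1" "h w' = 1" by (simp_all add: p_def h_def)
  have *: "conn_graph H \<and> (\<forall>a\<in>verts H. \<forall>b\<in>verts H. graph_dist H a b = f a b)"
  proof (rule conn_graph_distI[OF s])
    show "verts H \<noteq> {}" "f a a = 0" for a by (simp_all add: HV f_def)
    show "f a c \<le> Suc (f a b)" if a: "a \<in> verts H" and bc: "adj H b c" for a b c
    proof -
      have pV: "p a \<in> V" using a u by (auto simp: HV p_def)
      have "f a c \<le> Suc (f a b)" if "adj G b c"
      proof -
        have "b \<in> V" "c \<in> V" using adjD that by auto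
        then show ?thesis using dist_step[OF pV that] V[of b] V[of c] V[of a] hw by (auto simp: f_def)
      qed
      moreover have "f a c \<le> Suc (f a b)" if "{b, c} = {u, w} \<or> {b, c} = {u, w'} \<or> {b, c} = {w, w'}"
        using that a u uw w V[OF u] V[of a] hw
        by (auto simp: doubleton_eq_iff f_def HV)
      ultimately show ?thesis using bc HE by blast
    qed
    show "\<exists>c. adj H c b \<and> f a b = Suc (f a c)" if ab: "a \<in> verts H" "b \<in> verts H" "b \<noteq> a" for a b
    proof -
      consider "b \<notin> V" "a \<notin> V" | "b \<notin> V" "a \<in> V" | "b \<in> V" by blast
      then show ?thesis
      proof cases
        case 1
        then have "{a, b} = {w, w'}" using ab by (auto simp: HV)
        then show ?thesis using w ab
          by (intro exI[of _ a]) (auto simp: HE f_def h_def doubleton_eq_iff)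
      next
        case 2
        then have "b = w \<or> b = w'" using ab by (auto simp: HV)
        then show ?thesis using 2 V[OF 2(2)] V[OF u] hw u
          by (intro exI[of _ u]) (auto simp: HE f_def dist_sym)
      next
        case 3
        have pV: "p a \<in> V" using ab u by (auto simp: HV p_def)
        show ?thesis
        proof (cases "b = p a")
          case True
          then have "a = w \<or> a = w'" "b = u" using ab by (auto simp: p_def split: if_splits)
          then show ?thesis using V[OF u] hw u by (intro exI[of _ a]) (auto simp: HE f_def insert_commute)
        next
          case False
          obtain c where c: "adj G c b" "d (p a) b = Suc (d (p a) c)" using dist_pred[OF pV 3 False] .
          then have "c \<in> V" using adjD by blast
          moreover have "f a c = h a + d (p a) c" if "c \<in> V"
            using that V[OF that] pV by (auto simp: f_def p_def h_def)
          ultimately show ?thesis using c 3 V[OF 3] ab by (intro exI[of _ c]) (auto simp: HE f_def)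
        qed
      qed
    qed
  qed
  then show "conn_graph H" ..
  have D: "graph_dist H a b = f a b" if "a \<in> verts H" "b \<in> verts H" for a b using * that by blast
  show "graph_dist H a b = d a b" if "a \<in> V" "b \<in> V" for a b
    using D[of a b] that V[of a] V[of b] by (auto simp: HV f_def)
  show "graph_dist H w a = Suc (d u a) \<and> graph_dist H a w = Suc (d u a)"
    "graph_dist H w' a = Suc (d u a) \<and> graph_dist H a w' = Suc (d u a)" if "a \<in> V" for a
    using D that V[of a] hw dist_sym[of u a] u by (auto simp: HV f_def)
  show "graph_dist H w w = 0" "graph_dist H w' w' = 0" "graph_dist H w w' = 1" "graph_dist H w' w = 1"
    using D hw w by (auto simp: HV f_def)
qed

lemma block_bound_add_triangle:
  assumes G: "block_bound G I" and u: "u \<in> I" and w: "w \<notin> verts G" "w' \<notin> verts G" "w \<noteq> w'"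
  shows "block_bound (add_triangle G u w w') (insert w' (insert w (I - {u})))"
proof -
  interpret conn_graph G using G by (simp add: block_bound_def)
  have I: "I \<subseteq> V" "finite I" using G finite_V finite_subset by (auto simp: block_bound_def)
  have uV: "u \<in> V" using u I by auto
  note L = add_triangle[OF uV w]
  let ?H = "add_triangle G u w w'"
  have HV: "verts ?H = insert w' (insert w V)" by (simp add: add_triangle_def)
  have main: "qform (rdist ?H) (verts ?H) x \<le> - (\<Sum>v\<in>insert w' (insert w (I - {u})). (x v)\<^sup>2) / 2 \<and>
     ((\<exists>v\<in>verts ?H. x v \<noteq> 0) \<longrightarrow> qform (rdist ?H) (verts ?H) x < 0)" if "sum x (verts ?H) = 0" for x
  proof -
    let ?c = "x w + x w'"
    have sV: "sum x V = - ?c" using that w finite_V by (simp add: HV)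
    have r: "(\<Sum>v\<in>V. rdist ?H y v * x v) = (\<Sum>v\<in>V. rdist G u v * x v) + sum x V" if "y = w \<or> y = w'" for y
      unfolding sum.distrib[symmetric] using that L by (intro sum.cong refl) (auto simp: algebra_simps)
    have "qform (rdist ?H) (verts ?H) x = qform (rdist ?H) (insert w V) x
        + 2 * x w' * (\<Sum>v\<in>insert w V. rdist ?H w' v * x v) + (x w')\<^sup>2 / 2"
      unfolding HV by (rule qform_insert) (use finite_V w L in auto)
    also have "qform (rdist ?H) (insert w V) x = qform (rdist ?H) V x
        + 2 * x w * (\<Sum>v\<in>V. rdist ?H w v * x v) + (x w)\<^sup>2 / 2"
      by (rule qform_insert) (use finite_V w L in auto)
    also have "qform (rdist ?H) V x = qform (rdist G) V x" by (rule qform_cong) (use L in auto)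
    also have "(\<Sum>v\<in>insert w V. rdist ?H w' v * x v) = x w + (\<Sum>v\<in>V. rdist ?H w' v * x v)"
      using finite_V w L by simp
    finally have "qform (rdist ?H) (verts ?H) x
      = (qform (rdist G) V x + 2 * ?c * (\<Sum>v\<in>V. rdist G u v * x v) - ?c\<^sup>2) - ((x w)\<^sup>2 + (x w')\<^sup>2) / 2"
      unfolding r[OF disjI1[OF refl]] r[OF disjI2[OF refl]] sV by (simp add: power2_eq_square field_simps)
    moreover define q where "q = qform (rdist G) V x + 2 * ?c * (\<Sum>v\<in>V. rdist G u v * x v) - ?c\<^sup>2"
    ultimately have qH: "qform (rdist ?H) (verts ?H) x = q - ((x w)\<^sup>2 + (x w')\<^sup>2) / 2" by simp
    note b = block_bound_attach[OF G u sV, folded q_def]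
    have "w \<notin> I - {u}" "w' \<notin> insert w (I - {u})" using I w by auto
    then have s: "(\<Sum>v\<in>insert w' (insert w (I - {u})). (x v)\<^sup>2) = (x w')\<^sup>2 + ((x w)\<^sup>2 + (\<Sum>v\<in>I - {u}. (x v)\<^sup>2))" using I by simp
    have nn: "(\<Sum>v\<in>I - {u}. (x v)\<^sup>2) \<ge> 0" by (simp add: sum_nonneg)
    have "qform (rdist ?H) (verts ?H) x < 0" if v: "v \<in> verts ?H" "x v \<noteq> 0" for v
    proof (cases "x w = 0 \<and> x w' = 0")
      case True
      then have "v \<in> V" using v by (auto simp: HV)
      then show ?thesis using qH b(2)[OF _ _ v(2)] True by simp
    next
      case False
      define A where "A = (x w)\<^sup>2 + (x w')\<^sup>2"
      have "A > 0" using False by (simp add: A_def sum_power2_gt_zero_iff)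
      moreover have "q \<le> 0" using b(1) nn by linarith
      ultimately show ?thesis using qH[folded A_def] by linarith
    qed
    moreover have "qform (rdist ?H) (verts ?H) x \<le> - ((x w')\<^sup>2 + ((x w)\<^sup>2 + (\<Sum>v\<in>I - {u}. (x v)\<^sup>2))) / 2" using qH b(1) by (simp add: field_simps)
    ultimately show ?thesis unfolding s by blast
  qed
  show ?thesis unfolding block_bound_def using L(1) main I by (auto simp: HV)
qed


text \<open>While the path grows, its current tip takes the place of the previous vertex in the set,
  so that the next edge can be hung on it. The final tip is dropped.\<close>

lemma block_bound_attach_path:
  assumes K: "block_bound K I" and x: "x \<in> I"
  shows "block_bound (attach_path x r K) (I - {x})"
proof -
  interpret conn_graph K using K by (simp add: block_bound_def)
  have I: "I \<subseteq> verts K" using K by (simp add: block_bound_def)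
  define w where "w = (\<lambda>i. if i = 0 then x else Max (verts K) + i)"
  have "block_bound (attach_path x r K) (insert (w r) (I - {x}))"
  proof (induction r)
    case 0
    then show ?case using K x by (simp add: w_def insert_absorb)
  next
    case (Suc r)
    have new: "w (Suc r) \<notin> verts (attach_path x r K)"
      using attach_path_new[OF finite_V V_nonempty] by (simp add: w_def)
    have "w r \<notin> I - {x}"
    proof
      assume "w r \<in> I - {x}"
      then have "r \<noteq> 0" "w r \<in> verts K" using I by (auto simp: w_def split: if_splits)
      then show False using Max_ge[OF finite_V, of "w r"] by (simp add: w_def)
    qed
    moreover have "attach_path x (Suc r) K = add_leaf (attach_path x r K) (w r) (w (Suc r))"
      unfolding w_def by (rule attach_path_Suc)
    ultimately show ?case
      using block_bound_add_leaf[OF Suc insertI1 new] by (simp add: Diff_insert_absorb)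
  qed
  then show ?thesis by (rule block_bound_mono) auto
qed

text \<open>For a triangle D + I/2 = J - I/2 with J the all-ones matrix, so on vectors of sum zero
  the bound holds with equality and all three vertices are available for attachments.\<close>

lemma block_bound_triangle:
  assumes "distinct [a, b, c]"
  shows "block_bound ({a, b, c}, {{a, b}, {a, c}, {b, c}}) {a, b, c}"
proof -
  let ?T = "({a, b, c}, {{a, b}, {a, c}, {b, c}})"
  have ne: "a \<noteq> b" "a \<noteq> c" "b \<noteq> c" "b \<noteq> a" "c \<noteq> a" "c \<noteq> b" using assms by auto
  have s: "simple_graph ?T" using assms by (auto simp: simple_graph_def)
  have D: "conn_graph ?T \<and> (\<forall>u\<in>verts ?T. \<forall>v\<in>verts ?T. graph_dist ?T u v = (if u = v then 0 else 1))"
    by (rule conn_graph_distI[OF s]) (use assms in \<open>auto simp: doubleton_eq_iff\<close>)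
  have main: "qform (rdist ?T) (verts ?T) x = - (\<Sum>v\<in>{a, b, c}. (x v)\<^sup>2) / 2" if "sum x {a, b, c} = 0" for x
  proof -
    have x: "x c = - (x a + x b)" using that assms by simp
    have "qform (rdist ?T) (verts ?T) x = qform (\<lambda>u v. if u = v then 0 else 1) {a, b, c} x"
      by (rule trans[OF qform_cong[of _ _ _ x x]]) (use D in auto)
    also have "\<dots> = - (\<Sum>v\<in>{a, b, c}. (x v)\<^sup>2) / 2"
      using ne by (simp add: qform_def x power2_eq_square field_simps)
    finally show ?thesis .
  qed
  have "(\<Sum>v\<in>{a, b, c}. (x v)\<^sup>2) > 0" if "v \<in> {a, b, c}" "x v \<noteq> 0" for x :: "'a \<Rightarrow> real" and v
    by (rule sum_pos2[of _ v]) (use that in auto)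
  then show ?thesis unfolding block_bound_def using D main by auto
qed

text \<open>The graph grows from the first triangle along the path to the second triangle. The path
  tip is used up each time, while the four outer vertices stay available; these are the places where
  \<open>B_paths\<close> attaches its paths.\<close>

lemma block_bound_infinity: "block_bound (infinity_graph s) {s + 1, s + 2, s + 3, s + 4}"
proof -
  define P where "P i = ({..i} \<union> {s + 1, s + 2},
    (\<lambda>k. {k, Suc k}) ` {..<i} \<union> {{0, s + 1}, {0, s + 2}, {s + 1, s + 2}})" for i
  have P: "block_bound (P i) {i, s + 1, s + 2}" if "i \<le> s" for i
    using that
  proof (induction i)
    case 0
    have "P 0 = ({0, s + 1, s + 2}, {{0, s + 1}, {0, s + 2}, {s + 1, s + 2}})" by (auto simp: P_def)
    then show ?case using block_bound_triangle[of 0 "s + 1" "s + 2"] by simp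
  next
    case (Suc i)
    have "P (Suc i) = add_leaf (P i) i (Suc i)"
      by (auto simp: P_def add_leaf_def atMost_Suc lessThan_Suc)
    moreover have "insert (Suc i) ({i, s + 1, s + 2} - {i}) = {Suc i, s + 1, s + 2}" using Suc.prems by auto
    moreover have "Suc i \<notin> verts (P i)" using Suc.prems by (simp add: P_def)
    ultimately show ?case using block_bound_add_leaf[OF Suc.IH, of i "Suc i"] Suc.prems by simp
  qed
  have e1: "infinity_graph s = add_triangle (P s) s (s + 3) (s + 4)"
  proof (rule prod_eqI)
    show "verts (infinity_graph s) = verts (add_triangle (P s) s (s + 3) (s + 4))"
      by (auto simp: verts_infinity_graph add_triangle_def P_def)
    show "edges (infinity_graph s) = edges (add_triangle (P s) s (s + 3) (s + 4))"
      unfolding edges_infinity_graph add_triangle_def P_def snd_conv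
      by (simp only: Un_insert_right Un_empty_right insert_commute)
  qed
  have e2: "insert (s + 4) (insert (s + 3) ({s, s + 1, s + 2} - {s})) = {s + 1, s + 2, s + 3, s + 4}" by auto
  have "block_bound (add_triangle (P s) s (s + 3) (s + 4)) (insert (s + 4) (insert (s + 3) ({s, s + 1, s + 2} - {s})))"
    by (rule block_bound_add_triangle[OF P]) (simp_all add: P_def)
  then show ?thesis unfolding e1[symmetric] e2 .
qed

lemma good_B_paths: "conn_graph (B_paths s h1 h2 h3 h4)" "good (B_paths s h1 h2 h3 h4)"
proof -
  let ?I = "{s + 1, s + 2, s + 3, s + 4} - {s + 1} - {s + 2} - {s + 3} - {s + 4}"
  have b: "block_bound (B_paths s h1 h2 h3 h4) ?I"
    unfolding B_paths_def by (intro block_bound_attach_path block_bound_infinity) auto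
  then show "conn_graph (B_paths s h1 h2 h3 h4)" unfolding block_bound_def by blast
  show "good (B_paths s h1 h2 h3 h4)" using b by (rule block_bound_good)
qed


text \<open>If \<open>c\<close> is adjacent to all other vertices and these have total weight \<open>S\<close>, then \<open>x c\<close> and \<open>S\<close>
  contribute \<open>(x c + 2 * S)\<^sup>2 / 2\<close> to the form, which suggests the hyperplane.\<close>

definition center_form_neg :: "'a graph \<Rightarrow> 'a \<Rightarrow> bool" where
  "center_form_neg G c \<longleftrightarrow> conn_graph G \<and> c \<in> verts G \<and> (\<forall>v\<in>verts G. v \<noteq> c \<longrightarrow> graph_dist G c v = 1) \<and>
     (\<forall>x. x c + 2 * sum x (verts G - {c}) = 0 \<longrightarrow> (\<exists>v\<in>verts G. x v \<noteq> 0) \<longrightarrow> qform (rdist G) (verts G) x < 0)"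

lemma center_form_neg_good: "center_form_neg G c \<Longrightarrow> good G"
  unfolding good_def neg_on_hyperplane_def center_form_neg_def
  by (intro exI[of _ "\<lambda>x. x c + 2 * sum x (verts G - {c})"])
    (auto simp: linear_functional_def sum.distrib sum_distrib_left algebra_simps)

lemma center_form_neg_add_leaf:
  assumes G: "center_form_neg G c" and w: "w \<notin> verts G"
  shows "center_form_neg (add_leaf G c w) c"
proof -
  interpret conn_graph G using G by (simp add: center_form_neg_def)
  have c: "c \<in> V" and dc: "\<And>v. v \<in> V \<Longrightarrow> v \<noteq> c \<Longrightarrow> d c v = 1" using G by (auto simp: center_form_neg_def)
  note L = add_leaf[OF c w]
  let ?H = "add_leaf G c w"
  have neg: "qform (rdist ?H) (verts ?H) x < 0"
    if x: "x c + 2 * sum x (verts ?H - {c}) = 0" and v: "v \<in> verts ?H" "x v \<noteq> 0" for x v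
  proof -
    define S where "S = sum x (V - {c})"
    have "verts ?H - {c} = insert w (V - {c})" using w c by auto
    then have xc: "x c = - 2 * S - 2 * x w" using x w finite_V by (simp add: S_def)
    have dS: "(\<Sum>v\<in>V. rdist G c v * x v) = S"
    proof -
      have "(\<Sum>v\<in>V. rdist G c v * x v) = rdist G c c * x c + (\<Sum>v\<in>V - {c}. rdist G c v * x v)"
        using sum.remove[OF finite_V c] .
      also have "(\<Sum>v\<in>V - {c}. rdist G c v * x v) = S" unfolding S_def by (intro sum.cong refl) (simp add: dc)
      finally show ?thesis using c by simp
    qed
    have sV: "sum x V = x c + S" unfolding S_def using sum.remove[OF finite_V c] .
    \<comment> \<open>The hyperplane of the smaller graph asks for the centre weight
      -2\<open>S\<close>, that of the larger one for -2\<open>S\<close> - 2 \<open>x w\<close>; the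
      factor 2 in the correction is the coefficient in the functional.\<close>
    let ?y = "x(c := x c + 2 * x w)"
    have y: "qform (rdist G) V ?y = qform (rdist G) V x + 2 * (2 * x w) * S + ((x c + 2 * x w)\<^sup>2 - (x c)\<^sup>2) / 2"
      unfolding dS[symmetric] by (rule qform_add_point) (use c finite_V dist_sym in auto)
    have "sum ?y (V - {c}) = S" unfolding S_def by (rule sum.cong) auto
    then have "?y c + 2 * sum ?y (V - {c}) = 0" using xc by simp
    then have yneg: "qform (rdist G) V ?y < 0" if "\<exists>v\<in>V. ?y v \<noteq> 0"
      using G that unfolding center_form_neg_def by blast
    have y0: "qform (rdist G) V ?y \<le> 0"
    proof (cases "\<exists>v\<in>V. ?y v \<noteq> 0")
      case False
      then have "qform (rdist G) V ?y = qform (rdist G) V (\<lambda>_. 0)" by (intro qform_cong) auto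
      then show ?thesis by (simp add: qform_def)
    qed (use yneg in auto)
    have "qform (rdist ?H) (verts ?H) x = qform (rdist ?H) V x + 2 * x w * (\<Sum>v\<in>V. rdist ?H w v * x v) + (x w)\<^sup>2 / 2"
      unfolding verts_add_leaf by (rule qform_insert) (use finite_V w L c in \<open>auto simp: dist_sym[OF c]\<close>)
    also have "qform (rdist ?H) V x = qform (rdist G) V x" by (rule qform_cong) (use L in auto)
    also have "(\<Sum>v\<in>V. rdist ?H w v * x v) = (\<Sum>v\<in>V. rdist G c v * x v) + sum x V"
      unfolding sum.distrib[symmetric] by (intro sum.cong refl) (simp add: L algebra_simps)
    finally have H: "qform (rdist ?H) (verts ?H) x
        = qform (rdist G) V x + 2 * x w * (S + (x c + S)) + (x w)\<^sup>2 / 2"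
      unfolding dS sV .
    have "qform (rdist ?H) (verts ?H) x = qform (rdist G) V ?y - 3 / 2 * (x w)\<^sup>2"
      unfolding H unfolding y unfolding xc by (simp add: power2_eq_square field_simps)
    moreover have "qform (rdist G) V ?y - 3 / 2 * (x w)\<^sup>2 < 0"
    proof (cases "x w = 0")
      case True
      then have "v \<in> V" "?y v \<noteq> 0" using v by auto
      then show ?thesis using yneg True by auto
    next
      case False
      then have "(x w)\<^sup>2 > 0" by simp
      then show ?thesis using y0 by linarith
    qed
    ultimately show ?thesis by simp
  qed
  then show ?thesis unfolding center_form_neg_def using L c dc by auto
qed

lemma center_form_neg_attach_edges:
  assumes "center_form_neg K c"
  shows "center_form_neg (attach_edges c t K) c"
proof (induction t)
  case (Suc t)
  let ?K = "attach_edges c t K"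
  interpret conn_graph ?K using Suc by (simp add: center_form_neg_def)
  have "attach_edges c (Suc t) K = add_leaf ?K c (Max (verts ?K) + 1)"
    using attach_path_Suc[of c 0 ?K] by (simp add: attach_edges_def)
  moreover have "Max (verts ?K) + 1 \<notin> verts ?K" using Max_ge[OF finite_V] by fastforce
  ultimately show ?case using center_form_neg_add_leaf[OF Suc] by simp
qed (use assms in \<open>simp add: attach_edges_def\<close>)

section \<open>Distance tables and factorisations of small graphs\<close>

text \<open>The hypotheses of \<open>conn_graph_distI\<close> in executable form, for a graph on the
  vertices below \<open>n\<close> whose edges are listed in \<open>es\<close>.\<close>

definition distance_table :: "nat \<Rightarrow> (nat \<times> nat) list \<Rightarrow> nat list list \<Rightarrow> bool" where
  "distance_table n es M \<longleftrightarrow> list_all (\<lambda>u. M ! u ! u = 0 \<and>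
     list_all (\<lambda>(i, j). M ! u ! j \<le> Suc (M ! u ! i) \<and> M ! u ! i \<le> Suc (M ! u ! j)) es \<and>
     list_all (\<lambda>v. u = v \<or> list_ex (\<lambda>(i, j). j = v \<and> M ! u ! v = Suc (M ! u ! i) \<or>
        i = v \<and> M ! u ! v = Suc (M ! u ! j)) es) [0..<n]) [0..<n]
   \<and> list_all (\<lambda>(i, j). i < n \<and> j < n \<and> i \<noteq> j) es \<and> 0 < n"

lemma distance_tableD:
  assumes G: "verts G = {..<n}" "edges G = (\<lambda>(i, j). {i, j}) ` set es" and T: "distance_table n es M"
  shows "conn_graph G \<and> (\<forall>u\<in>verts G. \<forall>v\<in>verts G. graph_dist G u v = M ! u ! v)"
proof -
  note T = T[unfolded distance_table_def list_all_iff list_ex_iff set_upt]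
  have es: "i < n \<and> j < n \<and> i \<noteq> j" if "(i, j) \<in> set es" for i j using T that by auto
  have s: "simple_graph G" using es unfolding simple_graph_def G by auto
  have adj: "adj G v w \<longleftrightarrow> (v, w) \<in> set es \<or> (w, v) \<in> set es" for v w
    unfolding G by (auto simp: doubleton_eq_iff image_iff)
  show ?thesis
  proof (rule conn_graph_distI[OF s])
    show "verts G \<noteq> {}" using T G by auto
    show "M ! u ! u = 0" if "u \<in> verts G" for u using T G that by auto
    show "M ! u ! w \<le> Suc (M ! u ! v)" if u: "u \<in> verts G" and vw: "adj G v w" for u v w
    proof -
      have "\<forall>e\<in>set es. case e of (i, j) \<Rightarrow> M ! u ! j \<le> Suc (M ! u ! i) \<and> M ! u ! i \<le> Suc (M ! u ! j)"
        using T u G by auto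
      then show ?thesis using vw adj by fastforce
    qed
    show "\<exists>w. adj G w v \<and> M ! u ! v = Suc (M ! u ! w)" if uv: "u \<in> verts G" "v \<in> verts G" "v \<noteq> u" for u v
    proof -
      have "u \<in> {0..<n}" "v \<in> {0..<n}" using uv G by auto
      then have "u = v \<or> (\<exists>e\<in>set es. case e of (i, j) \<Rightarrow> j = v \<and> M ! u ! v = Suc (M ! u ! i) \<or>
          i = v \<and> M ! u ! v = Suc (M ! u ! j))"
        using T by blast
      then have "\<exists>e\<in>set es. case e of (i, j) \<Rightarrow> j = v \<and> M ! u ! v = Suc (M ! u ! i) \<or> i = v \<and> M ! u ! v = Suc (M ! u ! j)"
        using uv(3) by blast
      then show ?thesis using adj by fastforce
    qed
  qed
qed


text \<open>A factorisation \<open>N (2 D + 1) = \<Sum>k. c k L\<^sub>k\<^sup>T L\<^sub>k\<close> with triangular rows \<open>L\<^sub>k\<close> and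
  negative \<open>c k\<close> for all \<open>k > 0\<close>.\<close>

definition ldl :: "nat list list \<Rightarrow> int \<Rightarrow> int list \<Rightarrow> int list list \<Rightarrow> bool" where
  "ldl M N cs Ls \<longleftrightarrow> (let n = length M in 0 < N \<and>
     list_all (\<lambda>k. Ls ! k ! k \<noteq> 0 \<and> (0 < k \<longrightarrow> cs ! k < 0) \<and> list_all (\<lambda>j. Ls ! k ! j = 0) [0..<k] \<and>
       list_all (\<lambda>j. N * (2 * int (M ! k ! j) + (if k = j then 1 else 0))
         = sum_list (map (\<lambda>i. cs ! i * Ls ! i ! k * Ls ! i ! j) [0..<n])) [0..<n]) [0..<n])"

text \<open>On the kernel of the first row only negative coefficients remain, so the form is at most
  0. It is strictly negative because some row other than the first takes a nonzero value at
  \<open>x\<close>.\<close>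

lemma ldl_qform_neg:
  fixes x :: "nat \<Rightarrow> real"
  assumes "ldl M N cs Ls" and "(\<Sum>j<length M. real_of_int (Ls ! 0 ! j) * x j) = 0" and "v < length M" "x v \<noteq> 0"
  shows "qform (\<lambda>i j. real (M ! i ! j)) {..<length M} x < 0"
proof -
  define n where "n = length M"
  define L where "L k j = real_of_int (Ls ! k ! j)" for k j
  define c where "c k = real_of_int (cs ! k)" for k
  note * = assms(1)[unfolded ldl_def Let_def list_all_iff set_upt, folded n_def]
  have N: "N > 0" using * by blast
  have diag: "L k k \<noteq> 0" if "k < n" for k using * that by (auto simp: L_def)
  have neg: "c k < 0" if "0 < k" "k < n" for k using * that by (auto simp: c_def)
  have tri: "L k j = 0" if "j < k" "k < n" for k j using * that by (auto simp: L_def)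
  have eq: "N * (2 * real (M ! i ! j) + (if i = j then 1 else 0)) = (\<Sum>k<n. c k * L k i * L k j)"
    if "i < n" "j < n" for i j
  proof -
    have "N * (2 * int (M ! i ! j) + (if i = j then 1 else 0)) = sum_list (map (\<lambda>k. cs ! k * Ls ! k ! i * Ls ! k ! j) [0..<n])"
      using * that by auto
    also have "\<dots> = (\<Sum>k<n. cs ! k * Ls ! k ! i * Ls ! k ! j)"
      by (simp add: sum_list_sum_nth atLeast0LessThan)
    finally have "real_of_int (N * (2 * int (M ! i ! j) + (if i = j then 1 else 0)))
      = real_of_int (\<Sum>k<n. cs ! k * Ls ! k ! i * Ls ! k ! j)" by (rule arg_cong)
    then show ?thesis by (simp add: c_def L_def split: if_splits)
  qed
  define y where "y k = (\<Sum>j<n. L k j * x j)" for k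
  have q: "2 * N * qform (\<lambda>i j. real (M ! i ! j)) {..<n} x = (\<Sum>k<n. c k * (y k)\<^sup>2)"
  proof -
    have "2 * N * qform (\<lambda>i j. real (M ! i ! j)) {..<n} x
      = (\<Sum>i<n. \<Sum>j<n. N * (2 * real (M ! i ! j) + (if i = j then 1 else 0)) * (x i * x j))"
    proof -
      have "(\<Sum>j<n. (if i = j then 1 else 0) * (x i * x j)) = (x i)\<^sup>2" if "i < n" for i
        using that by (simp add: if_distrib[of "\<lambda>z. z * _"] power2_eq_square cong: if_cong)
      then have *: "(\<Sum>i<n. (x i)\<^sup>2) = (\<Sum>i<n. \<Sum>j<n. (if i = j then 1 else 0) * (x i * x j))" by simp
      show ?thesis
        unfolding qform_def * by (simp add: sum.distrib sum_distrib_left distrib_left distrib_right mult_ac)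
    qed
    also have "\<dots> = (\<Sum>i<n. \<Sum>j<n. \<Sum>k<n. c k * (L k i * x i * (L k j * x j)))"
      by (intro sum.cong refl) (simp add: eq sum_distrib_right sum_distrib_left mult_ac)
    also have "\<dots> = (\<Sum>i<n. \<Sum>k<n. \<Sum>j<n. c k * (L k i * x i * (L k j * x j)))"
      by (intro sum.cong refl sum.swap)
    also have "\<dots> = (\<Sum>k<n. \<Sum>i<n. \<Sum>j<n. c k * (L k i * x i * (L k j * x j)))"
      by (rule sum.swap)
    also have "\<dots> = (\<Sum>k<n. c k * (y k)\<^sup>2)"
      by (simp only: y_def power2_eq_square sum_product) (simp only: sum_distrib_left)
    finally show ?thesis .
  qed
  have y0: "y 0 = 0" and v: "v < n" "x v \<noteq> 0" using assms(2-4) by (simp_all add: y_def L_def n_def)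
  have "qform (\<lambda>i j. real (M ! i ! j)) {..<n} x < 0"
  proof -
    let ?S = "{j. j < n \<and> x j \<noteq> 0}"
    \<comment> \<open>At the last nonzero coordinate, the triangular row \<open>j\<close> reduces to
      its diagonal term, so it cannot vanish. In particular \<open>j\<close> is not 0, as row 0
      vanishes at \<open>x\<close>.\<close>
    define j where "j = Max ?S"
    have S: "finite ?S" "?S \<noteq> {}" using v by auto
    have j: "j < n" "x j \<noteq> 0" using Max_in[OF S] by (auto simp: j_def)
    have above: "x i = 0" if "j < i" "i < n" for i
    proof (rule ccontr)
      assume "x i \<noteq> 0"
      then have "i \<le> j" unfolding j_def using that by (intro Max_ge[OF S(1)]) simp
      then show False using that by simp
    qed
    have "y j = (\<Sum>i<n. if i = j then L j j * x j else 0)"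
      unfolding y_def
    proof (intro sum.cong refl)
      fix i assume "i \<in> {..<n}"
      then show "L j i * x i = (if i = j then L j j * x j else 0)"
        using tri[of i j] above[of i] j by (cases i j rule: linorder_cases) auto
    qed
    then have yj: "y j \<noteq> 0" using j diag by simp
    then have "j \<noteq> 0" using y0 by metis
    have "(\<Sum>k<n. c k * (y k)\<^sup>2) < (\<Sum>k<n. 0)"
    proof (rule sum_strict_mono_ex1)
      show "\<forall>k\<in>{..<n}. c k * (y k)\<^sup>2 \<le> 0"
      proof
        fix k assume "k \<in> {..<n}"
        then show "c k * (y k)\<^sup>2 \<le> 0" using neg[of k] y0 by (cases "k = 0") (auto simp: mult_le_0_iff)
      qed
      show "\<exists>k\<in>{..<n}. c k * (y k)\<^sup>2 < 0"
        using j yj \<open>j \<noteq> 0\<close> neg[of j] by (intro bexI[of _ j]) (auto simp: mult_less_0_iff)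
    qed simp
    then have "2 * N * qform (\<lambda>i j. real (M ! i ! j)) {..<n} x < 0" using q by simp
    then show ?thesis using N by (simp add: mult_less_0_iff)
  qed
  then show ?thesis by (simp add: n_def)
qed

lemma ldl_neg_on_hyperplane:
  assumes "ldl M N cs Ls"
  shows "neg_on_hyperplane (\<lambda>i j. real (M ! i ! j)) {..<length M}"
  unfolding neg_on_hyperplane_def
  using ldl_qform_neg[OF assms]
  by (intro exI[of _ "\<lambda>x. \<Sum>j<length M. real_of_int (Ls ! 0 ! j) * x j"])
    (auto simp: linear_functional_def sum.distrib sum_distrib_left algebra_simps)

lemma good_tableI:
  assumes "verts G = {..<n}" "edges G = (\<lambda>(i, j). {i, j}) ` set es" "distance_table n es M"
    and "length M = n" "ldl M N cs Ls"
  shows "conn_graph G \<and> good G"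
proof -
  note D = distance_tableD[OF assms(1-3)]
  have "neg_on_hyperplane (rdist G) (verts G)"
    using ldl_neg_on_hyperplane[OF assms(5)]
    by (rule neg_on_hyperplane_inj[of _ _ id]) (use D assms(1,4) in auto)
  then show ?thesis using D by (simp add: good_def)
qed


lemma attach_path_lessThan:
  assumes "0 < n"
  shows "attach_path x 1 ({..<n}, E) = ({..<n + 1}, insert {x, n} E)"
    and "attach_path x 2 ({..<n}, E) = ({..<n + 2}, insert {n, n + 1} (insert {x, n} E))"
proof -
  have M: "Max {..<n} = n - 1" using assms by (intro Max_eqI) auto
  show 1: "attach_path x 1 ({..<n}, E) = ({..<n + 1}, insert {x, n} E)"
    using attach_path_Suc[of x 0 "({..<n}, E)"] assms M by (auto simp: add_leaf_def)
  show "attach_path x 2 ({..<n}, E) = ({..<n + 2}, insert {n, n + 1} (insert {x, n} E))"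
    using attach_path_Suc[of x 1 "({..<n}, E)"] 1 assms M by (auto simp: add_leaf_def numeral_2_eq_2)
qed

lemma infinity_graph_numeral:
  "infinity_graph 0 = ({..<5}, {{0,1}, {0,2}, {1,2}, {0,3}, {0,4}, {3,4}})"
  "infinity_graph 1 = ({..<6}, {{0,1}, {0,2}, {0,3}, {2,3}, {1,4}, {1,5}, {4,5}})"
  "infinity_graph 2 = ({..<7}, {{0,1}, {1,2}, {0,3}, {0,4}, {3,4}, {2,5}, {2,6}, {5,6}})"
proof -
  have *: "infinity_graph s = ({..<s + 5}, edges (infinity_graph s))" for s
    by (rule prod_eqI) (auto simp: verts_infinity_graph)
  show "infinity_graph 0 = ({..<5}, {{0,1}, {0,2}, {1,2}, {0,3}, {0,4}, {3,4}})"
    "infinity_graph 1 = ({..<6}, {{0,1}, {0,2}, {0,3}, {2,3}, {1,4}, {1,5}, {4,5}})"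
    "infinity_graph 2 = ({..<7}, {{0,1}, {1,2}, {0,3}, {0,4}, {3,4}, {2,5}, {2,6}, {5,6}})"
    by (subst *, simp add: edges_infinity_graph lessThan_Suc numeral_eq_Suc insert_commute)+
qed

lemma theta_graph_lessThan: "theta_graph = ({..<4}, {{0,1}, {0,2}, {0,3}, {1,2}, {1,3}})"
  by (rule prod_eqI) (auto simp: theta_graph_def)

lemmas numeral_graphs = attach_edges_numeral attach_path_lessThan attach_path_lessThan(1)[unfolded One_nat_def]
  infinity_graph_numeral infinity_graph_numeral(2)[unfolded One_nat_def] theta_graph_lessThan

text \<open>The certificates come from Gaussian elimination on 2D + I with vertex 0 as first pivot:
  the first row listed is row 0 of 2D + I itself, and \<open>N\<close> clears the denominators of
  the later pivots. The other six graphs follow the same scheme.\<close>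

lemma good_B1: "conn_graph B1 \<and> good B1"
  by (rule good_tableI[of _ 8 "[(0,1), (0,2), (0,3), (1,4), (1,5), (2,3), (2,6), (2,7), (4,5)]"
        "[[0,1,1,1,2,2,2,2], [1,0,2,2,1,1,3,3], [1,2,0,1,3,3,1,1], [1,2,1,0,3,3,2,2], [2,1,3,3,0,1,4,4], [2,1,3,3,1,0,4,4], [2,3,1,2,4,4,0,2], [2,3,1,2,4,4,2,0]]"
        105 "[105, -35, -35, -7, -3, -135, -7, -63]"
        "[[1,2,2,2,4,4,4,4], [0,-3,0,0,-6,-6,-2,-2], [0,0,-3,-2,-2,-2,-6,-6], [0,0,0,-5,-2,-2,0,0], [0,0,0,0,-7,-2,0,0], [0,0,0,0,0,-1,0,0], [0,0,0,0,0,0,-5,4], [0,0,0,0,0,0,0,-1]]"],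
      simp add: B1_def numeral_graphs, simp add: B1_def numeral_graphs insert_commute, code_simp, simp, code_simp)

lemma good_B2: "conn_graph B2 \<and> good B2"
  by (rule good_tableI[of _ 9 "[(0,1), (0,3), (0,4), (0,7), (1,2), (2,5), (2,6), (2,8), (3,4), (5,6)]"
        "[[0,1,2,1,1,3,3,1,3], [1,0,1,2,2,2,2,2,2], [2,1,0,3,3,1,1,3,1], [1,2,3,0,1,4,4,2,4], [1,2,3,1,0,4,4,2,4], [3,2,1,4,4,0,1,4,2], [3,2,1,4,4,1,0,4,2], [1,2,3,2,2,4,4,0,4], [3,2,1,4,4,2,2,4,0]]"
        105 "[105, -35, -35, -7, -3, -7, -3, -15, -15]"
        "[[1,2,4,2,2,6,6,2,6], [0,-3,-6,0,0,-8,-8,0,-8], [0,0,-3,-2,-2,-6,-6,-2,-6], [0,0,0,-5,-2,0,0,4,0], [0,0,0,0,-7,0,0,4,0], [0,0,0,0,0,-5,-2,0,4], [0,0,0,0,0,0,-7,0,4], [0,0,0,0,0,0,0,-1,0], [0,0,0,0,0,0,0,0,-1]]"],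
      simp add: B2_def numeral_graphs, simp add: B2_def numeral_graphs insert_commute, code_simp, simp, code_simp)

lemma good_B3: "conn_graph B3 \<and> good B3"
  by (rule good_tableI[of _ 8 "[(0,1), (0,3), (0,4), (0,7), (1,2), (2,5), (2,6), (3,4), (5,6)]"
        "[[0,1,2,1,1,3,3,1], [1,0,1,2,2,2,2,2], [2,1,0,3,3,1,1,3], [1,2,3,0,1,4,4,2], [1,2,3,1,0,4,4,2], [3,2,1,4,4,0,1,4], [3,2,1,4,4,1,0,4], [1,2,3,2,2,4,4,0]]"
        105 "[105, -35, -35, -7, -3, -7, -147, -15]"
        "[[1,2,4,2,2,6,6,2], [0,-3,-6,0,0,-8,-8,0], [0,0,-3,-2,-2,-6,-6,-2], [0,0,0,-5,-2,0,0,4], [0,0,0,0,-7,0,0,4], [0,0,0,0,0,-5,-2,0], [0,0,0,0,0,0,-1,0], [0,0,0,0,0,0,0,-1]]"],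
      simp add: B3_def numeral_graphs, simp add: B3_def numeral_graphs insert_commute, code_simp, simp, code_simp)

lemma good_B4: "conn_graph B4 \<and> good B4"
  by (rule good_tableI[of _ 8 "[(0,1), (0,2), (0,3), (0,4), (0,5), (1,2), (1,6), (3,4), (6,7)]"
        "[[0,1,1,1,1,1,2,3], [1,0,1,2,2,2,1,2], [1,1,0,2,2,2,2,3], [1,2,2,0,1,2,3,4], [1,2,2,1,0,2,3,4], [1,2,2,2,2,0,3,4], [2,1,2,3,3,3,0,1], [3,2,3,4,4,4,1,0]]"
        15 "[15, -5, -1, -5, -1, -5, -1, -21]"
        "[[1,2,2,2,2,2,4,6], [0,-3,-2,0,0,0,-6,-8], [0,0,-5,0,0,0,0,-2], [0,0,0,-3,-2,0,-2,-4], [0,0,0,0,-5,0,-2,-4], [0,0,0,0,0,-3,-2,-4], [0,0,0,0,0,0,-1,-2], [0,0,0,0,0,0,0,-1]]"],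
      simp add: B4_def numeral_graphs, simp add: B4_def numeral_graphs insert_commute, code_simp, simp, code_simp)

lemma good_B5: "conn_graph B5 \<and> good B5"
  by (rule good_tableI[of _ 7 "[(0,1), (0,2), (0,3), (0,4), (0,5), (1,2), (1,6), (3,4)]"
        "[[0,1,1,1,1,1,2], [1,0,1,2,2,2,1], [1,1,0,2,2,2,2], [1,2,2,0,1,2,3], [1,2,2,1,0,2,3], [1,2,2,2,2,0,3], [2,1,2,3,3,3,0]]"
        15 "[15, -5, -25, -5, -1, -5, -1]"
        "[[1,2,2,2,2,2,4], [0,-3,-2,0,0,0,-6], [0,0,-1,0,0,0,0], [0,0,0,-3,-2,0,-2], [0,0,0,0,-5,0,-2], [0,0,0,0,0,-3,-2], [0,0,0,0,0,0,-1]]"],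
      simp add: B5_def numeral_graphs, simp add: B5_def numeral_graphs insert_commute, code_simp, simp, code_simp)

lemma good_B6: "conn_graph B6 \<and> good B6"
  by (rule good_tableI[of _ 6 "[(0,1), (0,2), (0,3), (0,4), (1,2), (1,3), (1,5)]"
        "[[0,1,1,1,1,2], [1,0,1,1,2,1], [1,1,0,2,2,2], [1,1,2,0,2,2], [1,2,2,2,0,3], [2,1,2,2,3,0]]"
        15 "[15, -5, -1, -9, -5, -25]"
        "[[1,2,2,2,2,4], [0,-3,-2,-2,0,-6], [0,0,-5,4,0,0], [0,0,0,-1,0,0], [0,0,0,0,-3,-2], [0,0,0,0,0,-1]]"],
      simp add: B6_def numeral_graphs, simp add: B6_def numeral_graphs insert_commute, code_simp, simp, code_simp)

lemma good_B7: "conn_graph B7 \<and> good B7"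
  by (rule good_tableI[of _ 7 "[(0,1), (0,2), (0,3), (0,4), (0,5), (1,2), (1,3), (1,6)]"
        "[[0,1,1,1,1,1,2], [1,0,1,1,2,2,1], [1,1,0,2,2,2,2], [1,1,2,0,2,2,2], [1,2,2,2,0,2,3], [1,2,2,2,2,0,3], [2,1,2,2,3,3,0]]"
        15 "[15, -5, -1, -9, -5, -5, -5]"
        "[[1,2,2,2,2,2,4], [0,-3,-2,-2,0,0,-6], [0,0,-5,4,0,0,0], [0,0,0,-1,0,0,0], [0,0,0,0,-3,0,-2], [0,0,0,0,0,-3,-2], [0,0,0,0,0,0,-1]]"],
      simp add: B7_def numeral_graphs, simp add: B7_def numeral_graphs insert_commute, code_simp, simp, code_simp)



text \<open>For a dominating vertex 0, row 0 of 2D + I is (1, 2, ..., 2), so eliminating it yields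
  precisely the hyperplane of \<open>center_form_neg\<close>.\<close>

lemma center_form_neg_tableI:
  assumes "verts G = {..<n}" "edges G = (\<lambda>(i, j). {i, j}) ` set es" "distance_table n es M"
    and "length M = n" "ldl M N cs Ls" "Ls ! 0 = 1 # replicate (n - 1) 2"
    and "list_all (\<lambda>v. v = 0 \<or> M ! 0 ! v = 1) [0..<n]"
  shows "center_form_neg G 0"
proof -
  note D = distance_tableD[OF assms(1-3)]
  have n: "0 < n" using assms(3) by (simp add: distance_table_def)
  have neg: "qform (rdist G) (verts G) x < 0"
    if x: "x 0 + 2 * sum x (verts G - {0}) = 0" and v: "v \<in> verts G" "x v \<noteq> 0" for x v
  proof -
    have "(\<Sum>j<n. real_of_int (Ls ! 0 ! j) * x j) = real_of_int (Ls ! 0 ! 0) * x 0 + (\<Sum>j\<in>{..<n} - {0}. real_of_int (Ls ! 0 ! j) * x j)"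
      using n by (intro sum.remove) auto
    also have "(\<Sum>j\<in>{..<n} - {0}. real_of_int (Ls ! 0 ! j) * x j) = (\<Sum>j\<in>{..<n} - {0}. 2 * x j)"
      by (intro sum.cong refl) (auto simp: assms(6) nth_Cons split: nat.split)
    finally have "(\<Sum>j<length M. real_of_int (Ls ! 0 ! j) * x j) = 0"
      using x by (simp add: assms(1,4,6) sum_distrib_left)
    then have "qform (\<lambda>i j. real (M ! i ! j)) {..<n} x < 0"
      using ldl_qform_neg[OF assms(5), of x v] v assms(1,4) by simp
    also have "qform (\<lambda>i j. real (M ! i ! j)) {..<n} x = qform (rdist G) (verts G) x"
      unfolding assms(1) by (rule qform_cong) (use D assms(1) in auto)
    finally show ?thesis .
  qed
  have "M ! 0 ! v = 1" if "v < n" "v \<noteq> 0" for v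
    using bspec[OF assms(7)[unfolded list_all_iff], of v] that by simp
  then have "graph_dist G 0 v = 1" if "v \<in> verts G" "v \<noteq> 0" for v using D n assms(1) that by simp
  note dist = this
  have "0 \<in> verts G" using n assms(1) by simp
  moreover have "\<forall>x. x 0 + 2 * sum x (verts G - {0}) = 0 \<longrightarrow> (\<exists>v\<in>verts G. x v \<noteq> 0) \<longrightarrow> qform (rdist G) (verts G) x < 0"
  proof (intro allI impI)
    fix x :: "nat \<Rightarrow> real" assume x: "x 0 + 2 * sum x (verts G - {0}) = 0" and "\<exists>v\<in>verts G. x v \<noteq> 0"
    then obtain v where "v \<in> verts G" "x v \<noteq> 0" by blast
    then show "qform (rdist G) (verts G) x < 0" by (rule neg[OF x])
  qed
  moreover have "conn_graph G" using D ..
  ultimately show ?thesis unfolding center_form_neg_def using dist by blast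
qed

lemma center_form_neg_infinity_graph_0: "center_form_neg (infinity_graph 0) 0"
  by (rule center_form_neg_tableI[of _ 5 "[(0,1), (0,2), (0,3), (0,4), (1,2), (3,4)]"
        "[[0,1,1,1,1], [1,0,1,2,2], [1,1,0,2,2], [1,2,2,0,1], [1,2,2,1,0]]"
        3 "[3, -1, -5, -1, -5]"
        "[[1,2,2,2,2], [0,-3,-2,0,0], [0,0,-1,0,0], [0,0,0,-3,-2], [0,0,0,0,-1]]"],
      simp add: numeral_graphs, simp add: numeral_graphs insert_commute, code_simp, simp, code_simp, simp add: numeral_eq_Suc, code_simp)

lemma center_form_neg_theta_graph: "center_form_neg (theta_graph) 0"
  by (rule center_form_neg_tableI[of _ 4 "[(0,1), (0,2), (0,3), (1,2), (1,3)]"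
        "[[0,1,1,1], [1,0,1,1], [1,1,0,2], [1,1,2,0]]"
        15 "[15, -5, -1, -9]"
        "[[1,2,2,2], [0,-3,-2,-2], [0,0,-5,4], [0,0,0,-1]]"],
      simp add: numeral_graphs, simp add: numeral_graphs insert_commute, code_simp, simp, code_simp, simp add: numeral_eq_Suc, code_simp)

lemma good_B_inf: "conn_graph (B_inf t)" "good (B_inf t)"
  and good_B_theta: "conn_graph (B_theta t)" "good (B_theta t)"
proof -
  have "center_form_neg (B_inf t) 0" "center_form_neg (B_theta t) 0"
    unfolding B_inf_def B_theta_def
    by (intro center_form_neg_attach_edges center_form_neg_infinity_graph_0 center_form_neg_theta_graph)+
  note c = this
  show "good (B_inf t)" "good (B_theta t)" using c by (auto intro: center_form_neg_good)
  show "conn_graph (B_inf t)" "conn_graph (B_theta t)" using c by (simp_all add: center_form_neg_def)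
qed

section \<open>The equivalence for bicyclic graphs\<close>

lemma listed_good:
  assumes "conn_graph G" "listed G"
  shows "good G"
proof -
  obtain B :: "nat graph" where B: "conn_graph B" "good B" "graph_iso G B"
  proof -
    from assms(2)[unfolded listed_def]
    consider B where "B \<in> {B1, B2, B3, B4, B5, B6, B7}" "graph_iso G B"
      | s h1 h2 h3 h4 where "graph_iso G (B_paths s h1 h2 h3 h4)"
      | t where "graph_iso G (B_inf t)" | k where "graph_iso G (B_theta k)" by metis
    then show ?thesis
    proof cases
      case 1
      then have "conn_graph B \<and> good B"
        using good_B1 good_B2 good_B3 good_B4 good_B5 good_B6 good_B7 by auto
      then show ?thesis using that 1 by blast
    qed (use that good_B_paths good_B_inf good_B_theta in metis)+
  qed
  then show ?thesis using good_iso[OF assms(1) _ B(3)] by (simp add: conn_graph_def)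
qed

lemma good_bicyclic_listed:
  assumes "conn_graph G" "good G" "card (edges G) = card (verts G) + 1"
  shows "listed G"
proof -
  obtain C l where Cl: "C = theta_graph \<or> (\<exists>s. C = infinity_graph s)" "finite_legs C l" "graph_iso G (spider C l)"
    using good_bicyclic_spider[OF assms] by blast
  have "simple_graph C" using Cl(1) simple_theta_graph simple_infinity_graph by blast
  then have S: "simple_graph (spider C l)" using Cl(2) by (rule simple_spider)
  have "conn_graph (spider C l)"
    using Cl(3) graph_iso_conn_graph(1)[OF assms(1) S] unfolding graph_iso_def by blast
  moreover have "good (spider C l)" using good_iso[OF assms(1) S Cl(3)] assms(2) by simp
  ultimately have "good_spider C l" using Cl(2) by (simp add: good_spider_def)
  then have "listed (spider C l)" using Cl(1) listed_theta listed_infinity by blast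
  then show ?thesis using Cl(3) listed_iso by blast
qed

lemma distance_eigenvalue_2_less_iff:
  assumes G: "conn_graph G" and vs: "distinct vs" "set vs = verts G" "length vs \<ge> 2"
  shows "distance_eigenvalue G vs 2 < - 1 / 2 \<longleftrightarrow> good G"
proof -
  interpret conn_graph G by (rule G)
  have "rdist G u v = rdist G v u" if "u \<in> V" "v \<in> V" for u v using dist_sym that by simp
  then show ?thesis
    unfolding distance_eigenvalue_def distance_matrix_def good_def
    by (rule kth_eigenvalue_2_less_iff[OF vs])
qed

theorem theorem4p1:
  fixes G :: "'a graph" and vs :: "'a list"
  assumes "bicyclic G"
    and "distinct vs" and "set vs = verts G"
  shows "distance_eigenvalue G vs 2 < - 1 / 2 \<longleftrightarrow>
      (\<exists>B \<in> {B1, B2, B3, B4, B5, B6, B7}. graph_iso G B)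
    \<or> (\<exists>s h1 h2 h3 h4. graph_iso G (B_paths s h1 h2 h3 h4))
    \<or> (\<exists>t. graph_iso G (B_inf t))
    \<or> (\<exists>k. graph_iso G (B_theta k))"
proof -
  have G: "conn_graph G" and bic: "card (edges G) = card (verts G) + 1"
    using assms(1) by (simp_all add: bicyclic_def conn_graph_def)
  interpret conn_graph G by (rule G)
  \<comment> \<open>A second eigenvalue exists only if there are two vertices, and the non-adjacent
    pair provides them.\<close>
  obtain u v where "u \<in> V" "v \<in> V" "u \<noteq> v" using bicyclic_not_complete[OF bic] by blast
  then have "card {u, v} \<le> card V" using finite_V by (intro card_mono) auto
  then have "length vs \<ge> 2" using \<open>u \<noteq> v\<close> assms(2,3) distinct_card[of vs] by simp
  then have "distance_eigenvalue G vs 2 < - 1 / 2 \<longleftrightarrow> good G"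
    by (rule distance_eigenvalue_2_less_iff[OF G assms(2,3)])
  also have "\<dots> \<longleftrightarrow> listed G"
    using listed_good[OF G] good_bicyclic_listed[OF G _ bic] by blast
  finally show ?thesis unfolding listed_def .
qed

end
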